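(* The subset sum problem with digraph constraint (SSG), restricted to instances whose digraph $G$ is a directed co-graph with $n$ vertices and $m$ arcs, can be solved in $\mathcal{O}(n\cdot c^2+m)$ time and $\mathcal{O}(n\cdot c)$ space, where $c$ is the capacity.
   Context: An instance consists of a set $A=\{a_1,\ldots,a_n\}$ of items, each $a_j$ with a positive integer size $s_j$, a positive integer capacity $c$, and a digraph $G=(A,E)$ without loops on the items. For $A'\subseteq A$ let $s(A')=\sum_{a_j\in A'}s_j$, and for $y\in A$ let $N^-(y)=\{u\in A : (u,y)\in E\}$ be the set of predecessors of $y$. The capacity constraint is $s(A')\le c$. The digraph constraint is: for every $y\in A$, if $N^-(y)\cap A'\neq\emptyset$ then $y\in A'$. SSG asks for a subset $A'\subseteq A$ maximizing $s(A')$ subject to the capacity constraint and the digraph constraint. Directed co-graphs: for vertex-disjoint digraphs $G_1=(V_1,E_1)$, $G_2=(V_2,E_2)$, the disjoint union $G_1\oplus G_2$ has vertex set $V_1\cup V_2$ and arc set $E_1\cup E_2$; the series composition $G_1\otimes G_2$ is the disjoint union plus all arcs $(u,v)$ and $(v,u)$ for $u\in V_1$, $v\in V_2$; the order composition $G_1\oslash G_2$ is the disjoint union plus all arcs $(u,v)$ for $u\in V_1$, $v\in V_2$. The class of directed co-graphs is the smallest class containing every single-vertex digraph and closed under $\oplus$, $\otimes$, $\oslash$ applied to vertex-disjoint members. *)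

theory Defs
  imports "Graph_Theory.Pair_Digraph"
begin

section \<open>Directed co-graphs\<close>

definition disjoint_union :: "'a pair_pre_digraph \<Rightarrow> 'a pair_pre_digraph \<Rightarrow> 'a pair_pre_digraph"
  where "disjoint_union G1 G2 =
    \<lparr> pverts = pverts G1 \<union> pverts G2, parcs = parcs G1 \<union> parcs G2 \<rparr>"

definition series_composition :: "'a pair_pre_digraph \<Rightarrow> 'a pair_pre_digraph \<Rightarrow> 'a pair_pre_digraph"
  where "series_composition G1 G2 =
    \<lparr> pverts = pverts G1 \<union> pverts G2,
      parcs = parcs G1 \<union> parcs G2 \<union> pverts G1 \<times> pverts G2 \<union> pverts G2 \<times> pverts G1 \<rparr>"

definition order_composition :: "'a pair_pre_digraph \<Rightarrow> 'a pair_pre_digraph \<Rightarrow> 'a pair_pre_digraph"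
  where "order_composition G1 G2 =
    \<lparr> pverts = pverts G1 \<union> pverts G2,
      parcs = parcs G1 \<union> parcs G2 \<union> pverts G1 \<times> pverts G2 \<rparr>"

inductive directed_cograph :: "'a pair_pre_digraph \<Rightarrow> bool" where
  single: "directed_cograph \<lparr> pverts = {v}, parcs = {} \<rparr>"
| union: "\<lbrakk> directed_cograph G1; directed_cograph G2; pverts G1 \<inter> pverts G2 = {} \<rbrakk>
    \<Longrightarrow> directed_cograph (disjoint_union G1 G2)"
| series: "\<lbrakk> directed_cograph G1; directed_cograph G2; pverts G1 \<inter> pverts G2 = {} \<rbrakk>
    \<Longrightarrow> directed_cograph (series_composition G1 G2)"
| order: "\<lbrakk> directed_cograph G1; directed_cograph G2; pverts G1 \<inter> pverts G2 = {} \<rbrakk>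
    \<Longrightarrow> directed_cograph (order_composition G1 G2)"


section \<open>Subset sum with digraph constraint\<close>

text \<open>The items are the numbers below \<open>n\<close>; item \<open>j\<close> has size \<open>s j\<close>.\<close>

definition ssg_instance :: "nat \<Rightarrow> (nat \<Rightarrow> nat) \<Rightarrow> nat \<Rightarrow> nat pair_pre_digraph \<Rightarrow> bool" where
  "ssg_instance n s c G \<longleftrightarrow>
     pair_digraph G \<and> pverts G = {..<n} \<and> (\<forall>j<n. 0 < s j) \<and> 0 < c"

definition predecessors :: "'a pair_pre_digraph \<Rightarrow> 'a \<Rightarrow> 'a set" where
  "predecessors G y = {u \<in> pverts G. (u, y) \<in> parcs G}"

definition capacity_constraint :: "('a \<Rightarrow> nat) \<Rightarrow> nat \<Rightarrow> 'a set \<Rightarrow> bool" where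
  "capacity_constraint s c A' \<longleftrightarrow> sum s A' \<le> c"

definition digraph_constraint :: "'a pair_pre_digraph \<Rightarrow> 'a set \<Rightarrow> bool" where
  "digraph_constraint G A' \<longleftrightarrow>
     (\<forall>y \<in> pverts G. predecessors G y \<inter> A' \<noteq> {} \<longrightarrow> y \<in> A')"

definition ssg_feasible :: "('a \<Rightarrow> nat) \<Rightarrow> nat \<Rightarrow> 'a pair_pre_digraph \<Rightarrow> 'a set \<Rightarrow> bool" where
  "ssg_feasible s c G A' \<longleftrightarrow>
     A' \<subseteq> pverts G \<and> capacity_constraint s c A' \<and> digraph_constraint G A'"

definition ssg_solution :: "('a \<Rightarrow> nat) \<Rightarrow> nat \<Rightarrow> 'a pair_pre_digraph \<Rightarrow> 'a set \<Rightarrow> bool" where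
  "ssg_solution s c G A' \<longleftrightarrow> is_arg_max (sum s) (ssg_feasible s c G) A'"


section \<open>A word RAM\<close>

text \<open>
  Programs of a random access machine with a read-only input tape that can be addressed directly,
  a working memory, and registers. Space is the number of memory cells; as usual for bounds below
  the input size, the input is not counted. A program mentions only finitely many registers, so
  these contribute a constant. The control structure is that of while programs, which
  changes running times by a constant factor only compared with jumps.
\<close>

datatype operand = Imm nat | Reg nat
datatype arith = Add | Sub | Mul
datatype test = Less operand operand | Equal operand operand

datatype com =
    Skip
  | Assign nat arith operand operand
  | ReadInput nat operand
  | Load nat operand
  | Store operand operand
  | Seq com com
  | If test com com
  | While test com

record ram_state =
  regs :: "nat \<Rightarrow> nat"
  mem :: "nat \<Rightarrow> nat"

definition initial_state :: ram_state where
  "initial_state = \<lparr> regs = (\<lambda>_. 0), mem = (\<lambda>_. 0) \<rparr>"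

primrec operand_val :: "ram_state \<Rightarrow> operand \<Rightarrow> nat" where
  "operand_val \<sigma> (Imm k) = k"
| "operand_val \<sigma> (Reg r) = regs \<sigma> r"

text \<open>Subtraction is truncated at zero.\<close>

primrec arith_val :: "arith \<Rightarrow> nat \<Rightarrow> nat \<Rightarrow> nat" where
  "arith_val Add x y = x + y"
| "arith_val Sub x y = x - y"
| "arith_val Mul x y = x * y"

primrec test_val :: "ram_state \<Rightarrow> test \<Rightarrow> bool" where
  "test_val \<sigma> (Less a b) \<longleftrightarrow> operand_val \<sigma> a < operand_val \<sigma> b"
| "test_val \<sigma> (Equal a b) \<longleftrightarrow> operand_val \<sigma> a = operand_val \<sigma> b"

definition set_reg :: "nat \<Rightarrow> nat \<Rightarrow> ram_state \<Rightarrow> ram_state" where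
  "set_reg r v \<sigma> = \<sigma>\<lparr> regs := (regs \<sigma>)(r := v) \<rparr>"

definition set_mem :: "nat \<Rightarrow> nat \<Rightarrow> ram_state \<Rightarrow> ram_state" where
  "set_mem i v \<sigma> = \<sigma>\<lparr> mem := (mem \<sigma>)(i := v) \<rparr>"

text \<open>
  \<open>exec inp S W p \<sigma> t \<sigma>'\<close>: on a machine with input tape \<open>inp\<close>, the \<open>S\<close> memory cells with
  addresses below \<open>S\<close>, and words holding the numbers up to \<open>W\<close>, program \<open>p\<close> started in \<open>\<sigma>\<close> halts
  in \<open>\<sigma>'\<close> after \<open>t\<close> steps. Every executed instruction and every evaluated test is one step.
  There is no transition, hence no halting run, if an address is out of range or a written
  value exceeds \<open>W\<close>. The program has no access to \<open>S\<close> and \<open>W\<close>.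
\<close>

inductive exec ::
  "nat list \<Rightarrow> nat \<Rightarrow> nat \<Rightarrow> com \<Rightarrow> ram_state \<Rightarrow> nat \<Rightarrow> ram_state \<Rightarrow> bool"
  for inp S W where
  Skip: "exec inp S W Skip \<sigma> 1 \<sigma>"
| Assign: "\<lbrakk> v = arith_val f (operand_val \<sigma> a) (operand_val \<sigma> b); v \<le> W \<rbrakk>
    \<Longrightarrow> exec inp S W (Assign r f a b) \<sigma> 1 (set_reg r v \<sigma>)"
| ReadInput: "\<lbrakk> i = operand_val \<sigma> a; i < length inp; inp ! i \<le> W \<rbrakk>
    \<Longrightarrow> exec inp S W (ReadInput r a) \<sigma> 1 (set_reg r (inp ! i) \<sigma>)"
| Load: "\<lbrakk> i = operand_val \<sigma> a; i < S \<rbrakk>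
    \<Longrightarrow> exec inp S W (Load r a) \<sigma> 1 (set_reg r (mem \<sigma> i) \<sigma>)"
| Store: "\<lbrakk> i = operand_val \<sigma> a; i < S; v = operand_val \<sigma> b; v \<le> W \<rbrakk>
    \<Longrightarrow> exec inp S W (Store a b) \<sigma> 1 (set_mem i v \<sigma>)"
| Seq: "\<lbrakk> exec inp S W p \<sigma> t \<sigma>'; exec inp S W q \<sigma>' u \<sigma>'' \<rbrakk>
    \<Longrightarrow> exec inp S W (Seq p q) \<sigma> (t + u) \<sigma>''"
| IfTrue: "\<lbrakk> test_val \<sigma> b; exec inp S W p \<sigma> t \<sigma>' \<rbrakk>
    \<Longrightarrow> exec inp S W (If b p q) \<sigma> (1 + t) \<sigma>'"
| IfFalse: "\<lbrakk> \<not> test_val \<sigma> b; exec inp S W q \<sigma> t \<sigma>' \<rbrakk>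
    \<Longrightarrow> exec inp S W (If b p q) \<sigma> (1 + t) \<sigma>'"
| WhileFalse: "\<not> test_val \<sigma> b \<Longrightarrow> exec inp S W (While b p) \<sigma> 1 \<sigma>"
| WhileTrue: "\<lbrakk> test_val \<sigma> b; exec inp S W p \<sigma> t \<sigma>'; exec inp S W (While b p) \<sigma>' u \<sigma>'' \<rbrakk>
    \<Longrightarrow> exec inp S W (While b p) \<sigma> (1 + t + u) \<sigma>''"

inductive_cases SkipE: "exec inp S W Skip \<sigma> t \<sigma>'"
inductive_cases AssignE: "exec inp S W (Assign r f a b) \<sigma> t \<sigma>'"
inductive_cases ReadInputE: "exec inp S W (ReadInput r a) \<sigma> t \<sigma>'"
inductive_cases LoadE: "exec inp S W (Load r a) \<sigma> t \<sigma>'"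
inductive_cases StoreE: "exec inp S W (Store a b) \<sigma> t \<sigma>'"
inductive_cases SeqE: "exec inp S W (Seq p q) \<sigma> t \<sigma>'"
inductive_cases IfE: "exec inp S W (If b p q) \<sigma> t \<sigma>'"
inductive_cases WhileE: "exec inp S W (While b p) \<sigma> t \<sigma>'"

lemma exec_deterministic:
  assumes "exec inp S W p \<sigma> t \<sigma>'" and "exec inp S W p \<sigma> u \<sigma>''"
  shows "t = u \<and> \<sigma>' = \<sigma>''"
  using assms
proof (induction arbitrary: u \<sigma>'' rule: exec.induct)
  case (Skip \<sigma>)
  then show ?case by (rule SkipE) simp
next
  case (Assign v f \<sigma> a b r)
  from Assign.prems show ?case by (rule AssignE) (simp add: Assign.hyps)
next
  case (ReadInput i \<sigma> a r)
  from ReadInput.prems show ?case by (rule ReadInputE) (simp add: ReadInput.hyps)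
next
  case (Load i \<sigma> a r)
  from Load.prems show ?case by (rule LoadE) (simp add: Load.hyps)
next
  case (Store i \<sigma> a v b)
  from Store.prems show ?case by (rule StoreE) (simp add: Store.hyps)
next
  case (Seq p \<sigma> t \<sigma>' q u' \<tau>)
  from Seq.prems obtain t1 \<sigma>1 u1 where
    1: "exec inp S W p \<sigma> t1 \<sigma>1" and 2: "exec inp S W q \<sigma>1 u1 \<sigma>''" and 3: "u = t1 + u1"
    by (rule SeqE)
  from Seq.IH(1)[OF 1] have 4: "t = t1" "\<sigma>1 = \<sigma>'" by simp_all
  from Seq.IH(2)[OF 2[unfolded 4]] show ?case by (simp add: 3 4)
next
  case (IfTrue \<sigma> b p t \<sigma>' q)
  from IfTrue.prems obtain u1 where 1: "exec inp S W p \<sigma> u1 \<sigma>''" and 2: "u = 1 + u1"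
    by (rule IfE) (simp_all add: IfTrue.hyps(1))
  from IfTrue.IH[OF 1] show ?case by (simp add: 2)
next
  case (IfFalse \<sigma> b q t \<sigma>' p)
  from IfFalse.prems obtain u1 where 1: "exec inp S W q \<sigma> u1 \<sigma>''" and 2: "u = 1 + u1"
    by (rule IfE) (simp_all add: IfFalse.hyps(1))
  from IfFalse.IH[OF 1] show ?case by (simp add: 2)
next
  case (WhileFalse \<sigma> b p)
  from WhileFalse.prems show ?case by (rule WhileE) (simp_all add: WhileFalse.hyps)
next
  case (WhileTrue \<sigma> b p t \<sigma>' u' \<tau>)
  from WhileTrue.prems obtain t1 \<sigma>1 u1 where
    1: "exec inp S W p \<sigma> t1 \<sigma>1" and 2: "exec inp S W (While b p) \<sigma>1 u1 \<sigma>''"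
    and 3: "u = 1 + t1 + u1"
    by (rule WhileE) (simp_all add: WhileTrue.hyps(1))
  from WhileTrue.IH(1)[OF 1] have 4: "t = t1" "\<sigma>1 = \<sigma>'" by simp_all
  from WhileTrue.IH(2)[OF 2[unfolded 4]] show ?case by (simp add: 3 4)
qed

text \<open>
  The word length is logarithmic: words hold numbers up to a fixed power of the sum of the
  input length and the largest input number.
\<close>

definition max_word :: "nat \<Rightarrow> nat list \<Rightarrow> nat" where
  "max_word k inp = (length inp + Max (set inp)) ^ k"


section \<open>Input and output format\<close>

text \<open>The lists of out-neighbours, each in arbitrary order.\<close>

definition adjacency_lists :: "nat \<Rightarrow> nat pair_pre_digraph \<Rightarrow> (nat \<Rightarrow> nat list) \<Rightarrow> bool" where
  "adjacency_lists n G adj \<longleftrightarrow>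
     (\<forall>u<n. distinct (adj u) \<and> set (adj u) = {v. (u, v) \<in> parcs G})"

text \<open>
  After \<open>n\<close>, \<open>c\<close> and the sizes come \<open>n + 1\<close> offsets and then the concatenated adjacency lists:
  the list of item \<open>u\<close> extends from its own offset up to, but excluding, the next one.
\<close>

definition encode_instance :: "nat \<Rightarrow> (nat \<Rightarrow> nat) \<Rightarrow> nat \<Rightarrow> (nat \<Rightarrow> nat list) \<Rightarrow> nat list" where
  "encode_instance n s c adj =
     [n, c] @ map s [0..<n]
     @ map (\<lambda>u. \<Sum>w<u. length (adj w)) [0..<Suc n]
     @ concat (map adj [0..<n])"

text \<open>The answer is the characteristic vector in the first \<open>n\<close> memory cells.\<close>

definition output_set :: "nat \<Rightarrow> ram_state \<Rightarrow> nat set" where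
  "output_set n \<sigma> = {j. j < n \<and> mem \<sigma> j = 1}"

end

(*
  Closed sets contain everything reachable from their elements, so only the vertices whose reachable
  set weighs at most c ("usable" vertices) matter. A breadth-first search that stops as soon as the
  weight or an out-degree exceeds c finds their reachable sets in O(c^2) steps per vertex; neither
  the rest of the graph nor the term m is needed.

  Reachability in a directed co-graph is an N-free preorder. Let D v be the vertices strictly below
  v and d v their weight. D v is a stack of layers in which every vertex of a layer lies above all of
  the layers below it, and the layers are recognised by weights alone: the vertices w below v with
  d w < j form a union of bottom layers iff they weigh exactly j. Processing the vertices by
  decreasing weight of the part of D v under its top layer, and then by increasing d v, one merges
  the pieces that make up the top layer and puts the piece containing v on top of them. All pieces
  are hung onto a binary tree. A closed set of a piece X with a piece Y on top may meet Y iff its part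
  in X weighs at least as much as the layer under Y. Subset sum tables for the nodes of this tree
  take O(c^2) steps each and O(c) cells each.

  The algorithm is written in a small loop language whose programs have a total semantics and a
  static bound on their running time, and which is compiled to the word RAM.
*)
theory Submission
  imports Defs
begin

section \<open>N-free preorders\<close>

text \<open>Nested sets of equal weight are equal, because sizes are positive. So inclusions that
  would need stored sets become comparisons of numbers, and \<open>O(c)\<close> cells per vertex
  suffice. The obstacle is that no decomposition of \<open>G\<close> is given and that the truncated
  searches see only what lies below usable vertices: the stacking has to be found from the numbers
  \<open>d w\<close>. Two things could go wrong when the piece of \<open>v\<close> is put on its top
  layer. Part of the layer could lie outside the merged pieces. The order of processing excludes
  this: an element of the layer that is not lowest in it has a base at least as heavy as that of
  \<open>v\<close> and a smaller \<open>d\<close>. And a piece could have swallowed elements that do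
  not belong to it. This is excluded by keeping the pieces minimal with respect to the links that
  created them; N-freeness shows that such links lead from the layer of \<open>v\<close> only to
  elements above all of \<open>D v\<close>. Within the merged pieces a closed set with such an
  element contains the whole layer, which is why one threshold on a weight describes how two pieces
  interact. The pieces as sets occur in invariants only; the machine knows their numbers.\<close>

lemma subset_eq_if_sum_le:
  fixes s :: "'a \<Rightarrow> nat"
  assumes "finite B" "A \<subseteq> B" "\<And>x. x \<in> B \<Longrightarrow> 0 < s x" "sum s B \<le> sum s A"
  shows "A = B"
proof (rule ccontr)
  assume "A \<noteq> B"
  with assms(2) obtain x where x: "x \<in> B" "x \<notin> A" by blast
  have "sum s A < sum s B"
    by (rule sum_strict_mono2[OF assms(1) assms(2), of x]) (use x assms(3) in auto)
  with assms(4) show False by simp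
qed

text \<open>\<open>R x\<close> is the set of elements below \<open>x\<close>; elements below each
  other are equivalent. If \<open>nfree\<close> failed, \<open>v\<close> above both \<open>p\<close>
  and \<open>q\<close>, and \<open>v'\<close> above \<open>q\<close> but not \<open>p\<close>, would
  form the pattern N.\<close>

locale nfree_preorder =
  fixes U :: "nat set" and R :: "nat \<Rightarrow> nat set" and s :: "nat \<Rightarrow> nat"
  assumes finite_U: "finite U"
    and refl_R: "x \<in> U \<Longrightarrow> x \<in> R x"
    and R_sub_U: "x \<in> U \<Longrightarrow> R x \<subseteq> U"
    and trans_R: "x \<in> U \<Longrightarrow> y \<in> R x \<Longrightarrow> R y \<subseteq> R x"
    and pos: "x \<in> U \<Longrightarrow> 0 < s x"
    and nfree: "\<lbrakk> v \<in> U; v' \<in> U; v \<notin> R v'; v' \<notin> R v; p \<in> R v; p \<notin> R v'; q \<in> R v; q \<in> R v' \<rbrakk>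
       \<Longrightarrow> q \<in> R p"
begin

text \<open>\<open>split v j\<close> says that the \<open>w\<close> in \<open>D v\<close> with \<open>d w < j\<close> are the union of some bottom layers
  of \<open>D v\<close>, but not all of them. \<open>H v\<close> is the top layer, and the layers below it weigh \<open>cx v\<close>.\<close>

definition D :: "nat \<Rightarrow> nat set" where "D x = {y \<in> R x. x \<notin> R y}"
definition d :: "nat \<Rightarrow> nat" where "d x = sum s (D x)"
definition K :: "nat \<Rightarrow> nat \<Rightarrow> nat set" where "K v j = {w \<in> R v. d w < j}"
definition split :: "nat \<Rightarrow> nat \<Rightarrow> bool" where "split v j \<longleftrightarrow> j < d v \<and> sum s (K v j) = j"
definition cx :: "nat \<Rightarrow> nat" where "cx v = Max {j. split v j}"
definition H :: "nat \<Rightarrow> nat set" where "H v = {w \<in> D v. cx v \<le> d w}"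

section \<open>Elementary properties of the strict part and its weight\<close>

lemma finite_R: "x \<in> U \<Longrightarrow> finite (R x)"
  using R_sub_U finite_U finite_subset by blast
lemma D_sub_R: "D x \<subseteq> R x" by (auto simp: D_def)
lemma D_sub_U: "x \<in> U \<Longrightarrow> D x \<subseteq> U" using D_sub_R R_sub_U by blast
lemma finite_D: "x \<in> U \<Longrightarrow> finite (D x)" using D_sub_R finite_R finite_subset by blast
lemma R_in_U: "x \<in> U \<Longrightarrow> y \<in> R x \<Longrightarrow> y \<in> U" using R_sub_U by blast
lemma D_in_U: "x \<in> U \<Longrightarrow> y \<in> D x \<Longrightarrow> y \<in> U" using D_sub_U by blast

lemma D_mono: "x \<in> U \<Longrightarrow> y \<in> R x \<Longrightarrow> D y \<subseteq> D x"
  using trans_R R_in_U unfolding D_def by blast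
lemma D_down: "x \<in> U \<Longrightarrow> y \<in> D x \<Longrightarrow> R y \<subseteq> D x"
  using trans_R R_in_U unfolding D_def by blast
lemma D_eq: "x \<in> U \<Longrightarrow> y \<in> R x \<Longrightarrow> x \<in> R y \<Longrightarrow> D y = D x"
  using D_mono R_in_U by (metis subset_antisym)
lemma D_irrefl: "x \<in> U \<Longrightarrow> x \<notin> D x" using refl_R by (auto simp: D_def)

lemma sum_mono_U: "\<lbrakk> B \<subseteq> U; A \<subseteq> B \<rbrakk> \<Longrightarrow> sum s A \<le> sum s B"
  by (rule sum_mono2) (auto intro: finite_subset[OF _ finite_U])

lemma sum_less_U: "\<lbrakk> B \<subseteq> U; A \<subset> B \<rbrakk> \<Longrightarrow> sum s A < sum s B"
  using subset_eq_if_sum_le[of B A s] pos finite_subset[OF _ finite_U]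
  by (metis leI psubset_imp_subset psubset_eq subsetD)

lemma d_less: assumes "x \<in> U" "y \<in> D x" shows "d y < d x"
proof -
  have "D y \<subset> D x" using assms D_mono[of x y] D_irrefl[of y] D_sub_R D_in_U by blast
  thus ?thesis unfolding d_def using assms D_sub_U by (intro sum_less_U) auto
qed
text \<open>Equivalent elements have the same strict part, so the numbers \<open>d\<close> alone
  separate the elements strictly below \<open>x\<close> from those equivalent to it.\<close>

lemma in_D_iff: "x \<in> U \<Longrightarrow> y \<in> R x \<Longrightarrow> y \<in> D x \<longleftrightarrow> d y < d x"
  using d_less D_eq[of x y] unfolding D_def d_def by auto

section \<open>Layers recognised by their weight\<close>

lemma K_sub_D: "v \<in> U \<Longrightarrow> j \<le> d v \<Longrightarrow> K v j \<subseteq> D v"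
  using in_D_iff unfolding K_def by auto

text \<open>Among the elements below \<open>p\<close> with \<open>d\<close> at least
  \<open>j\<close> let \<open>p0\<close> have the smallest \<open>d\<close>. Strictly below it there
  are only elements of \<open>K v j\<close>. They weigh at least \<open>j\<close>, the weight of all
  of \<open>K v j\<close>, so nothing of \<open>K v j\<close> is missing below \<open>p0\<close> and
  hence below \<open>p\<close>.\<close>

lemma K_sub_D_above:
  assumes v: "v \<in> U" and sp: "split v j" and p: "p \<in> R v" and dp: "j \<le> d p"
  shows "K v j \<subseteq> D p"
proof -
  have pU: "p \<in> U" using R_in_U v p by blast
  define S where "S = {q \<in> R p. j \<le> d q}"
  have "p \<in> S" using dp refl_R[OF pU] S_def by simp
  then obtain p0 where p0: "p0 \<in> S" and min: "\<And>q. q \<in> S \<Longrightarrow> d p0 \<le> d q"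
    using arg_min_natI[of "\<lambda>q. q \<in> S" p d] arg_min_nat_le[of "\<lambda>q. q \<in> S" _ d] by metis
  have p0U: "p0 \<in> U" and p0R: "p0 \<in> R p" using p0 R_in_U pU S_def by auto
  have sub: "D p0 \<subseteq> K v j"
  proof
    fix q assume q: "q \<in> D p0"
    have "q \<in> R p" using q D_sub_R trans_R[OF pU p0R] by blast
    moreover have "d q < d p0" using d_less p0U q by blast
    ultimately have "d q < j" using min[of q] S_def by force
    thus "q \<in> K v j" using \<open>q \<in> R p\<close> trans_R[OF v p] K_def by auto
  qed
  have "D p0 = K v j"
    by (rule subset_eq_if_sum_le[OF _ sub, of s])
      (use v p0 sp finite_R R_in_U pos in \<open>auto simp: K_def S_def split_def d_def\<close>)
  thus ?thesis using D_mono[OF pU p0R] by simp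
qed

lemma split_0: "v \<in> U \<Longrightarrow> 0 < d v \<Longrightarrow> split v 0"
  by (simp add: split_def K_def)
lemma finite_splits: "finite {j. split v j}"
  by (rule finite_subset[of _ "{..<d v}"]) (auto simp: split_def)
lemma split_le_cx: "split v j \<Longrightarrow> j \<le> cx v"
  unfolding cx_def using finite_splits by (intro Max_ge) auto
lemma split_cx: "v \<in> U \<Longrightarrow> 0 < d v \<Longrightarrow> split v (cx v)"
  using Max_in[OF finite_splits, of v] split_0 unfolding cx_def by blast
lemma cx_less: "v \<in> U \<Longrightarrow> 0 < d v \<Longrightarrow> cx v < d v"
  using split_cx split_def by blast

lemma K_eq_of_D: "v \<in> U \<Longrightarrow> j \<le> d v \<Longrightarrow> K v j = {w \<in> D v. d w < j}"
  using K_sub_D D_sub_R unfolding K_def by blast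

text \<open>For \<open>j \<le> d v\<close> the set \<open>K v j\<close> is cut out of
  \<open>D v\<close>, so all of this data is a function of the set \<open>D v\<close>, and one
  vertex can stand for any other with the same strict part.\<close>

lemma D_eq_cx: assumes "v \<in> U" "v' \<in> U" "D v = D v'" shows "d v = d v'" "cx v = cx v'" "H v = H v'"
proof -
  show d: "d v = d v'" using assms by (simp add: d_def)
  have "split v j \<longleftrightarrow> split v' j" for j
    using K_eq_of_D[of v j] K_eq_of_D[of v' j] assms d by (auto simp: split_def)
  thus c: "cx v = cx v'" by (simp add: cx_def)
  show "H v = H v'" using c assms by (simp add: H_def)
qed

lemma H_nonempty: assumes "v \<in> U" "0 < d v" shows "H v \<noteq> {}"
proof
  assume "H v = {}"
  hence "K v (cx v) = D v" using K_eq_of_D[of v "cx v"] cx_less[OF assms] assms unfolding H_def by force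
  thus False using split_cx[OF assms] cx_less[OF assms] unfolding split_def d_def by simp
qed

lemma sum_H: assumes "v \<in> U" "0 < d v" shows "sum s (H v) = d v - cx v"
proof -
  have K: "K v (cx v) = {w \<in> D v. d w < cx v}"
    by (rule K_eq_of_D[OF assms(1) less_imp_le[OF cx_less[OF assms]]])
  have "D v = K v (cx v) \<union> H v" "K v (cx v) \<inter> H v = {}"
    unfolding K H_def by auto
  hence "d v = sum s (K v (cx v)) + sum s (H v)"
    unfolding d_def using assms finite_D[of v] by (metis finite_Un sum.union_disjoint)
  thus ?thesis using split_cx[OF assms] by (simp add: split_def)
qed

text \<open>Every \<open>p\<close> below \<open>v\<close> with \<open>d p\<close> above
  \<open>j\<close> lies over all of \<open>K v j\<close>, so the elements with small
  \<open>d\<close> are the same for both.\<close>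

lemma split_inherit:
  assumes v: "v \<in> U" and sp: "split v j" and p: "p \<in> R v" and dp: "j < d p"
  shows "split p j"
proof -
  have "K v j \<subseteq> D p" using K_sub_D_above assms by simp
  hence "K p j = K v j" using trans_R[OF v p] D_sub_R unfolding K_def by blast
  thus ?thesis using sp dp by (simp add: split_def)
qed

text \<open>The only place where N-freeness enters.\<close>

lemma overlap_split:
  assumes v: "v \<in> U" and v': "v' \<in> U" and inc: "v \<notin> R v'" "v' \<notin> R v"
    and ns: "\<not> D v \<subseteq> D v'"
  shows "split v (sum s (D v \<inter> D v'))" and "K v (sum s (D v \<inter> D v')) = D v \<inter> D v'"
proof -
  define I where "I = D v \<inter> D v'"
  \<comment> \<open>A common element \<open>q\<close> that is not below \<open>p\<close> would
    complete an N with \<open>v\<close>, \<open>v'\<close> and \<open>p\<close>.\<close>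
  have over: "I \<subseteq> D p" if "p \<in> D v" "p \<notin> D v'" for p
  proof
    fix q assume q: "q \<in> I"
    have pR: "p \<in> R v" using that D_sub_R by blast
    have pU: "p \<in> U" using R_in_U v pR .
    have pn: "p \<notin> R v'"
      using that inc trans_R[OF v pR] unfolding D_def by blast
    have qp: "q \<in> R p"
      by (rule nfree[OF v v' inc pR pn]) (use q in \<open>auto simp: I_def D_def\<close>)
    moreover have "p \<notin> R q"
      using D_down[OF v'] q that unfolding I_def by blast
    ultimately show "q \<in> D p" by (simp add: D_def)
  qed
  obtain p where p: "p \<in> D v" "p \<notin> D v'" using ns by blast
  have IU: "I \<subseteq> U" using D_sub_U v I_def by blast
  have less: "sum s I < d v"
    unfolding d_def by (rule sum_less_U) (use D_sub_U v p I_def in auto)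
  \<comment> \<open>Elements of \<open>D v\<close> outside the intersection have all of it strictly
    below them, elements inside only a proper part of it. So the weight of the intersection
    separates the two kinds.\<close>
  have K: "K v (sum s I) = I"
  proof (rule equalityI; rule subsetI)
    fix w assume w: "w \<in> K v (sum s I)"
    hence wD: "w \<in> D v" using K_sub_D[OF v, of "sum s I"] less by auto
    show "w \<in> I"
    proof (rule ccontr)
      assume "w \<notin> I"
      hence "I \<subseteq> D w" using over wD I_def by blast
      hence "sum s I \<le> d w" unfolding d_def using D_sub_U D_in_U v wD by (intro sum_mono_U) auto
      thus False using w by (simp add: K_def)
    qed
  next
    fix w assume w: "w \<in> I"
    have wU: "w \<in> U" using w IU by blast
    have "D w \<subseteq> I" using w D_down[OF v, of w] D_down[OF v', of w] D_sub_R I_def by blast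
    hence "D w \<subset> I" using w D_irrefl wU by blast
    hence "d w < sum s I" unfolding d_def using IU by (intro sum_less_U)
    thus "w \<in> K v (sum s I)" using w D_sub_R unfolding K_def I_def by blast
  qed
  show "K v (sum s (D v \<inter> D v')) = D v \<inter> D v'" using K I_def by simp
  show "split v (sum s (D v \<inter> D v'))" using K less by (simp add: split_def I_def)
qed

lemma in_H_down: assumes "v \<in> U" "0 < d v" "p \<in> H v" "w \<in> D p" "cx v \<le> d w" shows "w \<in> H v"
  using assms D_mono[of v p] D_sub_R unfolding H_def by blast

section \<open>Closed sets of a piece with another one on top\<close>

definition closed_in :: "nat set \<Rightarrow> nat set \<Rightarrow> bool" where
  "closed_in X A \<longleftrightarrow> A \<subseteq> X \<and> (\<forall>x\<in>A. R x \<inter> X \<subseteq> A)"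

text \<open>The interface between the order and the dynamic programming: all dependence between the
  two pieces is condensed into one inequality about a weight. Threshold 0 describes unrelated
  pieces; the clause for \<open>B = {}\<close> lets a closed set stop in the base.\<close>

definition node_ok :: "nat set \<Rightarrow> nat set \<Rightarrow> nat \<Rightarrow> bool" where
  "node_ok X Y \<theta> \<longleftrightarrow> X \<inter> Y = {} \<and> (\<forall>A B. A \<subseteq> X \<longrightarrow> B \<subseteq> Y \<longrightarrow>
     closed_in (X \<union> Y) (A \<union> B) \<longleftrightarrow> closed_in X A \<and> closed_in Y B \<and> (B = {} \<or> \<theta> \<le> sum s A))"

lemma node_ok_union:
  assumes "X \<inter> Y = {}" "\<And>x. x \<in> X \<Longrightarrow> R x \<inter> Y = {}" "\<And>y. y \<in> Y \<Longrightarrow> R y \<inter> X = {}"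
  shows "node_ok X Y 0"
  using assms unfolding node_ok_def closed_in_def by (simp add: ball_Un Int_Un_distrib) blast

text \<open>Weights decide whether the base is contained in a closed set: closed sets that do not
  contain all of \<open>B\<close> are proper subsets of \<open>B\<close>.\<close>

lemma node_ok_attach:
  assumes dis: "X \<inter> Y = {}" and XU: "X \<subseteq> U" and BX: "B \<subseteq> X"
    and xy: "\<And>x. x \<in> X \<Longrightarrow> R x \<inter> Y = {}"
    and yx: "\<And>y. y \<in> Y \<Longrightarrow> R y \<inter> X = B"
    and top: "\<And>x. x \<in> X \<Longrightarrow> x \<notin> B \<Longrightarrow> B \<subseteq> R x"
  shows "node_ok X Y (sum s B)"
  unfolding node_ok_def
proof (intro conjI allI impI dis)
  fix A C assume A: "A \<subseteq> X" and C: "C \<subseteq> Y"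
  show "closed_in (X \<union> Y) (A \<union> C) \<longleftrightarrow>
    closed_in X A \<and> closed_in Y C \<and> (C = {} \<or> sum s B \<le> sum s A)" (is "?l \<longleftrightarrow> ?r")
  proof
    assume l: ?l
    have 1: "R x \<inter> (X \<union> Y) \<subseteq> A \<union> C" if "x \<in> A \<union> C" for x using l that unfolding closed_in_def by blast
    have "closed_in X A" unfolding closed_in_def using A 1 C dis by blast
    moreover have "closed_in Y C" unfolding closed_in_def using A 1 C dis by blast
    moreover have "sum s B \<le> sum s A" if "C \<noteq> {}"
    proof -
      from that obtain y where "y \<in> C" by blast
      hence "B \<subseteq> A" using 1[of y] yx[of y] C dis A by blast
      thus ?thesis using A XU by (intro sum_mono_U) auto
    qed
    ultimately show ?r by blast
  next
    assume r: ?r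
    have BA: "B \<subseteq> A" if "C \<noteq> {}"
    proof (cases "A \<subseteq> B")
      case True
      have BU: "B \<subseteq> U" using BX XU by blast
      have "A = B"
        by (rule subset_eq_if_sum_le[OF finite_subset[OF BU finite_U] True, of s])
          (use that r BU pos in blast)+
      thus ?thesis by simp
    next
      case False
      then obtain x where "x \<in> A" "x \<notin> B" by blast
      thus ?thesis using top[of x] A r BX unfolding closed_in_def by blast
    qed
    show ?l unfolding closed_in_def
    proof (intro conjI ballI)
      show "A \<union> C \<subseteq> X \<union> Y" using A C by blast
      fix x assume "x \<in> A \<union> C"
      thus "R x \<inter> (X \<union> Y) \<subseteq> A \<union> C"
      proof
        assume "x \<in> A"
        thus ?thesis using xy[of x] A r unfolding closed_in_def by blast
      next
        assume x: "x \<in> C"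
        hence "R x \<inter> X \<subseteq> A" using yx[of x] BA C by blast
        thus ?thesis using x r unfolding closed_in_def by blast
      qed
    qed
  qed
qed

section \<open>Modules\<close>

end

text \<open>\<open>Nd y\<close> is the piece with number \<open>y\<close>, \<open>Al\<close> the set of the pieces that are not yet part of a larger one, and
  \<open>cur x\<close> the last piece for which \<open>x\<close> was a minimal element. Hence \<open>cur x \<notin> Al\<close> means that the
  piece of \<open>x\<close> has been put on top of the layer \<open>H x\<close>. The vertices with \<open>j < cx x\<close> are finished, and
  so are those in \<open>P\<close> with \<open>cx x = j\<close>. The last assumption makes the pieces minimal: they are generated
  by the pairs of \<open>p\<close> and \<open>w \<in> H p\<close> and by the strongly connected components.\<close>

locale module_inv = nfree_preorder U R s
  for U :: "nat set" and R :: "nat \<Rightarrow> nat set" and s :: "nat \<Rightarrow> nat" +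
  fixes j b :: nat and P :: "nat set" and cur :: "nat \<Rightarrow> nat" and Al :: "nat set" and Nd :: "nat \<Rightarrow> nat set"
  assumes minv_done: "\<lbrakk> x \<in> U; 0 < d x; j < cx x \<or> cx x = j \<and> x \<in> P \<rbrakk> \<Longrightarrow> cur x \<notin> Al"
    and minv_dead: "\<lbrakk> x \<in> U; cur x \<notin> Al \<rbrakk> \<Longrightarrow> 0 < d x \<and> (j < cx x \<or> cx x = j \<and> d x \<le> b)"
    and minv_self: "\<lbrakk> x \<in> U; cur x \<in> Al \<rbrakk> \<Longrightarrow> x \<in> Nd (cur x)"
    and minv_sub: "\<lbrakk> x \<in> U; cur x \<in> Al \<rbrakk> \<Longrightarrow> Nd (cur x) \<subseteq> U"
    and minv_cover: "u \<in> U \<Longrightarrow> \<exists>x\<in>U. cur x \<in> Al \<and> u \<in> Nd (cur x)"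
    and minv_disj: "\<lbrakk> x \<in> U; y \<in> U; cur x \<in> Al; cur y \<in> Al; cur x \<noteq> cur y \<rbrakk> \<Longrightarrow> Nd (cur x) \<inter> Nd (cur y) = {}"
    and minv_D: "\<lbrakk> x \<in> U; y \<in> U; cur x \<in> Al; cur x = cur y \<rbrakk> \<Longrightarrow> D x = D y"
    and minv_below: "\<lbrakk> x \<in> U; cur x \<in> Al \<rbrakk> \<Longrightarrow> D x \<inter> Nd (cur x) = {}"
    and minv_R: "\<lbrakk> x \<in> U; cur x \<in> Al; u \<in> Nd (cur x) \<rbrakk> \<Longrightarrow> R u \<subseteq> D x \<union> Nd (cur x)"
    and minv_D_sub: "\<lbrakk> x \<in> U; cur x \<in> Al; u \<in> Nd (cur x) \<rbrakk> \<Longrightarrow> D x \<subseteq> D u"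
    and minv_edge: "\<lbrakk> x \<in> U; p \<in> U; cur x \<in> Al; cur p \<notin> Al; w \<in> H p \<rbrakk> \<Longrightarrow> p \<in> Nd (cur x) \<longleftrightarrow> w \<in> Nd (cur x)"
    and minv_gen: "\<lbrakk> x \<in> U; cur x \<in> Al; Z \<inter> Nd (cur x) \<noteq> {};
       \<And>p w. \<lbrakk> p \<in> U; cur p \<notin> Al; w \<in> H p \<rbrakk> \<Longrightarrow> p \<in> Z \<longleftrightarrow> w \<in> Z;
       \<And>u u'. \<lbrakk> u \<in> U; u' \<in> R u; u \<in> R u' \<rbrakk> \<Longrightarrow> u \<in> Z \<longleftrightarrow> u' \<in> Z \<rbrakk> \<Longrightarrow> Nd (cur x) \<subseteq> Z"
begin

text \<open>Everything below \<open>u\<close> lies in the piece of \<open>x\<close> or in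
  \<open>D x\<close>, which is also \<open>D y\<close> and avoids the piece of \<open>y\<close>.
  This allows pieces with the same strict part to be united with threshold 0.\<close>

lemma minv_unrelated:
  assumes "x \<in> U" "y \<in> U" "cur x \<in> Al" "cur y \<in> Al" "cur x \<noteq> cur y" "D x = D y" "u \<in> Nd (cur x)"
  shows "R u \<inter> Nd (cur y) = {}"
proof -
  have "R u \<subseteq> D y \<union> Nd (cur x)" using minv_R[of x u] assms by metis
  thus ?thesis using minv_disj[OF assms(1-5)] minv_below[OF assms(2,4)] by blast
qed

end

text \<open>The moment at which the piece of \<open>v\<close> is put on its layer: \<open>v\<close>
  is alive, everything with smaller \<open>d\<close> has been treated at the current
  \<open>j\<close>, and \<open>j\<close> is a split of \<open>v\<close>. That it is the largest
  split is a consequence.\<close>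

locale module_step = module_inv U R s j b P cur Al Nd
  for U R s j b P cur Al Nd +
  fixes v :: nat
  assumes done_below: "\<lbrakk> x \<in> U; d x < b \<rbrakk> \<Longrightarrow> x \<in> P" and v: "v \<in> U" and vb: "d v = b" and al: "cur v \<in> Al" and sp: "split v j"
begin

text \<open>The lowest elements of the top layer of \<open>v\<close>: their strict part is all of
  \<open>K v j\<close>, and their pieces cover the layer.\<close>

definition "Ms = {w \<in> R v. d w = j}"

lemma b_pos: "0 < d v" and j_less: "j < d v"
  using sp by (auto simp: split_def)

text \<open>A larger split would have been met at a higher value of \<open>j\<close>, and
  \<open>v\<close> would no longer be alive. So the program tests one \<open>j\<close> at a time and
  never computes a maximum.\<close>

lemma cx_j: "cx v = j"
proof (rule antisym)
  show "cx v \<le> j"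
  proof (rule ccontr)
    assume "\<not> cx v \<le> j"
    hence "j < cx v" by simp
    from minv_done[OF v b_pos disjI1[OF this]] al show False by contradiction
  qed
  show "j \<le> cx v" by (rule split_le_cx[OF sp])
qed

text \<open>An element with \<open>d w = j\<close> has \<open>K v j\<close> strictly below it and no
  weight left for more. A finished \<open>w\<close> would need a context weight of at least
  \<open>j\<close>, but \<open>cx w < d w = j\<close>.\<close>

lemma Ms: assumes "w \<in> Ms" shows "w \<in> U" "w \<in> H v" "D w = K v j" "cur w \<in> Al" "d w = j"
proof -
  have wR: "w \<in> R v" and dw: "d w = j" using assms by (auto simp: Ms_def)
  show wU: "w \<in> U" using R_in_U[OF v wR] .
  show "d w = j" by fact
  show "w \<in> H v" using in_D_iff[OF v wR] dw j_less cx_j by (simp add: H_def)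
  show "D w = K v j"
    by (rule sym, rule subset_eq_if_sum_le[of _ _ s])
      (use K_sub_D_above[OF v sp wR] dw sp finite_D pos D_in_U wU in \<open>auto simp: split_def d_def\<close>)
  show "cur w \<in> Al"
  proof (rule ccontr)
    assume "cur w \<notin> Al"
    from minv_dead[OF wU this] have "0 < d w" "j \<le> cx w" by auto
    with cx_less[OF wU] dw show False by simp
  qed
qed

lemma H_v: "w \<in> H v \<longleftrightarrow> w \<in> D v \<and> j \<le> d w" by (simp add: H_def cx_j)

lemma D_v: "D v = K v j \<union> H v"
  using K_eq_of_D[OF v, of j] j_less H_v by auto

text \<open>An element \<open>u\<close> of the layer that is not lowest inherits the split
  \<open>j\<close> and has \<open>d u < d v\<close>, so by the order of treatment it already sits on
  its own top layer. Any \<open>w'\<close> in that layer lies in the same piece as \<open>u\<close>,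
  is again in \<open>H v\<close> and has a smaller \<open>d\<close>.\<close>

lemma H_cover: "u \<in> H v \<Longrightarrow> \<exists>w\<in>Ms. u \<in> Nd (cur w)"
proof (induction "d u" arbitrary: u rule: less_induct)
  case less
  have uD: "u \<in> D v" and ju: "j \<le> d u" using less.prems H_v by auto
  have uR: "u \<in> R v" using uD D_sub_R by blast
  have uU: "u \<in> U" using D_in_U[OF v uD] .
  show ?case
  proof (cases "d u = j")
    case True
    hence uM: "u \<in> Ms" using uR by (simp add: Ms_def)
    show ?thesis by (rule bexI[OF _ uM], rule minv_self[OF uU Ms(4)[OF uM]])
  next
    case False
    with ju have lt: "j < d u" by simp
    have sj: "split u j" using split_inherit[OF v sp uR lt] .
    have dead: "cur u \<notin> Al"
      by (rule minv_done[OF uU]) (use split_le_cx[OF sj] lt d_less[OF v uD] vb done_below[OF uU] in auto)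
    obtain w' where w': "w' \<in> H u" using H_nonempty[OF uU] lt by fastforce
    have w'D: "w' \<in> D u" and "j \<le> d w'" using w' split_le_cx[OF sj] unfolding H_def by auto
    hence "w' \<in> H v" using in_H_down[OF v b_pos less.prems] cx_j by simp
    from less.hyps[OF d_less[OF uU w'D] this] obtain w where w: "w \<in> Ms" "w' \<in> Nd (cur w)" by blast
    hence "u \<in> Nd (cur w)" using minv_edge[OF Ms(1)[OF w(1)] uU Ms(4)[OF w(1)] dead w'] by simp
    thus ?thesis using w(1) by blast
  qed
qed

lemma Ms_nonempty: "Ms \<noteq> {}"
  using H_cover H_nonempty[OF v b_pos] by blast

text \<open>The pieces about to be merged may exceed the layer, but only by elements above all of
  \<open>D v\<close>. As pieces are minimal, it is enough that the zone respects both kinds of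
  generators. Equivalent elements are easy; for a finished \<open>p\<close> and \<open>u\<close> in
  \<open>H p\<close> each direction has two cases.\<close>

lemma module_in_zone: assumes w: "w \<in> Ms" shows "Nd (cur w) \<subseteq> {u \<in> U. u \<in> H v \<or> D v \<subseteq> D u}" (is "_ \<subseteq> ?Z")
proof (rule minv_gen)
  show "w \<in> U" "cur w \<in> Al" using Ms[OF w] by auto
  show "?Z \<inter> Nd (cur w) \<noteq> {}" using Ms[OF w] minv_self by blast
  fix u u' assume u: "u \<in> U" "u' \<in> R u" "u \<in> R u'"
  have u'U: "u' \<in> U" using u R_in_U by blast
  have "D u = D u'" "d u = d u'" using D_eq[OF u] by (auto simp: d_def)
  moreover have "u \<in> D v \<longleftrightarrow> u' \<in> D v" using D_down[OF v] u by blast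
  ultimately show "u \<in> ?Z \<longleftrightarrow> u' \<in> ?Z" using u u'U H_v by auto
next
  fix p u assume p: "p \<in> U" and dead: "cur p \<notin> Al" and uH: "u \<in> H p"
  have uD: "u \<in> D p" and cu: "cx p \<le> d u" using uH by (auto simp: H_def)
  have uU: "u \<in> U" using D_in_U p uD by blast
  have p0: "0 < d p" and pj: "j < cx p \<or> cx p = j \<and> d p \<le> b" using minv_dead[OF p dead] by auto
  show "p \<in> ?Z \<longleftrightarrow> u \<in> ?Z"
  proof
    assume "u \<in> ?Z"
    hence "u \<in> H v \<or> D v \<subseteq> D u" by simp
    hence "p \<in> H v \<or> D v \<subseteq> D p"
    proof
      assume "D v \<subseteq> D u"
      thus ?thesis using D_mono[OF p, of u] uD D_sub_R by blast
    next
      assume uv: "u \<in> H v"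
      hence uDv: "u \<in> D v" and ju: "j \<le> d u" using H_v by auto
      show ?thesis
      proof (rule disjCI)
        assume ns: "\<not> D v \<subseteq> D p"
        \<comment> \<open>Otherwise \<open>p\<close> and \<open>v\<close> are incomparable, and the
          overlap of their strict parts is a split of \<open>v\<close>, hence of weight at most
          \<open>cx v = j\<close>. But \<open>u\<close> lies in the overlap, so \<open>d u\<close>
          would be below \<open>j\<close>.\<close>
        have "p \<in> D v"
        proof (rule ccontr)
          assume np: "p \<notin> D v"
          have i1: "v \<notin> R p" using ns D_mono[OF p] by blast
          have i2: "p \<notin> R v" using np i1 by (simp add: D_def)
          define I where "I = D v \<inter> D p"
          have "split v (sum s I)" and KI: "K v (sum s I) = I"
            using overlap_split[OF v p i1 i2 ns] by (simp_all add: I_def)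
          hence "sum s I \<le> j" using split_le_cx cx_j by metis
          moreover have "d u < sum s I" using KI uDv uD unfolding K_def I_def by blast
          ultimately show False using ju by simp
        qed
        thus "p \<in> H v" using H_v d_less[OF p uD] ju by auto
      qed
    qed
    thus "p \<in> ?Z" using p by blast
  next
    assume "p \<in> ?Z"
    hence "p \<in> H v \<or> D v \<subseteq> D p" by simp
    hence "u \<in> H v \<or> D v \<subseteq> D u"
    proof
      assume pH: "p \<in> H v"
      hence pR: "p \<in> R v" and jp: "j \<le> d p" using H_v D_sub_R by auto
      have "d p \<noteq> j"
      proof
        assume "d p = j"
        hence "p \<in> Ms" using pR by (simp add: Ms_def)
        thus False using Ms(4) dead by blast
      qed
      hence "split p j" using split_inherit[OF v sp pR] jp by simp
      hence "j \<le> d u" using split_le_cx cu by fastforce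
      thus ?thesis using in_H_down[OF v b_pos pH uD] cx_j by simp
    next
      assume sub: "D v \<subseteq> D p"
      show ?thesis
      proof (cases "D v = D p")
        case True
        thus ?thesis using D_eq_cx(3)[OF v p] uH by simp
      next
        case False
        hence "D v \<subset> D p" using sub by blast
        hence "d v < d p" unfolding d_def using D_sub_U p by (intro sum_less_U)
        \<comment> \<open>At the current \<open>j\<close> only vertices with \<open>d\<close> up to
          \<open>b = d v\<close> have been put on top, so \<open>p\<close> was treated at a larger
          value.\<close>
        hence jc: "j < cx p" using pj vb by simp
        have sc: "split p (cx p)" using split_cx[OF p p0] .
        \<comment> \<open>An element \<open>q\<close> of \<open>D v\<close> in the top layer of
          \<open>p\<close> would lie over \<open>K p (cx p)\<close>, and \<open>cx p\<close> would
          be a split of \<open>v\<close> larger than \<open>cx v\<close>.\<close>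
        have "D v \<subseteq> K p (cx p)"
        proof (rule ccontr)
          assume "\<not> D v \<subseteq> K p (cx p)"
          then obtain q where q: "q \<in> D v" "q \<notin> K p (cx p)" by blast
          have qR: "q \<in> R p" using q sub D_sub_R by blast
          hence dq: "cx p \<le> d q" using q by (simp add: K_def)
          have KD: "K p (cx p) \<subseteq> D q" using K_sub_D_above[OF p sc qR dq] .
          have dv: "cx p < d v" using dq d_less[OF v q(1)] by simp
          have "K v (cx p) = K p (cx p)"
          proof (rule equalityI)
            show "K v (cx p) \<subseteq> K p (cx p)"
              using K_sub_D[OF v, of "cx p"] dv sub D_sub_R unfolding K_def by fastforce
            show "K p (cx p) \<subseteq> K v (cx p)"
              using KD D_mono[OF v, of q] q D_sub_R unfolding K_def by blast
          qed
          hence "split v (cx p)" using sc dv by (simp add: split_def)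
          thus False using split_le_cx cx_j jc by fastforce
        qed
        moreover have "K p (cx p) \<subseteq> D u"
          using K_sub_D_above[OF p sc _ cu] uD D_sub_R by blast
        ultimately show ?thesis by blast
      qed
    qed
    thus "u \<in> ?Z" using uU by blast
  qed
qed

section \<open>The merged pieces as a base for the piece of \<open>v\<close>\<close>

definition "X = (\<Union>w\<in>Ms. Nd (cur w))"

lemma cur_v_notin: "w \<in> Ms \<Longrightarrow> cur w \<noteq> cur v"
  using minv_D[of w v] Ms(1,4,5) v j_less by (metis d_def less_irrefl)

lemma X_props: "X \<subseteq> U" "H v \<subseteq> X" "X \<inter> K v j = {}" "X \<inter> Nd (cur v) = {}"
  "x \<in> X \<Longrightarrow> x \<in> H v \<or> D v \<subseteq> D x"
proof -
  show "X \<subseteq> U" using minv_sub Ms(1,4) by (auto simp: X_def)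
  show "H v \<subseteq> X" using H_cover by (auto simp: X_def)
  show "X \<inter> K v j = {}" using minv_below Ms(1,3,4) unfolding X_def by fastforce
  show "X \<inter> Nd (cur v) = {}" using minv_disj[OF _ v _ al] cur_v_notin Ms(1,4) unfolding X_def by blast
  show "x \<in> X \<Longrightarrow> x \<in> H v \<or> D v \<subseteq> D x" using module_in_zone unfolding X_def by blast
qed

lemma X_R: assumes "x \<in> X" shows "R x \<subseteq> K v j \<union> X"
proof -
  obtain w where w: "w \<in> Ms" "x \<in> Nd (cur w)" using assms by (auto simp: X_def)
  have "R x \<subseteq> D w \<union> Nd (cur w)" using minv_R[OF Ms(1,4)[OF w(1)] w(2)] .
  thus ?thesis using Ms(3)[OF w(1)] w(1) unfolding X_def by auto
qed

text \<open>From the piece of \<open>v\<close> exactly the layer \<open>H v\<close> is reached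
  inside \<open>X\<close>, and the rest of \<open>X\<close> lies above that layer. So the threshold
  is the weight of \<open>H v\<close>, which is available to the program as
  \<open>b - j\<close>.\<close>

lemma node_ok_v: "node_ok X (Nd (cur v)) (b - j)"
proof -
  have "b - j = sum s (H v)" using sum_H[OF v b_pos] cx_j vb by simp
  moreover have "node_ok X (Nd (cur v)) (sum s (H v))"
  proof (rule node_ok_attach)
    fix x assume x: "x \<in> X"
    show "R x \<inter> Nd (cur v) = {}"
      using X_R[OF x] X_props(4) minv_below[OF v al] D_v by blast
    assume "x \<notin> H v"
    hence "D v \<subseteq> D x" using X_props(5)[OF x] by blast
    thus "H v \<subseteq> R x" using D_v D_sub_R by blast
  next
    fix y assume y: "y \<in> Nd (cur v)"
    have "H v \<subseteq> R y" using minv_D_sub[OF v al y] D_v D_sub_R by blast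
    thus "R y \<inter> X = H v" using minv_R[OF v al y] X_props D_v by blast
  qed (use X_props in auto)
  ultimately show ?thesis by simp
qed

end

context module_step begin

text \<open>\<open>h\<close> numbers the union of \<open>X\<close> and the piece of
  \<open>v\<close>. The elements of \<open>Ms\<close> are minimal in the new piece and receive
  \<open>h\<close>; \<open>v\<close> and all vertices sharing its number keep it, and being dead it
  now marks them as finished.\<close>

lemma minv_step:
  assumes h: "h \<notin> Al" and hU: "\<And>x. x \<in> U \<Longrightarrow> cur x \<noteq> h"
    and Al': "Al' = Al - cur ` Ms - {cur v} \<union> {h}"
    and cur': "\<And>x. cur' x = (if x \<in> Ms then h else cur x)"
    and Nd'h: "Nd' h = X \<union> Nd (cur v)"
    and Nd': "\<And>y. y \<in> Al \<Longrightarrow> Nd' y = Nd y"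
  shows "module_inv U R s j b (insert v P) cur' Al' Nd'"
proof -
  have alive: "cur' x \<in> Al' \<longleftrightarrow> x \<in> Ms \<or> cur x \<in> Al \<and> cur x \<notin> cur ` Ms \<and> cur x \<noteq> cur v"
    if "x \<in> U" for x
  proof (cases "x \<in> Ms")
    case True
    thus ?thesis by (simp add: Al' cur')
  next
    case False
    thus ?thesis using hU[OF that] by (simp add: Al' cur')
  qed
  \<comment> \<open>A number used by an element of \<open>Ms\<close> is used by elements of
    \<open>Ms\<close> only: equal numbers mean equal strict parts, so \<open>d x = j\<close>, too
    little for \<open>x\<close> to lie above all of \<open>D v\<close>. Hence renumbering
    \<open>Ms\<close> is enough.\<close>
  have MsI: "x \<in> Ms" if "x \<in> U" "cur x \<in> cur ` Ms" for x
  proof -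
    from that obtain w where w: "w \<in> Ms" "cur x = cur w" by blast
    have al: "cur x \<in> Al" using w Ms(4) by simp
    have D: "D x = K v j" using minv_D[of x w] w Ms(1,3,4) that by metis
    hence dx: "d x = j" using sp by (simp add: d_def split_def)
    have "x \<in> X" using minv_self[OF that(1) al] w unfolding X_def by auto
    hence "x \<in> H v"
      using X_props(5)[of x] dx j_less sum_mono_U[OF D_sub_U[OF that(1)], of "D v"]
      unfolding d_def by fastforce
    thus ?thesis using dx H_v D_sub_R unfolding Ms_def by blast
  qed
  have alive2: "cur' x \<in> Al' \<longleftrightarrow> x \<in> Ms \<or> cur x \<in> Al \<and> x \<notin> Ms \<and> cur x \<noteq> cur v" if "x \<in> U" for x
    using alive[OF that] MsI[OF that] by blast
  have Ndo: "Nd' (cur' x) = Nd (cur x) \<and> cur' x = cur x" if "x \<in> U" "x \<notin> Ms" "cur x \<in> Al" for x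
    using that Nd' cur' by simp
  have Ndm: "Nd' (cur' x) = X \<union> Nd (cur v) \<and> cur' x = h" if "x \<in> Ms" for x
    using that Nd'h cur' by simp
  have XN: "(X \<union> Nd (cur v)) \<inter> Nd (cur x) = {}"
    if "x \<in> U" "x \<notin> Ms" "cur x \<in> Al" "cur x \<noteq> cur v" for x
  proof -
    have "Nd (cur w) \<inter> Nd (cur x) = {}" if w: "w \<in> Ms" for w
      by (rule minv_disj[OF Ms(1)[OF w] \<open>x \<in> U\<close> Ms(4)[OF w] \<open>cur x \<in> Al\<close>])
        (use MsI[OF \<open>x \<in> U\<close>] w \<open>x \<notin> Ms\<close> in \<open>metis imageI\<close>)
    moreover have "Nd (cur v) \<inter> Nd (cur x) = {}"
      using minv_disj[OF v that(1) al that(3)] that(4) by metis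
    ultimately show ?thesis unfolding X_def by blast
  qed
  have kind: "x \<in> Ms \<or> x \<notin> Ms \<and> cur x \<in> Al \<and> cur x \<noteq> cur v \<and> Nd' (cur' x) = Nd (cur x) \<and> cur' x = cur x"
    if "x \<in> U" "cur' x \<in> Al'" for x
    using that alive2[OF that(1)] Ndo[OF that(1)] by metis
  have v_new: "v \<in> Nd (cur v)" using minv_self v al by blast
  have dead': "D p = D v \<or> cur p \<notin> Al" if "p \<in> U" "cur' p \<notin> Al'" for p
    using that alive2 minv_D[of p v] v al by metis
  have vMs: "v \<notin> Ms" using j_less by (simp add: Ms_def)
  \<comment> \<open>Only vertices sharing the number of \<open>v\<close> become finished in this
    step. Their top layer is that of \<open>v\<close> and lies in \<open>X\<close>.\<close>
  have edge_new: "p \<in> X \<union> Nd (cur v) \<longleftrightarrow> w \<in> X \<union> Nd (cur v)" if p: "p \<in> U" and dd: "cur' p \<notin> Al'" and w: "w \<in> H p" for p w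
  proof (cases "cur p \<in> Al")
    case False
    show ?thesis using minv_edge[OF _ p _ False w] Ms(1,4) v al unfolding X_def by blast
  next
    case True
    hence cp: "cur p = cur v" using dd alive2[OF p] by blast
    hence "D p = D v" using minv_D p v al True by metis
    hence "H p = H v" using D_eq_cx p v by blast
    hence "w \<in> X" using w X_props(2) by blast
    moreover have "p \<in> Nd (cur v)" using minv_self[OF p True] cp by simp
    ultimately show ?thesis by blast
  qed
  show ?thesis
  proof unfold_locales
    fix x assume xU: "x \<in> U"
    { assume "0 < d x" "j < cx x \<or> cx x = j \<and> x \<in> insert v P"
      hence "cur x \<notin> Al \<or> x = v" using minv_done[OF xU] by auto
      moreover have "x \<notin> Ms" using \<open>0 < d x\<close> \<open>j < cx x \<or> _\<close> cx_less[OF xU] Ms(5)[of x] by auto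
      ultimately show "cur' x \<notin> Al'" using alive2[OF xU] by blast }
    { assume "cur' x \<notin> Al'"
      from dead'[OF xU this] show "0 < d x \<and> (j < cx x \<or> cx x = j \<and> d x \<le> b)"
        using minv_dead[OF xU] D_eq_cx[OF xU v] b_pos cx_j vb by auto }
    { assume a: "cur' x \<in> Al'"
      show "x \<in> Nd' (cur' x)"
        using a alive2[OF xU] Ndm Ndo xU minv_self[OF xU] Ms(4) unfolding X_def by fastforce
      show "Nd' (cur' x) \<subseteq> U"
        using kind[OF xU a] Ndm[of x] minv_sub[OF xU] X_props(1) minv_sub[OF v al] by (metis Un_subset_iff)
      show "D x \<inter> Nd' (cur' x) = {}"
      proof (cases "x \<in> Ms")
        case True
        have "K v j \<inter> (X \<union> Nd (cur v)) = {}" using X_props(3) minv_below[OF v al] D_v by blast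
        thus ?thesis using Ndm[OF True] Ms(3)[OF True] Nd'h by simp
      next
        case False
        thus ?thesis using kind[OF xU a] minv_below[OF xU] by metis
      qed
      fix u assume u: "u \<in> Nd' (cur' x)"
      have "R u \<subseteq> D x \<union> Nd' (cur' x) \<and> D x \<subseteq> D u"
      proof (cases "x \<in> Ms")
        case True
        show ?thesis
        proof (cases "u \<in> X")
          case uX: True
          then obtain w where "w \<in> Ms" "u \<in> Nd (cur w)" by (auto simp: X_def)
          hence "D x \<subseteq> D u" using minv_D_sub[OF Ms(1,4)] Ms(3) True by metis
          thus ?thesis using X_R[OF uX] Ndm[OF True] Ms(3)[OF True] by blast
        next
          case False
          hence uY: "u \<in> Nd (cur v)" using u Ndm[OF True] by blast
          show ?thesis using minv_R[OF v al uY] minv_D_sub[OF v al uY] D_v Ndm[OF True] Ms(3)[OF True] X_props(2) by blast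
        qed
      next
        case False
        hence cA: "cur x \<in> Al" and Nx: "Nd' (cur' x) = Nd (cur x)" using kind[OF xU a] by blast+
        show ?thesis using minv_R[OF xU cA] minv_D_sub[OF xU cA] u unfolding Nx by blast
      qed
      thus "R u \<subseteq> D x \<union> Nd' (cur' x)" "D x \<subseteq> D u" by auto }
  next
    fix u assume uU: "u \<in> U"
    then obtain x where x: "x \<in> U" "cur x \<in> Al" "u \<in> Nd (cur x)" using minv_cover by blast
    show "\<exists>x\<in>U. cur' x \<in> Al' \<and> u \<in> Nd' (cur' x)"
    proof (cases "x \<in> Ms \<or> cur x = cur v")
      case True
      obtain w where w: "w \<in> Ms" using Ms_nonempty by blast
      have "u \<in> X \<union> Nd (cur v)" using True x unfolding X_def by auto
      hence "u \<in> Nd' (cur' w)" using Ndm[OF w] Nd'h by simp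
      thus ?thesis using w alive2[OF Ms(1)[OF w]] Ms(1)[OF w] by blast
    next
      case False
      hence "u \<in> Nd' (cur' x)" "cur' x \<in> Al'" using x Ndo[OF x(1)] alive2[OF x(1)] by auto
      thus ?thesis using x(1) by blast
    qed
  next
    fix x y assume xU: "x \<in> U" and yU: "y \<in> U" and a: "cur' x \<in> Al'"
    { assume ay: "cur' y \<in> Al'" and ne: "cur' x \<noteq> cur' y"
      show "Nd' (cur' x) \<inter> Nd' (cur' y) = {}"
        using kind[OF xU a] kind[OF yU ay]
      proof (elim disjE conjE)
        assume "x \<in> Ms" "y \<in> Ms"
        thus ?thesis using ne cur' by simp
      next
        assume x: "x \<in> Ms" and y: "y \<notin> Ms" "cur y \<in> Al" "cur y \<noteq> cur v" "Nd' (cur' y) = Nd (cur y)"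
        show ?thesis using Ndm[OF x] XN[OF yU y(1-3)] y(4) Nd'h by simp
      next
        assume y: "y \<in> Ms" and x: "x \<notin> Ms" "cur x \<in> Al" "cur x \<noteq> cur v" "Nd' (cur' x) = Nd (cur x)"
        show ?thesis using Ndm[OF y] XN[OF xU x(1-3)] x(4) Nd'h by (simp add: Int_commute)
      next
        assume x: "cur x \<in> Al" "Nd' (cur' x) = Nd (cur x)" "cur' x = cur x"
          and y: "cur y \<in> Al" "Nd' (cur' y) = Nd (cur y)" "cur' y = cur y"
        show ?thesis using minv_disj[OF xU yU x(1) y(1)] ne x y by simp
      qed }
    { assume eq: "cur' x = cur' y"
      hence ay: "cur' y \<in> Al'" using a by simp
      show "D x = D y"
        using kind[OF xU a] kind[OF yU ay]
      proof (elim disjE conjE)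
        assume "x \<in> Ms" "y \<in> Ms"
        thus ?thesis using Ms(3) by simp
      next
        assume x: "x \<in> Ms" and y: "y \<notin> Ms"
        thus ?thesis using eq cur' hU[OF yU] by simp
      next
        assume y: "y \<in> Ms" and x: "x \<notin> Ms"
        thus ?thesis using eq cur' hU[OF xU] by simp
      next
        assume x: "cur x \<in> Al" "cur' x = cur x" and y: "cur' y = cur y"
        show ?thesis using minv_D[OF xU yU x(1)] eq x y by simp
      qed }
  next
    fix x p w assume xU: "x \<in> U" and pU: "p \<in> U" and a: "cur' x \<in> Al'" and dd: "cur' p \<notin> Al'" and w: "w \<in> H p"
    show "p \<in> Nd' (cur' x) \<longleftrightarrow> w \<in> Nd' (cur' x)"
    proof (cases "x \<in> Ms")
      case True
      thus ?thesis using Ndm[OF True] edge_new[OF pU dd w] Nd'h by simp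
    next
      case False
      hence x: "cur x \<in> Al" "cur x \<noteq> cur v" using a alive2[OF xU] by auto
      show ?thesis
      proof (cases "cur p \<in> Al")
        case True
        hence "cur p = cur v" "p \<notin> Ms" using dd alive2[OF pU] by auto
        hence "p \<in> Nd (cur v)" using minv_self[OF pU True] by simp
        hence "p \<in> X \<union> Nd (cur v)" "w \<in> X \<union> Nd (cur v)" using edge_new[OF pU dd w] by blast+
        thus ?thesis using XN[OF xU False x] Ndo[OF xU False x(1)] by (metis disjoint_iff)
      next
        case dp: False
        thus ?thesis using minv_edge[OF xU pU x(1) dp w] Ndo[OF xU \<open>x \<notin> Ms\<close> x(1)] by metis
      qed
    qed
  next
    fix x Z assume xU: "x \<in> U" and a: "cur' x \<in> Al'" and ne: "Z \<inter> Nd' (cur' x) \<noteq> {}"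
      and e: "\<And>p w. p \<in> U \<Longrightarrow> cur' p \<notin> Al' \<Longrightarrow> w \<in> H p \<Longrightarrow> p \<in> Z \<longleftrightarrow> w \<in> Z"
      and c: "\<And>u u'. u \<in> U \<Longrightarrow> u' \<in> R u \<Longrightarrow> u \<in> R u' \<Longrightarrow> u \<in> Z \<longleftrightarrow> u' \<in> Z"
    have still: "cur' p \<notin> Al'" if "p \<in> U" "cur p \<notin> Al" for p
      using that alive2 Ms(4) by blast
    have gen: "Nd (cur y) \<subseteq> Z" if "y \<in> U" "cur y \<in> Al" "Z \<inter> Nd (cur y) \<noteq> {}" for y
    proof (rule minv_gen[OF that])
      show "p \<in> Z \<longleftrightarrow> w \<in> Z" if "p \<in> U" "cur p \<notin> Al" "w \<in> H p" for p w
        by (rule e[OF that(1) still[OF that(1,2)] that(3)])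
    qed (rule c)
    show "Nd' (cur' x) \<subseteq> Z"
    proof (cases "x \<in> Ms")
      case False
      thus ?thesis using kind[OF xU a] gen[OF xU] ne by metis
    next
      case True
      have vd: "cur' v \<notin> Al'" using alive2[OF v] vMs by blast
      \<comment> \<open>The newly finished \<open>v\<close> is linked to every \<open>w\<close> in
        \<open>Ms\<close>, as these lie in \<open>H v\<close>. So a set that respects the links and
        meets one of the merged pieces contains them all.\<close>
      have ve: "v \<in> Z \<longleftrightarrow> w \<in> Z" if "w \<in> Ms" for w using e[OF v vd] Ms(2)[OF that] .
      have "v \<in> Z"
      proof (cases "Z \<inter> Nd (cur v) = {}")
        case False thus ?thesis using gen[OF v al] v_new by blast
      next
        case True
        then obtain w where w: "w \<in> Ms" "Z \<inter> Nd (cur w) \<noteq> {}"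
          using ne Ndm[OF \<open>x \<in> Ms\<close>] unfolding X_def by fastforce
        hence "w \<in> Z" using gen[OF Ms(1,4)[OF w(1)]] minv_self[OF Ms(1,4)[OF w(1)]] by blast
        thus ?thesis using ve w by blast
      qed
      hence "Nd (cur v) \<subseteq> Z" using gen[OF v al] v_new by blast
      moreover have "Nd (cur w) \<subseteq> Z" if "w \<in> Ms" for w
        using gen[OF Ms(1,4)[OF that]] minv_self[OF Ms(1,4)[OF that]] ve[OF that] \<open>v \<in> Z\<close> by blast
      ultimately have "X \<union> Nd (cur v) \<subseteq> Z" unfolding X_def by blast
      thus ?thesis using Ndm[OF True] by metis
    qed
  qed
qed

end

context nfree_preorder
begin

text \<open>The pieces are the equivalence classes. A context weight is below \<open>d\<close>,
  hence below \<open>j\<close>, so it is consistent that nothing has been put on a layer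
  yet.\<close>

lemma module_inv_init:
  assumes rep: "\<And>x y. x \<in> U \<Longrightarrow> y \<in> U \<Longrightarrow> cur x = cur y \<longleftrightarrow> y \<in> R x \<and> x \<in> R y"
    and al: "\<And>x. x \<in> U \<Longrightarrow> cur x \<in> Al"
    and Nd: "\<And>x. x \<in> U \<Longrightarrow> Nd (cur x) = {y \<in> U. cur y = cur x}"
    and dj: "\<And>x. x \<in> U \<Longrightarrow> d x \<le> j"
  shows "module_inv U R s j b P cur Al Nd"
proof unfold_locales
  have Nd': "Nd (cur x) = {y \<in> R x. x \<in> R y}" if "x \<in> U" for x
  proof -
    have "y \<in> Nd (cur x) \<longleftrightarrow> y \<in> R x \<and> x \<in> R y" for y
      using Nd[OF that] rep[OF that, of y] R_in_U[OF that, of y]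
      by (metis (mono_tags, lifting) mem_Collect_eq)
    thus ?thesis by blast
  qed
  fix x assume x: "x \<in> U"
  { assume "0 < d x" "j < cx x \<or> cx x = j \<and> x \<in> P"
    thus "cur x \<notin> Al" using cx_less[OF x] dj[OF x] by auto }
  { assume "cur x \<notin> Al" thus "0 < d x \<and> (j < cx x \<or> cx x = j \<and> d x \<le> b)" using al x by blast }
  show "x \<in> Nd (cur x)" "Nd (cur x) \<subseteq> U" using Nd[OF x] x by auto
  show "\<exists>y\<in>U. cur y \<in> Al \<and> x \<in> Nd (cur y)" using Nd[OF x] x al by auto
  show "Nd (cur x) \<inter> Nd (cur y) = {}" if "y \<in> U" "cur x \<noteq> cur y" for y
    using Nd[OF x] Nd[OF that(1)] that(2) by auto
  show "D x = D y" if "y \<in> U" "cur x = cur y" for y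
    using rep[OF x that(1)] D_eq[OF x] that by auto
  show "D x \<inter> Nd (cur x) = {}" using Nd'[OF x] by (auto simp: D_def)
  show "R u \<subseteq> D x \<union> Nd (cur x)" "D x \<subseteq> D u" if "u \<in> Nd (cur x)" for u
    using that Nd'[OF x] trans_R[OF x, of u] D_eq[OF x, of u] by (auto simp: D_def)
  show "(p \<in> Nd (cur x)) = (w \<in> Nd (cur x))" if "p \<in> U" "cur p \<notin> Al" for p w using that al by blast
  show "Nd (cur x) \<subseteq> Z" if ne: "Z \<inter> Nd (cur x) \<noteq> {}"
    and c: "\<And>u u'. u \<in> U \<Longrightarrow> u' \<in> R u \<Longrightarrow> u \<in> R u' \<Longrightarrow> u \<in> Z \<longleftrightarrow> u' \<in> Z" for Z
  proof
    fix y assume y: "y \<in> Nd (cur x)"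
    obtain z where z: "z \<in> Z" "z \<in> Nd (cur x)" using ne by blast
    have "z \<in> U" "y \<in> U" "cur z = cur y" using y z Nd[OF x] by auto
    thus "y \<in> Z" using c[of z y] rep[of z y] z by blast
  qed
qed

text \<open>\<open>b\<close> only bounds the \<open>d\<close> of the vertices put on top at the
  current \<open>j\<close>, so it can be raised to the \<open>d\<close> of the next vertex.\<close>

lemma module_inv_mono_b:
  assumes "module_inv U R s j b P cur Al Nd" "b \<le> b'"
  shows "module_inv U R s j b' P cur Al Nd"
proof -
  interpret module_inv U R s j b P cur Al Nd by fact
  show ?thesis
  proof unfold_locales
    show "Nd (cur x) \<subseteq> Z" if "x \<in> U" "cur x \<in> Al" "Z \<inter> Nd (cur x) \<noteq> {}"
      "\<And>p w. \<lbrakk> p \<in> U; cur p \<notin> Al; w \<in> H p \<rbrakk> \<Longrightarrow> p \<in> Z \<longleftrightarrow> w \<in> Z"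
      "\<And>u u'. \<lbrakk> u \<in> U; u' \<in> R u; u \<in> R u' \<rbrakk> \<Longrightarrow> u \<in> Z \<longleftrightarrow> u' \<in> Z" for x Z
      by (rule minv_gen[OF that])
    fix x assume "x \<in> U" "cur x \<notin> Al"
    from minv_dead[OF this] show "0 < d x \<and> (j < cx x \<or> cx x = j \<and> d x \<le> b')" using assms(2) by auto
  qed (fact minv_done minv_self minv_sub minv_cover minv_disj minv_D minv_below minv_R minv_D_sub minv_edge)+
qed

text \<open>If \<open>j\<close> is not a split of \<open>v\<close>, then \<open>cx v\<close> differs
  from \<open>j\<close> and nothing is due for \<open>v\<close> now; if \<open>v\<close> is not
  alive, its turn is over.\<close>

lemma module_inv_skip:
  assumes "module_inv U R s j b P cur Al Nd" "cur v \<notin> Al \<or> \<not> split v j"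
  shows "module_inv U R s j b (insert v P) cur Al Nd"
proof -
  interpret module_inv U R s j b P cur Al Nd by fact
  show ?thesis
  proof unfold_locales
    show "Nd (cur x) \<subseteq> Z" if "x \<in> U" "cur x \<in> Al" "Z \<inter> Nd (cur x) \<noteq> {}"
      "\<And>p w. \<lbrakk> p \<in> U; cur p \<notin> Al; w \<in> H p \<rbrakk> \<Longrightarrow> p \<in> Z \<longleftrightarrow> w \<in> Z"
      "\<And>u u'. \<lbrakk> u \<in> U; u' \<in> R u; u \<in> R u' \<rbrakk> \<Longrightarrow> u \<in> Z \<longleftrightarrow> u' \<in> Z" for x Z
      by (rule minv_gen[OF that])
    fix x assume x: "x \<in> U" "0 < d x" "j < cx x \<or> cx x = j \<and> x \<in> insert v P"
    show "cur x \<notin> Al"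
    proof (cases "x = v \<and> cx x = j")
      case True
      thus ?thesis using split_cx[OF x(1,2)] assms(2) by blast
    next
      case False
      show ?thesis by (rule minv_done[OF x(1,2)]) (use False x in blast)
    qed
  qed (fact minv_dead minv_self minv_sub minv_cover minv_disj minv_D minv_below minv_R minv_D_sub minv_edge)+
qed

text \<open>Vertices with context weight \<open>Suc j\<close> were finished as members of
  \<open>P\<close>; at \<open>j\<close> they are finished because their context weight exceeds the
  counter, so the scan can restart with no vertex treated.\<close>

lemma module_inv_next:
  assumes "module_inv U R s (Suc j) b P cur Al Nd" "U \<subseteq> P"
  shows "module_inv U R s j 0 {} cur Al Nd"
proof -
  interpret module_inv U R s "Suc j" b P cur Al Nd by fact
  show ?thesis
  proof unfold_locales
    show "Nd (cur x) \<subseteq> Z" if "x \<in> U" "cur x \<in> Al" "Z \<inter> Nd (cur x) \<noteq> {}"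
      "\<And>p w. \<lbrakk> p \<in> U; cur p \<notin> Al; w \<in> H p \<rbrakk> \<Longrightarrow> p \<in> Z \<longleftrightarrow> w \<in> Z"
      "\<And>u u'. \<lbrakk> u \<in> U; u' \<in> R u; u \<in> R u' \<rbrakk> \<Longrightarrow> u \<in> Z \<longleftrightarrow> u' \<in> Z" for x Z
      by (rule minv_gen[OF that])
    fix x assume x: "x \<in> U"
    { assume a: "0 < d x" "j < cx x \<or> cx x = j \<and> x \<in> {}"
      show "cur x \<notin> Al" by (rule minv_done[OF x a(1)]) (use a assms(2) x in auto) }
    { assume "cur x \<notin> Al"
      from minv_dead[OF x this] show "0 < d x \<and> (j < cx x \<or> cx x = j \<and> d x \<le> 0)" by auto }
  qed (fact minv_self minv_sub minv_cover minv_disj minv_D minv_below minv_R minv_D_sub minv_edge)+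
qed

text \<open>Zero is the least possible context weight, so at the end every vertex with something
  strictly below it sits on its layer.\<close>

lemma module_inv_final:
  assumes "module_inv U R s 0 b P cur Al Nd" "U \<subseteq> P" "x \<in> U"
  shows "cur x \<in> Al \<longleftrightarrow> d x = 0"
proof -
  interpret module_inv U R s 0 b P cur Al Nd by fact
  show ?thesis
  proof (cases "d x = 0")
    case True
    thus ?thesis using minv_dead[OF assms(3)] by auto
  next
    case False
    have "cur x \<notin> Al" by (rule minv_done[OF assms(3)]) (use False assms(2,3) in auto)
    thus ?thesis using False by simp
  qed
qed

text \<open>Leaves have numbers below \<open>n\<close>, inner nodes follow in order of creation. A
  join uses one number and lowers the number of live pieces by one, so \<open>nd + card Al\<close>
  does not grow and at most \<open>2 * n\<close> numbers occur: this bounds the space for the tree.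
  The last clause says that no node has two parents.\<close>

definition pool :: "nat \<Rightarrow> nat \<Rightarrow> nat set \<Rightarrow> (nat \<Rightarrow> nat set) \<Rightarrow> (nat \<Rightarrow> nat) \<Rightarrow> (nat \<Rightarrow> nat) \<Rightarrow> (nat \<Rightarrow> nat) \<Rightarrow> bool" where
  "pool n nd Al Nd Lc Rc Th \<longleftrightarrow> n \<le> nd \<and> Al \<subseteq> {..<nd} \<and> nd + card Al \<le> 2 * n \<and>
    (\<forall>i\<in>{n..<nd}. Lc i < i \<and> Rc i < i \<and> Lc i \<noteq> Rc i \<and> Lc i \<notin> Al \<and> Rc i \<notin> Al \<and>
       Nd i = Nd (Lc i) \<union> Nd (Rc i) \<and> node_ok (Nd (Lc i)) (Nd (Rc i)) (Th i)) \<and>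
    (\<forall>i\<in>{n..<nd}. \<forall>i'\<in>{n..<nd}. i \<noteq> i' \<longrightarrow> {Lc i, Rc i} \<inter> {Lc i', Rc i'} = {})"

lemma pool_join:
  assumes p: "pool n nd Al Nd Lc Rc Th" and hy: "h \<in> Al" "y \<in> Al" "h \<noteq> y" and ok: "node_ok (Nd h) (Nd y) \<theta>"
  shows "pool n (Suc nd) (insert nd (Al - {h, y})) (Nd(nd := Nd h \<union> Nd y)) (Lc(nd := h)) (Rc(nd := y)) (Th(nd := \<theta>))"
    and "Suc nd < 2 * n" "h < nd" "y < nd"
proof -
  have Al: "Al \<subseteq> {..<nd}" and c: "nd + card Al \<le> 2 * n" and nn: "n \<le> nd" using p by (auto simp: pool_def)
  have fin: "finite Al" using Al finite_subset by blast
  show lt: "h < nd" "y < nd" using Al hy by auto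
  have "card {h, y} \<le> card Al" using fin hy by (intro card_mono) auto
  hence c2: "2 \<le> card Al" using hy by simp
  thus "Suc nd < 2 * n" using c by simp
  have "card (Al - {h, y}) = card Al - 2" using hy fin by (simp add: card_Diff_subset)
  moreover have "nd \<notin> Al - {h, y}" using Al by auto
  ultimately have cd: "card (insert nd (Al - {h, y})) = card Al - 1" using fin c2 by simp
  have old: "Lc i < i" "Rc i < i" "Lc i \<noteq> Rc i" "Lc i \<notin> Al" "Rc i \<notin> Al"
      "Nd i = Nd (Lc i) \<union> Nd (Rc i)" "node_ok (Nd (Lc i)) (Nd (Rc i)) (Th i)"
    if "i \<in> {n..<nd}" for i using p that by (auto simp: pool_def)
  have dis: "{Lc i, Rc i} \<inter> {Lc i', Rc i'} = {}" if "i \<in> {n..<nd}" "i' \<in> {n..<nd}" "i \<noteq> i'" for i i'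
    using p that unfolding pool_def by blast
  show "pool n (Suc nd) (insert nd (Al - {h, y})) (Nd(nd := Nd h \<union> Nd y)) (Lc(nd := h)) (Rc(nd := y)) (Th(nd := \<theta>))"
    unfolding pool_def
  proof (intro conjI ballI impI)
    show "Suc nd + card (insert nd (Al - {h, y})) \<le> 2 * n" using cd c c2 by simp
    show "n \<le> Suc nd" "insert nd (Al - {h, y}) \<subseteq> {..<Suc nd}" using nn Al by auto
  next
    fix i assume "i \<in> {n..<Suc nd}"
    hence "i = nd \<or> i \<in> {n..<nd}" by auto
    hence all: "((Lc(nd := h)) i < i)
      \<and> ((Rc(nd := y)) i < i)
      \<and> ((Lc(nd := h)) i \<noteq> (Rc(nd := y)) i)
      \<and> ((Lc(nd := h)) i \<notin> insert nd (Al - {h, y}))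
      \<and> ((Rc(nd := y)) i \<notin> insert nd (Al - {h, y}))
      \<and> ((Nd(nd := Nd h \<union> Nd y)) i = (Nd(nd := Nd h \<union> Nd y)) ((Lc(nd := h)) i) \<union> (Nd(nd := Nd h \<union> Nd y)) ((Rc(nd := y)) i))
      \<and> (node_ok ((Nd(nd := Nd h \<union> Nd y)) ((Lc(nd := h)) i)) ((Nd(nd := Nd h \<union> Nd y)) ((Rc(nd := y)) i)) ((Th(nd := \<theta>)) i))" (is "?P")
    proof (elim disjE)
      assume "i = nd"
      thus "?P" using lt hy ok by auto
    next
      assume i: "i \<in> {n..<nd}"
      hence "i \<noteq> nd" "Lc i \<noteq> nd" "Rc i \<noteq> nd" "Lc i \<noteq> h" using old[OF i] hy by auto
      thus "?P" using old[OF i] by auto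
    qed
    from all show "(Lc(nd := h)) i < i"
       "(Rc(nd := y)) i < i"
       "(Lc(nd := h)) i \<noteq> (Rc(nd := y)) i"
       "(Lc(nd := h)) i \<notin> insert nd (Al - {h, y})"
       "(Rc(nd := y)) i \<notin> insert nd (Al - {h, y})"
       "(Nd(nd := Nd h \<union> Nd y)) i = (Nd(nd := Nd h \<union> Nd y)) ((Lc(nd := h)) i) \<union> (Nd(nd := Nd h \<union> Nd y)) ((Rc(nd := y)) i)"
       "node_ok ((Nd(nd := Nd h \<union> Nd y)) ((Lc(nd := h)) i)) ((Nd(nd := Nd h \<union> Nd y)) ((Rc(nd := y)) i)) ((Th(nd := \<theta>)) i)"
      by blast+
  next
    fix i i' assume "i \<in> {n..<Suc nd}" "i' \<in> {n..<Suc nd}" "i \<noteq> i'"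
    hence "i = nd \<and> i' \<in> {n..<nd} \<or> i' = nd \<and> i \<in> {n..<nd} \<or> i \<in> {n..<nd} \<and> i' \<in> {n..<nd} \<and> i \<noteq> i'" by auto
    thus "{(Lc(nd := h)) i, (Rc(nd := y)) i} \<inter> {(Lc(nd := h)) i', (Rc(nd := y)) i'} = {}"
    proof (elim disjE conjE)
      assume i: "i = nd" "i' \<in> {n..<nd}"
      thus ?thesis using old(4,5)[OF i(2)] hy by auto
    next
      assume i: "i' = nd" "i \<in> {n..<nd}"
      thus ?thesis using old(4,5)[OF i(2)] hy by auto
    next
      assume i: "i \<in> {n..<nd}" "i' \<in> {n..<nd}" "i \<noteq> i'"
      thus ?thesis using dis[OF i] by auto
    qed
  qed
qed

lemma pool_cong:
  assumes "pool n nd Al Nd Lc Rc Th" "Al = Al'" "\<And>i. i < nd \<Longrightarrow> Nd i = Nd' i"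
    "\<And>i. i < nd \<Longrightarrow> Lc i = Lc' i" "\<And>i. i < nd \<Longrightarrow> Rc i = Rc' i" "\<And>i. i < nd \<Longrightarrow> Th i = Th' i"
  shows "pool n nd Al' Nd' Lc' Rc' Th'"
proof -
  have "Nd (Lc i) = Nd' (Lc i)" "Nd (Rc i) = Nd' (Rc i)" if "i \<in> {n..<nd}" for i
  proof -
    have "Lc i < i" "Rc i < i" "i < nd" using assms(1) that by (auto simp: pool_def)
    thus "Nd (Lc i) = Nd' (Lc i)" "Nd (Rc i) = Nd' (Rc i)" using assms(3) by auto
  qed
  thus ?thesis using assms unfolding pool_def by auto
qed

text \<open>Progress of a pass that unites pieces: \<open>S\<close> contains the old pieces met so
  far and \<open>h\<close> numbers their union, with \<open>none\<close> for the empty one. A piece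
  can be met repeatedly; it is new exactly if it is alive and different from
  \<open>h\<close>.\<close>

definition absorbed :: "nat \<Rightarrow> nat set \<Rightarrow> (nat \<Rightarrow> nat set) \<Rightarrow> nat set \<Rightarrow> nat \<Rightarrow> nat set \<Rightarrow> (nat \<Rightarrow> nat set) \<Rightarrow> bool" where
  "absorbed none Al0 Nd0 S h Al Nd \<longleftrightarrow> S \<subseteq> Al0 \<and> (\<forall>y\<in>Al0. Nd y = Nd0 y) \<and>
    (if S = {} then h = none \<and> Al = Al0
     else h \<in> Al \<and> h \<notin> Al0 - S \<and> Nd h = (\<Union>y\<in>S. Nd0 y) \<and> Al = insert h (Al0 - S))"

lemma absorbed_init: "absorbed none Al Nd {} none Al Nd"
  by (simp add: absorbed_def)

lemma absorbed_skip:
  assumes "absorbed none Al0 Nd0 S h Al Nd" "y \<in> Al0" "none \<notin> Al0" "y \<notin> Al \<or> y = h"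
  shows "absorbed none Al0 Nd0 (insert y S) h Al Nd"
proof -
  have "y \<in> S" using assms by (auto simp: absorbed_def split: if_splits)
  thus ?thesis using assms(1) by (simp add: insert_absorb)
qed

lemma absorbed_first:
  assumes "absorbed none Al0 Nd0 {} h Al Nd" "y \<in> Al0"
  shows "absorbed none Al0 Nd0 {y} y Al Nd"
  using assms by (auto simp: absorbed_def)

lemma absorbed_more:
  assumes a: "absorbed none Al0 Nd0 S h Al Nd" and y: "y \<in> Al0" "y \<in> Al" "y \<noteq> h" and S: "S \<noteq> {}"
    and h': "h' \<notin> Al" "h' \<notin> Al0"
  shows "absorbed none Al0 Nd0 (insert y S) h' (insert h' (Al - {h, y})) (Nd(h' := Nd h \<union> Nd y))"
proof -
  have "y \<notin> S" using a y S by (auto simp: absorbed_def)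
  have "h \<notin> Al0 - S" "Al = insert h (Al0 - S)" using a S by (auto simp: absorbed_def)
  hence "Al - {h, y} = Al0 - insert y S" using y by auto
  thus ?thesis using a y S h' by (auto simp: absorbed_def)
qed

lemma absorbed_unrelated:
  assumes "absorbed none Al0 Nd0 S h Al Nd" "S \<noteq> {}" "y \<in> Al0"
    and "\<And>z. z \<in> S \<Longrightarrow> Nd0 z \<inter> Nd0 y = {}"
    and "\<And>z x. z \<in> S \<Longrightarrow> x \<in> Nd0 z \<Longrightarrow> R x \<inter> Nd0 y = {}"
    and "\<And>z x. z \<in> S \<Longrightarrow> x \<in> Nd0 y \<Longrightarrow> R x \<inter> Nd0 z = {}"
  shows "node_ok (Nd h) (Nd y) 0"
proof -
  have e: "Nd h = (\<Union>y\<in>S. Nd0 y)" "Nd y = Nd0 y" using assms(1-3) by (auto simp: absorbed_def)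
  show ?thesis unfolding e
  proof (rule node_ok_union)
    show "(\<Union>y\<in>S. Nd0 y) \<inter> Nd0 y = {}" using assms(4) by blast
    show "R x \<inter> Nd0 y = {}" if "x \<in> (\<Union>y\<in>S. Nd0 y)" for x using that assms(5) by blast
    show "R x \<inter> (\<Union>y\<in>S. Nd0 y) = {}" if "x \<in> Nd0 y" for x using that assms(6) by blast
  qed
qed

section \<open>Dynamic programming\<close>

definition weights :: "nat set \<Rightarrow> nat set" where
  "weights X = {sum s A | A. closed_in X A}"

lemma closed_in_empty: "closed_in X {}" by (simp add: closed_in_def)
lemma zero_weights: "0 \<in> weights X"
  unfolding weights_def using closed_in_empty by (metis (mono_tags, lifting) mem_Collect_eq sum.empty)

lemma sum_0_empty: assumes "A \<subseteq> U" "sum s A = 0" shows "A = {}"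
proof (rule ccontr)
  assume "A \<noteq> {}"
  then obtain x where x: "x \<in> A" by blast
  hence "s x = 0" using assms finite_subset[OF assms(1) finite_U] by simp
  thus False using pos[of x] x assms(1) by auto
qed

text \<open>Sizes are positive, so weight 0 means the empty set and the exception for
  \<open>B = {}\<close> can be read off the weight \<open>b\<close>.\<close>

lemma weights_node:
  assumes ok: "node_ok X Y \<theta>" and fin: "finite X" "finite Y" and YU: "Y \<subseteq> U"
  shows "t \<in> weights (X \<union> Y) \<longleftrightarrow> (\<exists>a b. t = a + b \<and> a \<in> weights X \<and> b \<in> weights Y \<and> (b = 0 \<or> \<theta> \<le> a))"
proof
  assume "t \<in> weights (X \<union> Y)"
  then obtain C where C: "closed_in (X \<union> Y) C" "t = sum s C" by (auto simp: weights_def)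
  have CX: "C = C \<inter> X \<union> C \<inter> Y" using C by (auto simp: closed_in_def)
  have "closed_in (X \<union> Y) (C \<inter> X \<union> C \<inter> Y)" using C(1) CX by metis
  hence cl: "closed_in X (C \<inter> X)" "closed_in Y (C \<inter> Y)" "C \<inter> Y = {} \<or> \<theta> \<le> sum s (C \<inter> X)"
    using ok unfolding node_ok_def by (meson inf_le2)+
  have "(C \<inter> X) \<inter> (C \<inter> Y) = {}" using ok by (auto simp: node_ok_def)
  hence "sum s (C \<inter> X \<union> C \<inter> Y) = sum s (C \<inter> X) + sum s (C \<inter> Y)"
    using fin by (intro sum.union_disjoint) auto
  hence "t = sum s (C \<inter> X) + sum s (C \<inter> Y)" using C(2) CX by metis
  thus "\<exists>a b. t = a + b \<and> a \<in> weights X \<and> b \<in> weights Y \<and> (b = 0 \<or> \<theta> \<le> a)"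
    using cl unfolding weights_def by (intro exI[of _ "sum s (C \<inter> X)"] exI[of _ "sum s (C \<inter> Y)"]) auto
next
  assume "\<exists>a b. t = a + b \<and> a \<in> weights X \<and> b \<in> weights Y \<and> (b = 0 \<or> \<theta> \<le> a)"
  then obtain A C where A: "closed_in X A" and C: "closed_in Y C" and t: "t = sum s A + sum s C"
    and o: "sum s C = 0 \<or> \<theta> \<le> sum s A" by (auto simp: weights_def)
  have sub: "A \<subseteq> X" "C \<subseteq> Y" using A C by (auto simp: closed_in_def)
  have "C = {} \<or> \<theta> \<le> sum s A"
    using o sum_0_empty[of C] sub(2) YU by blast
  hence "closed_in (X \<union> Y) (A \<union> C)" using ok A C sub unfolding node_ok_def by blast
  moreover have "sum s (A \<union> C) = t"
    using t sub ok finite_subset[OF sub(1) fin(1)] finite_subset[OF sub(2) fin(2)]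
    by (subst sum.union_disjoint) (auto simp: node_ok_def)
  ultimately show "t \<in> weights (X \<union> Y)" by (auto simp: weights_def)
qed

lemma closed_sum_0: "closed_in X A \<Longrightarrow> X \<subseteq> U \<Longrightarrow> sum s A = 0 \<Longrightarrow> A = {}"
  using sum_0_empty[of A] unfolding closed_in_def by blast

end

text \<open>An entry \<open>T i t\<close> of a table is 0 if no closed subset of node \<open>i\<close> has weight \<open>t\<close>, and otherwise the
  successor of the weight that the left child contributes.\<close>

locale solution_table = nfree_preorder U R s
  for U :: "nat set" and R :: "nat \<Rightarrow> nat set" and s :: "nat \<Rightarrow> nat" +
  fixes n nd c :: nat and Nd :: "nat \<Rightarrow> nat set" and Lc Rc Th :: "nat \<Rightarrow> nat" and T :: "nat \<Rightarrow> nat \<Rightarrow> nat" and Al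
  assumes pool: "pool n nd Al Nd Lc Rc Th"
    and leaf: "\<lbrakk> i < n; Nd i \<noteq> {}; t \<le> c \<rbrakk> \<Longrightarrow> T i t \<noteq> 0 \<longleftrightarrow> t = 0 \<or> t = sum s (Nd i)"
    and leaf_closed: "\<lbrakk> i < n; x \<in> Nd i \<rbrakk> \<Longrightarrow> Nd i \<subseteq> R x"
    and NdU: "i < nd \<Longrightarrow> Nd i \<subseteq> U"
    and inner: "\<lbrakk> n \<le> i; i < nd; t \<le> c \<rbrakk> \<Longrightarrow> T i t \<noteq> 0 \<longleftrightarrow>
      (\<exists>a b. t = a + b \<and> T (Lc i) a \<noteq> 0 \<and> T (Rc i) b \<noteq> 0 \<and> (b = 0 \<or> Th i \<le> a))"
    and retrace: "\<lbrakk> n \<le> i; i < nd; t \<le> c; T i t \<noteq> 0 \<rbrakk> \<Longrightarrow> (let a = T i t - 1 in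
      a \<le> t \<and> T (Lc i) a \<noteq> 0 \<and> T (Rc i) (t - a) \<noteq> 0 \<and> (t - a = 0 \<or> Th i \<le> a))"
    and nonempty: "\<lbrakk> n \<le> i; i < nd \<rbrakk> \<Longrightarrow> Nd (Lc i) \<noteq> {} \<and> Nd (Rc i) \<noteq> {}"
begin

lemma children: assumes "n \<le> i" "i < nd"
  shows "Lc i < i" "Rc i < i" "Lc i \<noteq> Rc i" "Nd i = Nd (Lc i) \<union> Nd (Rc i)"
    "node_ok (Nd (Lc i)) (Nd (Rc i)) (Th i)" "Lc i \<notin> Al" "Rc i \<notin> Al"
  using pool assms by (auto simp: pool_def)

lemma children_disjoint: "\<lbrakk> n \<le> i; i < nd; n \<le> i'; i' < nd; i \<noteq> i' \<rbrakk> \<Longrightarrow> {Lc i, Rc i} \<inter> {Lc i', Rc i'} = {}"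
  using pool by (auto simp: pool_def)

lemma closed_leaf: assumes "i < n" "Nd i \<noteq> {}" shows "closed_in (Nd i) A \<longleftrightarrow> A = {} \<or> A = Nd i"
  using leaf_closed[OF assms(1)] unfolding closed_in_def by blast

lemma table: "\<lbrakk> i < nd; Nd i \<noteq> {}; t \<le> c \<rbrakk> \<Longrightarrow> T i t \<noteq> 0 \<longleftrightarrow> t \<in> weights (Nd i)"
proof (induction i arbitrary: t rule: less_induct)
  case (less i)
  show ?case
  proof (cases "i < n")
    case True
    have "t \<in> weights (Nd i) \<longleftrightarrow> t = 0 \<or> t = sum s (Nd i)"
      using closed_leaf[OF True less.prems(2)] unfolding weights_def mem_Collect_eq by (metis sum.empty)
    thus ?thesis using leaf[OF True less.prems(2,3)] by simp
  next
    case False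
    hence i: "n \<le> i" "i < nd" using less.prems by auto
    note ch = children[OF i]
    have lt: "Lc i < nd" "Rc i < nd" using ch i by auto
    have fin: "finite (Nd (Lc i))" "finite (Nd (Rc i))" "Nd (Rc i) \<subseteq> U"
      using NdU lt finite_U finite_subset by blast+
    have "T (Lc i) a \<noteq> 0 \<longleftrightarrow> a \<in> weights (Nd (Lc i))" "T (Rc i) a \<noteq> 0 \<longleftrightarrow> a \<in> weights (Nd (Rc i))"
      if "a \<le> c" for a using less.IH ch lt nonempty[OF i] that by auto
    hence "(\<exists>a b. t = a + b \<and> T (Lc i) a \<noteq> 0 \<and> T (Rc i) b \<noteq> 0 \<and> (b = 0 \<or> Th i \<le> a)) \<longleftrightarrow>
       (\<exists>a b. t = a + b \<and> a \<in> weights (Nd (Lc i)) \<and> b \<in> weights (Nd (Rc i)) \<and> (b = 0 \<or> Th i \<le> a))"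
      using less.prems(3) by (metis le_trans le_add1 le_add2)
    thus ?thesis using inner[OF i less.prems(3)] weights_node[OF ch(5) fin, of t] ch(4) by simp
  qed
qed

text \<open>The closed set that the table entries describe; a leaf contributes all of its class or
  nothing. Numbers from \<open>nd\<close> on are treated like leaves to make the recursion
  total.\<close>

function sol :: "nat \<Rightarrow> nat \<Rightarrow> nat set" where
  "sol i t = (if i < n \<or> nd \<le> i then if t = 0 then {} else Nd i
     else sol (Lc i) (T i t - 1) \<union> sol (Rc i) (t - (T i t - 1)))"
  by auto
termination by (relation "measure fst") (use children in auto)

declare sol.simps [simp del]

lemma sol: "\<lbrakk> i < nd; Nd i \<noteq> {}; t \<le> c; T i t \<noteq> 0 \<rbrakk> \<Longrightarrow> closed_in (Nd i) (sol i t) \<and> sum s (sol i t) = t"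
proof (induction i t rule: sol.induct)
  case (1 i t)
  show ?case
  proof (cases "i < n")
    case True
    thus ?thesis using leaf[OF True 1(4,5)] 1(6) closed_leaf[OF True 1(4)] sol.simps[of i t] by auto
  next
    case False
    hence i: "n \<le> i" "i < nd" using 1 by auto
    note ch = children[OF i] and ne = nonempty[OF i]
    let ?a = "T i t - 1" let ?A = "sol (Lc i) ?a" and ?B = "sol (Rc i) (t - ?a)"
    have b: "?a \<le> t" "T (Lc i) ?a \<noteq> 0" "T (Rc i) (t - ?a) \<noteq> 0" "t - ?a = 0 \<or> Th i \<le> ?a"
      using retrace[OF i 1(5,6)] by (auto simp: Let_def)
    have lt: "Lc i < nd" "Rc i < nd" using ch i by auto
    have n: "\<not> (i < n \<or> nd \<le> i)" using i by simp
    have A: "closed_in (Nd (Lc i)) ?A" "sum s ?A = ?a" using 1(1)[OF n lt(1)] ne b 1(5) by auto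
    have B: "closed_in (Nd (Rc i)) ?B" "sum s ?B = t - ?a" using 1(2)[OF n lt(2)] ne b 1(5) by auto
    have sub: "?A \<subseteq> Nd (Lc i)" "?B \<subseteq> Nd (Rc i)" using A B by (auto simp: closed_in_def)
    have "?B = {} \<or> Th i \<le> sum s ?A" using closed_sum_0[OF B(1) NdU[OF lt(2)]] B(2) A(2) b(4) by auto
    hence "closed_in (Nd i) (?A \<union> ?B)" using ch(4,5) A(1) B(1) sub unfolding node_ok_def by metis
    moreover have "sum s (?A \<union> ?B) = t"
    proof -
      have "Nd (Lc i) \<inter> Nd (Rc i) = {}" using ch(5) by (simp add: node_ok_def)
      hence "?A \<inter> ?B = {}" using sub by blast
      moreover have "finite ?A" "finite ?B"
        using finite_subset[OF subset_trans[OF sub(1) NdU[OF lt(1)]] finite_U]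
          finite_subset[OF subset_trans[OF sub(2) NdU[OF lt(2)]] finite_U] by auto
      ultimately show ?thesis using A B b(1) by (simp add: sum.union_disjoint)
    qed
    ultimately show ?thesis using sol.simps[of i t] n by simp
  qed
qed

lemma sol_0: assumes "i < nd" shows "i < n \<or> Nd i \<noteq> {} \<Longrightarrow> sol i 0 = {}"
proof (cases "i < n")
  case True thus ?thesis by (simp add: sol.simps)
next
  case False
  assume "i < n \<or> Nd i \<noteq> {}"
  with False have ne: "Nd i \<noteq> {}" by simp
  have "T i 0 \<noteq> 0" using table[OF assms ne] zero_weights by simp
  thus ?thesis using sol[OF assms ne] closed_sum_0[OF _ NdU[OF assms]] by simp
qed

text \<open>Invariant of the traceback: nodes from \<open>m\<close> on have passed their demands on
  to their children, and \<open>tg\<close> holds the weights asked of the others. Entries of the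
  former stay in place, so the union stops at \<open>m\<close>. The last clause says that a node
  with a demand is not the child of a node still waiting.\<close>

definition traced :: "nat \<Rightarrow> nat \<Rightarrow> nat \<Rightarrow> (nat \<Rightarrow> nat) \<Rightarrow> bool" where
  "traced rt t m tg \<longleftrightarrow> (\<Union>y<m. sol y (tg y)) = sol rt t \<and>
    (\<forall>y<m. tg y \<noteq> 0 \<longrightarrow> Nd y \<noteq> {} \<and> tg y \<le> c \<and> T y (tg y) \<noteq> 0 \<and>
       (\<forall>i\<in>{n..<m}. y \<noteq> Lc i \<and> y \<noteq> Rc i))"

lemma inner_nonempty: "n \<le> i \<Longrightarrow> i < nd \<Longrightarrow> Nd i \<noteq> {}"
  using children(4) nonempty by auto

lemma traced_init:
  assumes "rt \<in> Al" "Nd rt \<noteq> {}" "t \<le> c" "T rt t \<noteq> 0"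
  shows "traced rt t nd (\<lambda>y. if y = rt then t else 0)"
proof -
  have r: "rt < nd" using assms(1) pool by (auto simp: pool_def)
  have "sol y 0 = {}" if "y < nd" for y using sol_0[OF that] inner_nonempty[of y] that by fastforce
  hence "(\<Union>y<nd. sol y (if y = rt then t else 0)) = sol rt t" using r by (auto split: if_splits)
  thus ?thesis using assms children(6,7) unfolding traced_def by (auto split: if_splits)
qed

lemma traced_step:
  assumes tr: "traced rt t (Suc m) tg" and m: "n \<le> m" "m < nd"
    and k: "k = T m (tg m) - 1"
  shows "traced rt t m (tg(Lc m := k, Rc m := tg m - k))"
proof -
  note ch = children[OF m] and ne = nonempty[OF m]
  let ?tg = "tg(Lc m := k, Rc m := tg m - k)"
  \<comment> \<open>Node \<open>m\<close> is still waiting, so nothing has been asked of its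
    children and overwriting their entries loses nothing.\<close>
  have z: "tg (Lc m) = 0" "tg (Rc m) = 0"
    using tr ch m unfolding traced_def by (metis atLeastLessThan_iff lessI less_SucI)+
  have T0: "T m 0 \<noteq> 0" using table[OF m(2) inner_nonempty[OF m]] zero_weights by simp
  have tm: "tg m \<le> c" "T m (tg m) \<noteq> 0" using tr T0 unfolding traced_def by (cases "tg m = 0"; simp)+
  have b: "k \<le> tg m" "T (Lc m) k \<noteq> 0" "T (Rc m) (tg m - k) \<noteq> 0"
    using retrace[OF m tm] k by (auto simp: Let_def)
  have s0: "sol (Lc m) 0 = {}" "sol (Rc m) 0 = {}" using sol_0[of "Lc m"] sol_0[of "Rc m"] ch m ne by auto
  have sm: "sol m (tg m) = sol (Lc m) k \<union> sol (Rc m) (tg m - k)"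
    using sol.simps[of m "tg m"] m k by simp
  have u: "(\<Union>y<m. sol y (?tg y)) = (\<Union>y<Suc m. sol y (tg y))"
  proof -
    have "(\<Union>y<m. sol y (tg y)) = (\<Union>y\<in>{..<m} - {Lc m, Rc m}. sol y (tg y))"
      using s0 z by auto
    moreover have "(\<Union>y<m. sol y (?tg y)) = (\<Union>y\<in>{..<m} - {Lc m, Rc m}. sol y (tg y)) \<union> sol m (tg m)"
    proof -
      let ?M = "{..<m} - {Lc m, Rc m}"
      have e: "{..<m} = insert (Lc m) (insert (Rc m) ?M)" using ch(1,2) by auto
      have "(\<Union>y\<in>insert (Lc m) (insert (Rc m) ?M). sol y (?tg y))
          = sol (Lc m) (?tg (Lc m)) \<union> (sol (Rc m) (?tg (Rc m)) \<union> (\<Union>y\<in>?M. sol y (?tg y)))"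
        by (simp only: UN_insert)
      moreover have "(\<Union>y\<in>?M. sol y (?tg y)) = (\<Union>y\<in>?M. sol y (tg y))"
        by (rule SUP_cong) auto
      ultimately show ?thesis unfolding e[symmetric] sm using ch(3) by auto
    qed
    ultimately show ?thesis by (simp add: lessThan_Suc Un_commute)
  qed
  have l: "Nd y \<noteq> {} \<and> ?tg y \<le> c \<and> T y (?tg y) \<noteq> 0 \<and> (\<forall>i\<in>{n..<m}. y \<noteq> Lc i \<and> y \<noteq> Rc i)"
    if y: "y < m" "?tg y \<noteq> 0" for y
  proof (cases "y = Lc m \<or> y = Rc m")
    case True
    have "\<forall>i\<in>{n..<m}. y \<noteq> Lc i \<and> y \<noteq> Rc i"
    proof
      fix i assume "i \<in> {n..<m}"
      hence "{Lc i, Rc i} \<inter> {Lc m, Rc m} = {}" using children_disjoint[of i m] m by auto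
      thus "y \<noteq> Lc i \<and> y \<noteq> Rc i" using True by auto
    qed
    thus ?thesis using True b tm ne ch(3) by auto
  next
    case False
    thus ?thesis using y tr unfolding traced_def by auto
  qed
  have "(\<Union>y<Suc m. sol y (tg y)) = sol rt t" using tr by (simp only: traced_def)
  note r = trans[OF u this]
  show ?thesis unfolding traced_def
    by (rule conjI, rule r, intro allI impI, rule l)
qed

end

section \<open>Reachability in directed co-graphs\<close>

text \<open>Cross arcs lead from \<open>V1\<close> to \<open>V2\<close> only, so a path that has
  entered \<open>V2\<close> stays there and a path ending in \<open>V1\<close> never left
  it.\<close>

lemma layered_rtrancl:
  assumes V: "V1 \<inter> V2 = {}" and E: "E1 \<subseteq> V1 \<times> V1" "E2 \<subseteq> V2 \<times> V2" "C \<subseteq> V1 \<times> V2"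
    and xy: "(x, y) \<in> (E1 \<union> E2 \<union> C)\<^sup>*"
  shows "x \<in> V2 \<Longrightarrow> y \<in> V2 \<and> (x, y) \<in> E2\<^sup>*" and "y \<in> V1 \<Longrightarrow> x \<in> V1 \<and> (x, y) \<in> E1\<^sup>*"
proof -
  show "y \<in> V2 \<and> (x, y) \<in> E2\<^sup>*" if "x \<in> V2" using xy that
  proof (induction rule: rtrancl_induct)
    case (step y z)
    hence "(y, z) \<in> E2" using V E by blast
    thus ?case using step E by (auto intro: rtrancl_into_rtrancl)
  qed simp
  show "x \<in> V1 \<and> (x, y) \<in> E1\<^sup>*" if "y \<in> V1" using xy that
  proof (induction rule: converse_rtrancl_induct)
    case (step x z)
    hence "(x, z) \<in> E1" using V E by blast
    thus ?case using step E by (auto intro: converse_rtrancl_into_rtrancl)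
  qed simp
qed

lemma cograph_arcs: "directed_cograph G \<Longrightarrow> parcs G \<subseteq> pverts G \<times> pverts G"
  by (induction rule: directed_cograph.induct)
    (auto simp: disjoint_union_def series_composition_def order_composition_def)

definition nfree_on :: "'a set \<Rightarrow> ('a \<times> 'a) set \<Rightarrow> bool" where
  "nfree_on V E \<longleftrightarrow> (\<forall>v\<in>V. \<forall>v'\<in>V. \<forall>p\<in>V. \<forall>q\<in>V. (v, v') \<notin> E\<^sup>* \<longrightarrow> (v', v) \<notin> E\<^sup>* \<longrightarrow>
     (v, p) \<in> E\<^sup>* \<longrightarrow> (v', p) \<notin> E\<^sup>* \<longrightarrow> (v, q) \<in> E\<^sup>* \<longrightarrow> (v', q) \<in> E\<^sup>* \<longrightarrow> (p, q) \<in> E\<^sup>*)"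

lemma nfree_onD: "\<lbrakk> nfree_on V E; v \<in> V; v' \<in> V; p \<in> V; q \<in> V; (v, v') \<notin> E\<^sup>*; (v', v) \<notin> E\<^sup>*;
    (v, p) \<in> E\<^sup>*; (v', p) \<notin> E\<^sup>*; (v, q) \<in> E\<^sup>*; (v', q) \<in> E\<^sup>* \<rbrakk> \<Longrightarrow> (p, q) \<in> E\<^sup>*"
  unfolding nfree_on_def by blast

text \<open>Covers the disjoint union and the order composition. Without cross arcs, all vertices of
  an N lie in one part. With all of them, every vertex of \<open>V1\<close> reaches every vertex of
  \<open>V2\<close>, which contradicts one of the missing relations unless the N lies in one
  part.\<close>

lemma nfree_on_layered:
  assumes V: "V1 \<inter> V2 = {}" and E: "E1 \<subseteq> V1 \<times> V1" "E2 \<subseteq> V2 \<times> V2"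
    and C: "C = {} \<or> C = V1 \<times> V2" and 1: "nfree_on V1 E1" and 2: "nfree_on V2 E2"
  shows "nfree_on (V1 \<union> V2) (E1 \<union> E2 \<union> C)"
  unfolding nfree_on_def
proof (intro ballI impI)
  let ?E = "E1 \<union> E2 \<union> C"
  have sub: "E1\<^sup>* \<subseteq> ?E\<^sup>*" "E2\<^sup>* \<subseteq> ?E\<^sup>*" by (rule rtrancl_mono; blast)+
  have CV: "C \<subseteq> V1 \<times> V2" using C by blast
  note L2 = layered_rtrancl(1)[OF V E CV] and L1 = layered_rtrancl(2)[OF V E CV]
  fix v v' p q assume vs: "v \<in> V1 \<union> V2" "v' \<in> V1 \<union> V2" "p \<in> V1 \<union> V2" "q \<in> V1 \<union> V2"
    and inc: "(v, v') \<notin> ?E\<^sup>*" "(v', v) \<notin> ?E\<^sup>*"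
    and p: "(v, p) \<in> ?E\<^sup>*" "(v', p) \<notin> ?E\<^sup>*" and q: "(v, q) \<in> ?E\<^sup>*" "(v', q) \<in> ?E\<^sup>*"
  have cross: "(x, y) \<in> ?E\<^sup>*" if "C \<noteq> {}" "x \<in> V1" "y \<in> V2" for x y using that C by blast
  have stay: "y \<in> V1" if "C = {}" "(x, y) \<in> ?E\<^sup>*" "x \<in> V1" "y \<in> V1 \<union> V2" for x y
  proof (rule ccontr)
    assume "y \<notin> V1"
    have "(x, y) \<in> (E2 \<union> E1 \<union> {})\<^sup>*" using that by (simp add: Un_commute)
    from layered_rtrancl(2)[OF _ E(2,1) _ this] \<open>y \<notin> V1\<close> that V show False by blast
  qed
  have all1: "(p, q) \<in> ?E\<^sup>*" if i: "v \<in> V1" "v' \<in> V1" "p \<in> V1" "q \<in> V1"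
    using nfree_onD[OF 1 i] inc p q L1 sub i by blast
  have all2: "(p, q) \<in> ?E\<^sup>*" if i: "v \<in> V2" "v' \<in> V2" "p \<in> V2" "q \<in> V2"
    using nfree_onD[OF 2 i] inc p q L2 sub i by blast
  show "(p, q) \<in> ?E\<^sup>*"
  proof (cases "q \<in> V1")
    case True
    hence v: "v \<in> V1" "v' \<in> V1" using L1 q by blast+
    show ?thesis
    proof (cases "p \<in> V1")
      case True thus ?thesis using all1 v \<open>q \<in> V1\<close> by blast
    next
      case False
      hence "p \<in> V2" using vs by blast
      moreover have "C \<noteq> {}" using stay[OF _ p(1) v(1) vs(3)] False by blast
      ultimately show ?thesis using cross v(2) p(2) by blast
    qed
  next
    case False
    hence q2: "q \<in> V2" using vs by blast
    show ?thesis
    proof (cases "C = {}")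
      case True
      hence "v \<in> V2" "v' \<in> V2" using stay q vs False by blast+
      thus ?thesis using all2 q2 L2[OF p(1)] by blast
    next
      case C: False
      show ?thesis
      proof (cases "p \<in> V1")
        case True thus ?thesis using cross C q2 by blast
      next
        case False
        hence p2: "p \<in> V2" using vs by blast
        hence v'2: "v' \<in> V2" using cross[OF C _ p2, of v'] p(2) vs by blast
        hence "v \<in> V2" using cross[OF C _ v'2, of v] inc vs by blast
        thus ?thesis using all2 v'2 p2 q2 by blast
      qed
    qed
  qed
qed

lemma cograph_nonempty: "directed_cograph G \<Longrightarrow> pverts G \<noteq> {}"
  by (induction rule: directed_cograph.induct)
    (auto simp: disjoint_union_def series_composition_def order_composition_def)

lemma cograph_nfree: "directed_cograph G \<Longrightarrow> nfree_on (pverts G) (parcs G)"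
proof (induction rule: directed_cograph.induct)
  case (single v)
  thus ?case by (simp add: nfree_on_def)
next
  case (union G1 G2)
  thus ?case using nfree_on_layered[OF union(3) cograph_arcs[OF union(1)] cograph_arcs[OF union(2)], of "{}"] union.IH
    by (simp add: disjoint_union_def)
next
  case (order G1 G2)
  thus ?case using nfree_on_layered[OF order(3) cograph_arcs[OF order(1)] cograph_arcs[OF order(2)], of "pverts G1 \<times> pverts G2"] order.IH
    by (simp add: order_composition_def)
next
  \<comment> \<open>Both parts are nonempty, so any two vertices reach each other and no two are
    incomparable.\<close>
  case (series G1 G2)
  let ?E = "parcs (series_composition G1 G2)"
  have "(x, y) \<in> ?E\<^sup>*" if "x \<in> pverts G1 \<union> pverts G2" "y \<in> pverts G1 \<union> pverts G2" for x y
  proof -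
    obtain a b where ab: "a \<in> pverts G1" "b \<in> pverts G2"
      using cograph_nonempty series by blast
    have 1: "(u, w) \<in> ?E" "(w, u) \<in> ?E" if "u \<in> pverts G1" "w \<in> pverts G2" for u w
      using that by (auto simp: series_composition_def)
    have xa: "(x, a) \<in> ?E\<^sup>*"
      using that(1) 1[OF _ ab(2), of x] 1[OF ab(1), of x] 1[OF ab]
      by (meson Un_iff r_into_rtrancl rtrancl.rtrancl_into_rtrancl)
    have ay: "(a, y) \<in> ?E\<^sup>*"
      using that(2) 1[OF _ ab(2), of y] 1[OF ab(1), of y] 1[OF ab]
      by (meson Un_iff r_into_rtrancl rtrancl.rtrancl_into_rtrancl)
    show ?thesis using xa ay by (rule rtrancl_trans)
  qed
  thus ?case by (simp add: nfree_on_def series_composition_def)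
qed

section \<open>The input\<close>

lemma concat_offset:
  assumes "u < n" "i < length (f u)"
  shows "(\<Sum>w<u. length (f w)) + i < (\<Sum>w<n. length (f w))"
    and "concat (map f [0..<n]) ! ((\<Sum>w<u. length (f w)) + i) = f u ! i"
proof -
  have len: "length (concat (map f [0..<m])) = (\<Sum>w<m. length (f w))" for m
    by (induction m) auto
  have "(\<Sum>w<u. length (f w)) + i < (\<Sum>w<n. length (f w)) \<and>
    concat (map f [0..<n]) ! ((\<Sum>w<u. length (f w)) + i) = f u ! i" using assms
  proof (induction n)
    case (Suc n)
    show ?case
    proof (cases "u = n")
      case True
      thus ?thesis using Suc.prems len[of n] by (simp add: nth_append)
    next
      case False
      thus ?thesis using Suc len[of n] by (simp add: nth_append)
    qed
  qed simp
  thus "(\<Sum>w<u. length (f w)) + i < (\<Sum>w<n. length (f w))"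
    "concat (map f [0..<n]) ! ((\<Sum>w<u. length (f w)) + i) = f u ! i" by auto
qed

locale ssg =
  fixes n :: nat and s :: "nat \<Rightarrow> nat" and c :: nat and G :: "nat pair_pre_digraph" and adj :: "nat \<Rightarrow> nat list"
  assumes inst: "ssg_instance n s c G" and cog: "directed_cograph G" and adj: "adjacency_lists n G adj"
begin

definition inp :: "nat list" where "inp = encode_instance n s c adj"
definition off :: "nat \<Rightarrow> nat" where "off u = (\<Sum>w<u. length (adj w))"

lemma verts: "pverts G = {..<n}" and s_pos: "j < n \<Longrightarrow> 0 < s j" and c_pos: "0 < c"
  using inst by (auto simp: ssg_instance_def)
lemma n_pos: "0 < n" using cograph_nonempty[OF cog] verts by auto
lemma arcs: "(x, y) \<in> parcs G \<Longrightarrow> x < n \<and> y < n" using cograph_arcs[OF cog] verts by auto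
lemma adj_set: "u < n \<Longrightarrow> set (adj u) = {v. (u, v) \<in> parcs G}"
  and adj_distinct: "u < n \<Longrightarrow> distinct (adj u)"
  using adj by (auto simp: adjacency_lists_def)

lemma inp_len: "length inp = 2 * n + 3 + off n"
proof -
  have "length (concat (map adj [0..<n])) = off n" for n
    unfolding off_def by (induction n) auto
  thus ?thesis by (simp add: inp_def encode_instance_def)
qed
lemma inp_n: "inp ! 0 = n" and inp_c: "inp ! Suc 0 = c" by (simp_all add: inp_def encode_instance_def)
lemma inp_s: "j < n \<Longrightarrow> inp ! Suc (Suc j) = s j"
  by (simp add: inp_def encode_instance_def nth_append)
lemma inp_off: "u \<le> n \<Longrightarrow> inp ! (n + Suc (Suc u)) = off u"
  by (simp add: inp_def encode_instance_def nth_append off_def del: upt_Suc)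
lemma off_Suc: "off (Suc u) = off u + length (adj u)" by (simp add: off_def)
lemma inp_adj: assumes "u < n" "i < length (adj u)"
  shows "off u + i < off n" "inp ! (2 * n + 3 + (off u + i)) = adj u ! i"
proof -
  show "off u + i < off n" using concat_offset(1)[of u n i adj] assms by (simp add: off_def)
  have "inp ! (2 * n + 3 + (off u + i)) = concat (map adj [0..<n]) ! (off u + i)"
    by (simp add: inp_def encode_instance_def nth_append del: upt_Suc)
  thus "inp ! (2 * n + 3 + (off u + i)) = adj u ! i"
    using concat_offset(2)[of u n i adj] assms by (simp add: off_def)
qed

definition reach :: "nat \<Rightarrow> nat set" where "reach x = {y. (x, y) \<in> (parcs G)\<^sup>*}"
definition W :: "nat \<Rightarrow> nat" where "W x = sum s (reach x)"
definition U :: "nat set" where "U = {x. x < n \<and> W x \<le> c}"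

lemma reach_refl: "x \<in> reach x" by (simp add: reach_def)
lemma reach_trans: "y \<in> reach x \<Longrightarrow> reach y \<subseteq> reach x" by (auto simp: reach_def)
lemma reach_lt: assumes "x < n" shows "reach x \<subseteq> {..<n}"
proof
  fix y assume "y \<in> reach x"
  hence "(x, y) \<in> (parcs G)\<^sup>*" by (simp add: reach_def)
  thus "y \<in> {..<n}" by (induction rule: rtrancl_induct) (use assms arcs in auto)
qed
lemma finite_reach: "x < n \<Longrightarrow> finite (reach x)" using reach_lt finite_subset by blast
lemma W_mono: "x < n \<Longrightarrow> y \<in> reach x \<Longrightarrow> W y \<le> W x"
  unfolding W_def using reach_trans finite_reach by (intro sum_mono2) auto

sublocale nfree_preorder U reach s
proof
  show "finite U" by (simp add: U_def)
  fix x assume x: "x \<in> U"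
  show "x \<in> reach x" by (rule reach_refl)
  show "reach x \<subseteq> U" using x reach_lt[of x] W_mono[of x] unfolding U_def by fastforce
  show "0 < s x" using x s_pos by (simp add: U_def)
  show "reach y \<subseteq> reach x" if "y \<in> reach x" for y using that by (rule reach_trans)
next
  fix v v' p q assume "v \<in> U" "v' \<in> U" "v \<notin> reach v'" "v' \<notin> reach v" "p \<in> reach v" "p \<notin> reach v'" "q \<in> reach v" "q \<in> reach v'"
  moreover have "v < n" "v' < n" "p < n" "q < n" using calculation reach_lt by (auto simp: U_def)
  ultimately show "q \<in> reach p"
    using nfree_onD[OF cograph_nfree[OF cog], of v v' p q] verts by (auto simp: reach_def)
qed

text \<open>A vertex below \<open>x\<close> that does not reach back misses at least
  \<open>x\<close> itself, which has positive size. So the program decides mutual reachability by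
  comparing two stored weights.\<close>

lemma W_less: assumes x: "x < n" and y: "y \<in> reach x" shows "W y < W x \<longleftrightarrow> x \<notin> reach y"
proof
  assume "W y < W x"
  thus "x \<notin> reach y" using W_mono[of y x] reach_lt[OF x] y by auto
next
  assume "x \<notin> reach y"
  hence "reach y \<subset> reach x" using reach_trans[OF y] reach_refl by blast
  hence "sum s (reach y) < sum s (reach x)"
    using subset_eq_if_sum_le[of "reach x" "reach y" s] finite_reach[OF x] s_pos reach_lt[OF x]
    by (metis leI lessThan_iff psubset_imp_subset psubset_eq subsetD)
  thus "W y < W x" by (simp add: W_def)
qed

lemma D_W: "x \<in> U \<Longrightarrow> D x = {w \<in> reach x. W w < W x}"
  using W_less unfolding D_def U_def by auto

lemma d_le_W: "x \<in> U \<Longrightarrow> d x < W x"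
proof -
  assume x: "x \<in> U"
  hence "D x \<subset> reach x" using D_irrefl D_sub_R refl_R by blast
  thus ?thesis unfolding d_def W_def using x R_sub_U by (intro sum_less_U)
qed

lemma d_less_c: "x \<in> U \<Longrightarrow> d x < c" using d_le_W[of x] by (simp add: U_def)

text \<open>For usable \<open>x\<close> this is the smallest vertex of its strongly connected
  component; it doubles as the number of the leaf for that component.\<close>

definition rep :: "nat \<Rightarrow> nat" where "rep x = Min {w \<in> reach x. W w = W x}"

lemma class_eq: assumes "x \<in> U" shows "{w \<in> reach x. W w = W x} = {w \<in> reach x. x \<in> reach w}"
  using W_less[of x] W_mono[of x] assms by (fastforce simp: U_def)

lemma rep_props: assumes "x \<in> U" shows "rep x \<in> reach x" "x \<in> reach (rep x)" "rep x \<in> U"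
proof -
  have "rep x \<in> {w \<in> reach x. W w = W x}" unfolding rep_def
    by (rule Min_in) (use assms finite_reach reach_refl in \<open>auto simp: U_def\<close>)
  thus "rep x \<in> reach x" "x \<in> reach (rep x)" "rep x \<in> U" using class_eq[OF assms] R_sub_U[OF assms] by auto
qed

lemma rep_eq: assumes "x \<in> U" "y \<in> U" shows "rep x = rep y \<longleftrightarrow> y \<in> reach x \<and> x \<in> reach y"
proof
  assume "rep x = rep y"
  thus "y \<in> reach x \<and> x \<in> reach y" using rep_props[OF assms(1)] rep_props[OF assms(2)] reach_trans by (metis subsetD)
next
  assume a: "y \<in> reach x \<and> x \<in> reach y"
  hence "reach x = reach y" using reach_trans by blast
  thus "rep x = rep y" by (simp add: rep_def W_def)
qed

lemma class_weight: assumes "x \<in> U" shows "sum s {y \<in> U. rep y = rep x} = W x - d x"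
proof -
  have "{y \<in> U. rep y = rep x} = {w \<in> reach x. x \<in> reach w}"
    using rep_eq[OF assms] rep_eq[OF _ assms] R_sub_U[OF assms] by blast
  also have "\<dots> = reach x - D x" by (auto simp: D_def)
  finally show ?thesis unfolding W_def d_def
    using D_sub_R[of x] finite_reach[of x] assms by (simp add: sum_diff_nat finite_D)
qed

text \<open>A feasible set contains \<open>reach x\<close> for each of its elements
  \<open>x\<close>, so all of them are usable. Conversely, no arc leads out of \<open>U\<close>, and
  closedness inside \<open>U\<close> is closedness in \<open>G\<close>.\<close>

lemma feasible_iff: "ssg_feasible s c G A \<longleftrightarrow> closed_in U A \<and> sum s A \<le> c"
proof
  assume f: "ssg_feasible s c G A"
  hence A: "A \<subseteq> {..<n}" "sum s A \<le> c" "\<And>x y. (x, y) \<in> parcs G \<Longrightarrow> x \<in> A \<Longrightarrow> y \<in> A"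
    using verts arcs unfolding ssg_feasible_def capacity_constraint_def digraph_constraint_def predecessors_def by fastforce+
  have cl: "reach x \<subseteq> A" if "x \<in> A" for x
  proof
    fix y assume "y \<in> reach x"
    hence "(x, y) \<in> (parcs G)\<^sup>*" by (simp add: reach_def)
    thus "y \<in> A" by (induction rule: rtrancl_induct) (use that A(3) in auto)
  qed
  have "A \<subseteq> U"
  proof
    fix x assume x: "x \<in> A"
    have "W x \<le> sum s A" unfolding W_def using cl[OF x] finite_subset[OF A(1)] by (intro sum_mono2) auto
    thus "x \<in> U" using A x by (auto simp: U_def)
  qed
  thus "closed_in U A \<and> sum s A \<le> c" using cl A by (auto simp: closed_in_def)
next
  assume a: "closed_in U A \<and> sum s A \<le> c"
  hence AU: "A \<subseteq> U" by (auto simp: closed_in_def)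
  have "y \<in> A" if "(x, y) \<in> parcs G" "x \<in> A" for x y
  proof -
    have "y \<in> reach x" using that by (auto simp: reach_def)
    thus ?thesis using a that R_sub_U AU unfolding closed_in_def by blast
  qed
  thus "ssg_feasible s c G A" using a AU verts
    unfolding ssg_feasible_def capacity_constraint_def digraph_constraint_def predecessors_def by (auto simp: U_def)
qed

end

section \<open>A loop language\<close>

datatype ex = N nat | V nat | B arith ex ex | Arr nat ex ex | In ex
datatype bx = Lt ex ex | Eq ex ex
text \<open>\<open>Loop r lo h p\<close> lets \<open>r\<close> run from the value of
  \<open>lo\<close> up to, but excluding, the value that variable \<open>h\<close> has on entry.
  There is no other form of repetition.\<close>

datatype cm = Nop | Set nat ex | Put nat ex ex ex | Out ex ex | Sq cm cm | Cond bx cm cm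
  | Loop nat ex nat cm

record st =
  var :: "nat \<Rightarrow> nat"
  arr :: "nat \<Rightarrow> nat \<Rightarrow> nat \<Rightarrow> nat"
  out :: "nat \<Rightarrow> nat"

definition set_var :: "nat \<Rightarrow> nat \<Rightarrow> st \<Rightarrow> st" where
  "set_var r x \<sigma> = \<sigma>\<lparr>var := (var \<sigma>)(r := x)\<rparr>"
definition set_arr :: "nat \<Rightarrow> nat \<Rightarrow> nat \<Rightarrow> nat \<Rightarrow> st \<Rightarrow> st" where
  "set_arr a i j x \<sigma> = \<sigma>\<lparr>arr := (arr \<sigma>)(a := (arr \<sigma> a)(i := (arr \<sigma> a i)(j := x)))\<rparr>"
definition set_out :: "nat \<Rightarrow> nat \<Rightarrow> st \<Rightarrow> st" where
  "set_out i x \<sigma> = \<sigma>\<lparr>out := (out \<sigma>)(i := x)\<rparr>"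

lemma set_sel [simp]:
  "var (set_var r x \<sigma>) = (var \<sigma>)(r := x)" "arr (set_var r x \<sigma>) = arr \<sigma>" "out (set_var r x \<sigma>) = out \<sigma>"
  "var (set_arr a i j x \<sigma>) = var \<sigma>" "out (set_arr a i j x \<sigma>) = out \<sigma>"
  "arr (set_arr a i j x \<sigma>) = (arr \<sigma>)(a := (arr \<sigma> a)(i := (arr \<sigma> a i)(j := x)))"
  "var (set_out i x \<sigma>) = var \<sigma>" "arr (set_out i x \<sigma>) = arr \<sigma>"
  "out (set_out i x \<sigma>) = (out \<sigma>)(i := x)"
  by (simp_all add: set_var_def set_arr_def set_out_def)

text \<open>Machine steps of the compiled expression. The 6 for an array access consists of the five
  instructions of \<open>address\<close> and one \<open>Load\<close>.\<close>

primrec cost :: "ex \<Rightarrow> nat" where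
  "cost (N k) = 1"
| "cost (V r) = 1"
| "cost (B f a b) = cost a + cost b + 1"
| "cost (Arr a i j) = cost i + cost j + 6"
| "cost (In e) = cost e + 1"

text \<open>An expression of weight \<open>w\<close> has a value of at most \<open>Y\<close> to the power \<open>w\<close> if \<open>Y \<ge> 2\<close> bounds the
  variables, the array entries and the input.\<close>

primrec weight :: "ex \<Rightarrow> nat" where
  "weight (N k) = k + 1"
| "weight (V r) = 1"
| "weight (B f a b) = weight a + weight b"
| "weight (Arr a i j) = weight i + weight j"
| "weight (In e) = weight e"

primrec weight_cm :: "cm \<Rightarrow> nat" where
  "weight_cm Nop = 1"
| "weight_cm (Set r e) = weight e"
| "weight_cm (Put a i j e) = weight i + weight j + weight e"
| "weight_cm (Out i e) = weight i + weight e"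
| "weight_cm (Sq p q) = weight_cm p + weight_cm q"
| "weight_cm (Cond b p q) = (case b of Lt x y \<Rightarrow> weight x + weight y | Eq x y \<Rightarrow> weight x + weight y)
     + weight_cm p + weight_cm q"
| "weight_cm (Loop r lo h p) = weight lo + weight_cm p"

primrec wfx :: "nat \<Rightarrow> ex \<Rightarrow> bool" where
  "wfx K (N k) \<longleftrightarrow> True"
| "wfx K (V r) \<longleftrightarrow> r < K"
| "wfx K (B f a b) \<longleftrightarrow> wfx K a \<and> wfx K b"
| "wfx K (Arr a i j) \<longleftrightarrow> a < 16 \<and> wfx K i \<and> wfx K j"
| "wfx K (In e) \<longleftrightarrow> wfx K e"

primrec wfb :: "nat \<Rightarrow> bx \<Rightarrow> bool" where
  "wfb K (Lt x y) \<longleftrightarrow> wfx K x \<and> wfx K y"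
| "wfb K (Eq x y) \<longleftrightarrow> wfx K x \<and> wfx K y"

primrec wv :: "cm \<Rightarrow> nat set" where
  "wv Nop = {}"
| "wv (Set r e) = {r}"
| "wv (Put a i j e) = {}"
| "wv (Out i e) = {}"
| "wv (Sq p q) = wv p \<union> wv q"
| "wv (Cond b p q) = wv p \<union> wv q"
| "wv (Loop r lo h p) = insert r (wv p)"

primrec wa :: "cm \<Rightarrow> nat set" where
  "wa Nop = {}"
| "wa (Set r e) = {}"
| "wa (Put a i j e) = {a}"
| "wa (Out i e) = {}"
| "wa (Sq p q) = wa p \<union> wa q"
| "wa (Cond b p q) = wa p \<union> wa q"
| "wa (Loop r lo h p) = wa p"

text \<open>The body of a loop may write neither the counter nor the bound. This makes the
  \<open>While\<close> of the machine, which tests the bound in each round, agree with a number of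
  rounds fixed on entry.\<close>

primrec wf_cm :: "nat \<Rightarrow> cm \<Rightarrow> bool" where
  "wf_cm K Nop \<longleftrightarrow> True"
| "wf_cm K (Set r e) \<longleftrightarrow> r < K \<and> wfx K e"
| "wf_cm K (Put a i j e) \<longleftrightarrow> a < 16 \<and> wfx K i \<and> wfx K j \<and> wfx K e"
| "wf_cm K (Out i e) \<longleftrightarrow> wfx K i \<and> wfx K e"
| "wf_cm K (Sq p q) \<longleftrightarrow> wf_cm K p \<and> wf_cm K q"
| "wf_cm K (Cond b p q) \<longleftrightarrow> wfb K b \<and> wf_cm K p \<and> wf_cm K q"
| "wf_cm K (Loop r lo h p) \<longleftrightarrow> r < K \<and> h < K \<and> r \<noteq> h \<and> r \<notin> wv p \<and> h \<notin> wv p \<and> wfx K lo \<and> wf_cm K p"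

text \<open>\<open>\<beta> h\<close> bounds the value of a variable \<open>h\<close> that serves as
  loop bound. Entering and leaving a loop costs an assignment and the failing test, each round a
  test and an increment. Both branches of a conditional are charged.\<close>

primrec tm :: "(nat \<Rightarrow> nat) \<Rightarrow> cm \<Rightarrow> nat" where
  "tm \<beta> Nop = 1"
| "tm \<beta> (Set r e) = cost e + 1"
| "tm \<beta> (Put a i j e) = cost i + cost j + cost e + 6"
| "tm \<beta> (Out i e) = cost i + cost e + 1"
| "tm \<beta> (Sq p q) = tm \<beta> p + tm \<beta> q"
| "tm \<beta> (Cond b p q) = (case b of Lt x y \<Rightarrow> cost x + cost y | Eq x y \<Rightarrow> cost x + cost y) + 1
    + tm \<beta> p + tm \<beta> q"
| "tm \<beta> (Loop r lo h p) = cost lo + 2 + \<beta> h * (tm \<beta> p + 2)"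

primrec ev :: "nat list \<Rightarrow> ex \<Rightarrow> st \<Rightarrow> nat" where
  "ev inp (N k) \<sigma> = k"
| "ev inp (V r) \<sigma> = var \<sigma> r"
| "ev inp (B f a b) \<sigma> = arith_val f (ev inp a \<sigma>) (ev inp b \<sigma>)"
| "ev inp (Arr a i j) \<sigma> = arr \<sigma> a (ev inp i \<sigma>) (ev inp j \<sigma>)"
| "ev inp (In e) \<sigma> = inp ! ev inp e \<sigma>"

primrec evb :: "nat list \<Rightarrow> bx \<Rightarrow> st \<Rightarrow> bool" where
  "evb inp (Lt x y) \<sigma> \<longleftrightarrow> ev inp x \<sigma> < ev inp y \<sigma>"
| "evb inp (Eq x y) \<sigma> \<longleftrightarrow> ev inp x \<sigma> = ev inp y \<sigma>"

definition incr :: "nat \<Rightarrow> st \<Rightarrow> st" where "incr r \<sigma> = set_var r (Suc (var \<sigma> r)) \<sigma>"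

primrec run :: "nat list \<Rightarrow> cm \<Rightarrow> st \<Rightarrow> st" where
  "run inp Nop \<sigma> = \<sigma>"
| "run inp (Set r e) \<sigma> = set_var r (ev inp e \<sigma>) \<sigma>"
| "run inp (Put a i j e) \<sigma> = set_arr a (ev inp i \<sigma>) (ev inp j \<sigma>) (ev inp e \<sigma>) \<sigma>"
| "run inp (Out i e) \<sigma> = set_out (ev inp i \<sigma>) (ev inp e \<sigma>) \<sigma>"
| "run inp (Sq p q) \<sigma> = run inp q (run inp p \<sigma>)"
| "run inp (Cond b p q) \<sigma> = (if evb inp b \<sigma> then run inp p \<sigma> else run inp q \<sigma>)"
| "run inp (Loop r lo h p) \<sigma> =
    ((\<lambda>\<tau>. incr r (run inp p \<tau>)) ^^ (var \<sigma> h - ev inp lo \<sigma>)) (set_var r (ev inp lo \<sigma>) \<sigma>)"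

lemma run_frame:
  "r \<notin> wv p \<Longrightarrow> var (run inp p \<sigma>) r = var \<sigma> r"
  "a \<notin> wa p \<Longrightarrow> arr (run inp p \<sigma>) a = arr \<sigma> a"
proof (induction p arbitrary: \<sigma>)
  case (Loop r' lo h p)
  { case 1
    have "var (((\<lambda>\<tau>. incr r' (run inp p \<tau>)) ^^ k) \<tau>) r = var \<tau> r" for k \<tau>
      using 1 by (induction k) (auto simp: incr_def Loop.IH)
    thus ?case using 1 by simp
  next
    case 2
    have "arr (((\<lambda>\<tau>. incr r' (run inp p \<tau>)) ^^ k) \<tau>) a = arr \<tau> a" for k \<tau>
      using 2 by (induction k) (auto simp: incr_def Loop.IH)
    thus ?case using 2 by simp }
qed auto

locale machine =
  fixes inp :: "nat list" and n NI NJ X :: nat and \<beta> :: "nat \<Rightarrow> nat"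
begin

primrec okx :: "ex \<Rightarrow> st \<Rightarrow> bool" where
  "okx (N k) \<sigma> \<longleftrightarrow> True"
| "okx (V r) \<sigma> \<longleftrightarrow> True"
| "okx (B f a b) \<sigma> \<longleftrightarrow> okx a \<sigma> \<and> okx b \<sigma>"
| "okx (Arr a i j) \<sigma> \<longleftrightarrow> okx i \<sigma> \<and> okx j \<sigma> \<and> ev inp i \<sigma> < NI \<and> ev inp j \<sigma> < NJ"
| "okx (In e) \<sigma> \<longleftrightarrow> okx e \<sigma> \<and> ev inp e \<sigma> < length inp"

primrec okb :: "bx \<Rightarrow> st \<Rightarrow> bool" where
  "okb (Lt x y) \<sigma> \<longleftrightarrow> okx x \<sigma> \<and> okx y \<sigma>"
| "okb (Eq x y) \<sigma> \<longleftrightarrow> okx x \<sigma> \<and> okx y \<sigma>"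

text \<open>Collects what the machine or the time bound could object to: indices out of range,
  stored values above \<open>X\<close>, loop bounds above \<open>\<beta>\<close>. Intermediate
  values of expressions may exceed \<open>X\<close>; they are controlled by
  \<open>weight\<close>.\<close>

primrec safe :: "cm \<Rightarrow> st \<Rightarrow> bool" where
  "safe Nop \<sigma> \<longleftrightarrow> True"
| "safe (Set r e) \<sigma> \<longleftrightarrow> okx e \<sigma> \<and> ev inp e \<sigma> \<le> X"
| "safe (Put a i j e) \<sigma> \<longleftrightarrow> okx i \<sigma> \<and> okx j \<sigma> \<and> okx e \<sigma> \<and> ev inp i \<sigma> < NI \<and> ev inp j \<sigma> < NJ \<and> ev inp e \<sigma> \<le> X"
| "safe (Out i e) \<sigma> \<longleftrightarrow> okx i \<sigma> \<and> okx e \<sigma> \<and> ev inp i \<sigma> < n \<and> ev inp e \<sigma> \<le> X"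
| "safe (Sq p q) \<sigma> \<longleftrightarrow> safe p \<sigma> \<and> safe q (run inp p \<sigma>)"
| "safe (Cond b p q) \<sigma> \<longleftrightarrow> okb b \<sigma> \<and> (if evb inp b \<sigma> then safe p \<sigma> else safe q \<sigma>)"
| "safe (Loop r lo h p) \<sigma> \<longleftrightarrow> okx lo \<sigma> \<and> ev inp lo \<sigma> \<le> X \<and> var \<sigma> h \<le> \<beta> h \<and>
    (\<forall>k < var \<sigma> h - ev inp lo \<sigma>.
       safe p (((\<lambda>\<tau>. incr r (run inp p \<tau>)) ^^ k) (set_var r (ev inp lo \<sigma>) \<sigma>)))"

definition wp :: "cm \<Rightarrow> (st \<Rightarrow> bool) \<Rightarrow> st \<Rightarrow> bool" where
  "wp p Q \<sigma> \<longleftrightarrow> safe p \<sigma> \<and> Q (run inp p \<sigma>)"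

lemma wp_simps [simp]:
  "wp Nop Q \<sigma> \<longleftrightarrow> Q \<sigma>"
  "wp (Set r e) Q \<sigma> \<longleftrightarrow> okx e \<sigma> \<and> ev inp e \<sigma> \<le> X \<and> Q (set_var r (ev inp e \<sigma>) \<sigma>)"
  "wp (Put a i j e) Q \<sigma> \<longleftrightarrow> okx i \<sigma> \<and> okx j \<sigma> \<and> okx e \<sigma> \<and> ev inp i \<sigma> < NI \<and> ev inp j \<sigma> < NJ \<and> ev inp e \<sigma> \<le> X
     \<and> Q (set_arr a (ev inp i \<sigma>) (ev inp j \<sigma>) (ev inp e \<sigma>) \<sigma>)"
  "wp (Out i e) Q \<sigma> \<longleftrightarrow> okx i \<sigma> \<and> okx e \<sigma> \<and> ev inp i \<sigma> < n \<and> ev inp e \<sigma> \<le> X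
     \<and> Q (set_out (ev inp i \<sigma>) (ev inp e \<sigma>) \<sigma>)"
  "wp (Sq p q) Q \<sigma> \<longleftrightarrow> wp p (wp q Q) \<sigma>"
  "wp (Cond b p q) Q \<sigma> \<longleftrightarrow> okb b \<sigma> \<and> (if evb inp b \<sigma> then wp p Q \<sigma> else wp q Q \<sigma>)"
  by (auto simp: wp_def)

lemma wp_mono: "wp p P \<sigma> \<Longrightarrow> (\<And>\<tau>. P \<tau> \<Longrightarrow> Q \<tau>) \<Longrightarrow> wp p Q \<sigma>"
  by (auto simp: wp_def)

definition same :: "nat set \<Rightarrow> nat set \<Rightarrow> st \<Rightarrow> st \<Rightarrow> bool" where
  "same vs as \<sigma> \<tau> \<longleftrightarrow> (\<forall>r. r \<notin> vs \<longrightarrow> var \<tau> r = var \<sigma> r) \<and> (\<forall>a. a \<notin> as \<longrightarrow> arr \<tau> a = arr \<sigma> a)"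

lemma same_var: "same vs as \<sigma> \<tau> \<Longrightarrow> r \<notin> vs \<Longrightarrow> var \<tau> r = var \<sigma> r"
  and same_arr: "same vs as \<sigma> \<tau> \<Longrightarrow> a \<notin> as \<Longrightarrow> arr \<tau> a = arr \<sigma> a"
  by (auto simp: same_def)

text \<open>What a program does not assign keeps its value. Reading this off the program text keeps
  it out of the invariants.\<close>

lemma wp_frame:
  assumes "wp p P \<sigma>" "\<And>\<tau>. same (wv p) (wa p) \<sigma> \<tau> \<Longrightarrow> P \<tau> \<Longrightarrow> Q \<tau>"
  shows "wp p Q \<sigma>"
  using assms unfolding wp_def same_def by (metis run_frame)

text \<open>\<open>I i\<close> holds once the counter has been set to \<open>i\<close>, before the
  round starts. The maximum in the last premise covers a loop that is never entered.\<close>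

lemma wp_Loop:
  assumes wf: "r \<noteq> h" "r \<notin> wv p" "h \<notin> wv p"
    and lo: "okx lo \<sigma>" "ev inp lo \<sigma> \<le> X" "var \<sigma> h \<le> \<beta> h"
    and init: "I (ev inp lo \<sigma>) (set_var r (ev inp lo \<sigma>) \<sigma>)"
    and step: "\<And>i \<tau>. \<lbrakk> ev inp lo \<sigma> \<le> i; i < var \<sigma> h; var \<tau> r = i; same (insert r (wv p)) (wa p) \<sigma> \<tau>; I i \<tau> \<rbrakk>
      \<Longrightarrow> wp p (\<lambda>\<tau>'. I (Suc i) (set_var r (Suc i) \<tau>')) \<tau>"
    and fin: "\<And>\<tau>. \<lbrakk> same (insert r (wv p)) (wa p) \<sigma> \<tau>; I (max (ev inp lo \<sigma>) (var \<sigma> h)) \<tau> \<rbrakk> \<Longrightarrow> Q \<tau>"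
  shows "wp (Loop r lo h p) Q \<sigma>"
proof -
  let ?f = "\<lambda>\<tau>. incr r (run inp p \<tau>)" and ?l = "ev inp lo \<sigma>"
  let ?s = "set_var r ?l \<sigma>"
  have fr: "same (insert r (wv p)) (wa p) \<sigma> ((?f ^^ k) ?s)" for k
  proof (induction k)
    case 0 show ?case by (simp add: same_def)
  next
    case (Suc k) thus ?case by (auto simp: same_def incr_def run_frame)
  qed
  have main: "var ((?f ^^ k) ?s) r = ?l + k \<and> I (?l + k) ((?f ^^ k) ?s) \<and> (\<forall>k' < k. safe p ((?f ^^ k') ?s))"
    if "k \<le> var \<sigma> h - ?l" for k
    using that
  proof (induction k)
    case 0 thus ?case using init by simp
  next
    case (Suc k)
    let ?t = "(?f ^^ k) ?s"
    from Suc have IH: "var ?t r = ?l + k" "I (?l + k) ?t" "\<forall>k' < k. safe p ((?f ^^ k') ?s)" by auto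
    have "wp p (\<lambda>\<tau>'. I (Suc (?l + k)) (set_var r (Suc (?l + k)) \<tau>')) ?t"
      by (rule step) (use IH Suc.prems fr in auto)
    hence "safe p ?t" "I (Suc (?l + k)) (set_var r (Suc (?l + k)) (run inp p ?t))" by (auto simp: wp_def)
    moreover have "var (run inp p ?t) r = ?l + k" using IH wf by (simp add: run_frame)
    ultimately show ?case using IH by (auto simp: incr_def less_Suc_eq)
  qed
  have m: "max ?l (var \<sigma> h) = ?l + (var \<sigma> h - ?l)" by simp
  have "Q ((?f ^^ (var \<sigma> h - ?l)) ?s)"
  proof (rule fin[OF fr])
    show "I (max ?l (var \<sigma> h)) ((?f ^^ (var \<sigma> h - ?l)) ?s)"
      unfolding m using main[OF order_refl] by blast
  qed
  thus ?thesis using main[of "var \<sigma> h - ?l"] lo by (simp add: wp_def)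
qed

end

section \<open>Compilation\<close>

abbreviation mov :: "nat \<Rightarrow> operand \<Rightarrow> com" where "mov r a \<equiv> Assign r Add a (Imm 0)"

text \<open>Register 0 holds the number of columns of all arrays, register 1 the length of the output.
  Entry \<open>(i, j)\<close> of the 16 interleaved arrays is found behind the output.\<close>

definition address :: "nat \<Rightarrow> nat \<Rightarrow> com" where
  "address a k = Seq (Assign k Mul (Reg k) (Reg 0)) (Seq (Assign k Add (Reg k) (Reg (Suc k)))
     (Seq (Assign k Mul (Reg k) (Imm 16)) (Seq (Assign k Add (Reg k) (Imm a)) (Assign k Add (Reg k) (Reg 1)))))"

text \<open>Stack discipline: the value goes to register \<open>k\<close> and only registers from
  \<open>k\<close> on are changed, so the second operand can be computed from \<open>Suc k\<close>
  on without losing the first.\<close>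

primrec cex :: "ex \<Rightarrow> nat \<Rightarrow> com" where
  "cex (N x) k = mov k (Imm x)"
| "cex (V r) k = mov k (Reg (r + 2))"
| "cex (B f a b) k = Seq (cex a k) (Seq (cex b (Suc k)) (Assign k f (Reg k) (Reg (Suc k))))"
| "cex (Arr a i j) k = Seq (cex i k) (Seq (cex j (Suc k)) (Seq (address a k) (Load k (Reg k))))"
| "cex (In e) k = Seq (cex e k) (ReadInput k (Reg k))"

primrec ccm :: "nat \<Rightarrow> cm \<Rightarrow> com" where
  "ccm T Nop = Skip"
| "ccm T (Set r e) = Seq (cex e T) (mov (r + 2) (Reg T))"
| "ccm T (Put a i j e) = Seq (cex i T) (Seq (cex j (Suc T)) (Seq (address a T)
     (Seq (cex e (Suc T)) (Store (Reg T) (Reg (Suc T))))))"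
| "ccm T (Out i e) = Seq (cex i T) (Seq (cex e (Suc T)) (Store (Reg T) (Reg (Suc T))))"
| "ccm T (Sq p q) = Seq (ccm T p) (ccm T q)"
| "ccm T (Cond b p q) = (case b of
      Lt x y \<Rightarrow> Seq (cex x T) (Seq (cex y (Suc T)) (If (Less (Reg T) (Reg (Suc T))) (ccm T p) (ccm T q)))
    | Eq x y \<Rightarrow> Seq (cex x T) (Seq (cex y (Suc T)) (If (Equal (Reg T) (Reg (Suc T))) (ccm T p) (ccm T q))))"
| "ccm T (Loop r lo h p) = Seq (cex lo T) (Seq (mov (r + 2) (Reg T))
     (While (Less (Reg (r + 2)) (Reg (h + 2))) (Seq (ccm T p) (Assign (r + 2) Add (Reg (r + 2)) (Imm 1)))))"

locale compiled = machine inp n NI NJ X \<beta>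
  for inp n NI NJ X \<beta> +
  fixes S W K Y :: nat
  assumes space: "n + 16 * (NI * NJ) \<le> S" and word: "S \<le> W" and X_W: "X \<le> W"
    and Y: "2 \<le> Y" "X \<le> Y" and inp_X: "\<And>i. i < length inp \<Longrightarrow> inp ! i \<le> X"
begin

definition addr :: "nat \<Rightarrow> nat \<Rightarrow> nat \<Rightarrow> nat" where
  "addr a i j = n + (16 * (i * NJ + j) + a)"

definition rel :: "ram_state \<Rightarrow> st \<Rightarrow> bool" where
  "rel \<rho> \<sigma> \<longleftrightarrow> (\<forall>r<K. regs \<rho> (r + 2) = var \<sigma> r) \<and> regs \<rho> 0 = NJ \<and> regs \<rho> 1 = n \<and>
     (\<forall>a<16. \<forall>i<NI. \<forall>j<NJ. mem \<rho> (addr a i j) = arr \<sigma> a i j) \<and> (\<forall>i<n. mem \<rho> i = out \<sigma> i)"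

definition bounded :: "st \<Rightarrow> bool" where
  "bounded \<sigma> \<longleftrightarrow> (\<forall>r. var \<sigma> r \<le> X) \<and> (\<forall>a i j. arr \<sigma> a i j \<le> X)"

lemma addr_less: assumes "a < 16" "i < NI" "j < NJ" shows "addr a i j < S"
proof -
  have "i * NJ + j < Suc i * NJ" using assms by simp
  also have "Suc i * NJ \<le> NI * NJ" using assms by (intro mult_le_mono1) simp
  finally show ?thesis using space assms by (simp add: addr_def)
qed

lemma addr_eq: assumes "a < 16" "j < NJ" "a' < 16" "j' < NJ"
  shows "addr a i j = addr a' i' j' \<longleftrightarrow> a = a' \<and> i = i' \<and> j = j'"
proof
  assume "addr a i j = addr a' i' j'"
  hence e: "16 * (i * NJ + j) + a = 16 * (i' * NJ + j') + a'" by (simp add: addr_def)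
  have m: "(16 * x + y) mod 16 = y" if "y < 16" for x y :: nat using that by simp
  have a: "a = a'" using m[OF assms(1)] m[OF assms(3)] e by metis
  hence f: "i * NJ + j = i' * NJ + j'" using e by simp
  have m': "(x * NJ + y) mod NJ = y" "(x * NJ + y) div NJ = x" if "y < NJ" for x y using that by simp_all
  have "j = j'" using m'(1)[OF assms(2)] m'(1)[OF assms(4)] f by metis
  moreover have "i = i'" using m'(2)[OF assms(2)] m'(2)[OF assms(4)] f by metis
  ultimately show "a = a' \<and> i = i' \<and> j = j'" using a by simp
qed auto

lemma Y_pow_mono: "a \<le> b \<Longrightarrow> Y ^ a \<le> Y ^ b"
  using Y by (intro power_increasing) auto

lemma weight_pos: "1 \<le> weight e"
  by (induction e) auto

lemma Y_le_pow: "Y \<le> Y ^ weight e"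
  using Y_pow_mono[OF weight_pos[of e]] by simp

text \<open>Weights are exponents. Powers of \<open>Y\<close> with positive exponent are at least 2,
  so their sum is at most their product and every operation just adds exponents. A constant
  \<open>k\<close> gets an exponent of its own because \<open>k < 2 ^ k\<close>.\<close>

lemma ev_bound: "okx e \<sigma> \<Longrightarrow> bounded \<sigma> \<Longrightarrow> ev inp e \<sigma> \<le> Y ^ weight e"
proof (induction e)
  case (N k)
  have "k < 2 ^ k" by (rule less_exp)
  also have "(2::nat) ^ k \<le> Y ^ k" using Y by (intro power_mono) auto
  also have "Y ^ k \<le> Y ^ (k + 1)" by (rule Y_pow_mono) simp
  finally show ?case by simp
next
  case (V r) thus ?case using Y by (simp add: bounded_def) (meson le_trans)
next
  case (B f a b)
  let ?p = "Y ^ weight a" and ?q = "Y ^ weight b"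
  have pq: "2 \<le> ?p" "2 \<le> ?q" using Y_le_pow[of a] Y_le_pow[of b] Y by auto
  have sum: "?p + ?q \<le> ?p * ?q"
  proof -
    obtain x y where "?p = x + 2" "?q = y + 2" using pq by (metis add.commute le_Suc_ex)
    thus ?thesis by (simp add: algebra_simps)
  qed
  have le: "ev inp a \<sigma> \<le> ?p" "ev inp b \<sigma> \<le> ?q" using B by auto
  have "arith_val f (ev inp a \<sigma>) (ev inp b \<sigma>) \<le> ?p * ?q"
  proof (cases f)
    case Mul thus ?thesis using mult_le_mono[OF le] by simp
  next
    case Sub thus ?thesis using le sum by simp
  next
    case Add thus ?thesis using le sum by simp
  qed
  thus ?case by (simp add: power_add)
next
  case (Arr a i j)
  have "arr \<sigma> a (ev inp i \<sigma>) (ev inp j \<sigma>) \<le> X" using Arr by (simp add: bounded_def)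
  also have "X \<le> Y ^ weight (Arr a i j)" using Y_le_pow[of "Arr a i j"] Y(2) by (rule le_trans[rotated])
  finally show ?case by simp
next
  case (In e)
  have "inp ! ev inp e \<sigma> \<le> X" using In inp_X by simp
  also have "X \<le> Y ^ weight (In e)" using Y_le_pow[of "In e"] Y(2) by (rule le_trans[rotated])
  finally show ?case by simp
qed

section \<open>Correctness and running time of the compiled code\<close>

definition cexec :: "com \<Rightarrow> ram_state \<Rightarrow> nat \<Rightarrow> (ram_state \<Rightarrow> bool) \<Rightarrow> bool" where
  "cexec p \<rho> t Q \<longleftrightarrow> (\<exists>t' \<rho>'. exec inp S W p \<rho> t' \<rho>' \<and> t' \<le> t \<and> Q \<rho>')"

lemma cexec_Seq: "cexec p \<rho> t (\<lambda>\<rho>'. cexec q \<rho>' u Q) \<Longrightarrow> cexec (Seq p q) \<rho> (t + u) Q"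
  unfolding cexec_def by (meson exec.Seq add_mono)
lemma cexec_mono: "cexec p \<rho> t P \<Longrightarrow> t \<le> u \<Longrightarrow> (\<And>\<rho>'. P \<rho>' \<Longrightarrow> Q \<rho>') \<Longrightarrow> cexec p \<rho> u Q"
  unfolding cexec_def by (meson le_trans)
lemma cexec_Assign: "1 \<le> t \<Longrightarrow> arith_val f (operand_val \<rho> a) (operand_val \<rho> b) \<le> W \<Longrightarrow>
    Q (set_reg r (arith_val f (operand_val \<rho> a) (operand_val \<rho> b)) \<rho>) \<Longrightarrow> cexec (Assign r f a b) \<rho> t Q"
  unfolding cexec_def by (meson exec.Assign)
lemma cexec_Load: "1 \<le> t \<Longrightarrow> operand_val \<rho> a < S \<Longrightarrow> Q (set_reg r (mem \<rho> (operand_val \<rho> a)) \<rho>) \<Longrightarrow> cexec (Load r a) \<rho> t Q"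
  unfolding cexec_def by (meson exec.Load)
lemma cexec_Read: "1 \<le> t \<Longrightarrow> operand_val \<rho> a < length inp \<Longrightarrow> Q (set_reg r (inp ! operand_val \<rho> a) \<rho>) \<Longrightarrow> cexec (ReadInput r a) \<rho> t Q"
  unfolding cexec_def by (meson exec.ReadInput inp_X X_W le_trans)
lemma cexec_Store: "1 \<le> t \<Longrightarrow> operand_val \<rho> a < S \<Longrightarrow> operand_val \<rho> b \<le> W \<Longrightarrow>
    Q (set_mem (operand_val \<rho> a) (operand_val \<rho> b) \<rho>) \<Longrightarrow> cexec (Store a b) \<rho> t Q"
  unfolding cexec_def by (meson exec.Store)

lemma regs_set [simp]: "regs (set_reg r v \<rho>) = (regs \<rho>)(r := v)" "mem (set_reg r v \<rho>) = mem \<rho>"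
  "regs (set_mem i v \<rho>) = regs \<rho>" "mem (set_mem i v \<rho>) = (mem \<rho>)(i := v)"
  by (simp_all add: set_reg_def set_mem_def)

definition keeps :: "nat \<Rightarrow> ram_state \<Rightarrow> ram_state \<Rightarrow> bool" where
  "keeps k \<rho> \<rho>' \<longleftrightarrow> mem \<rho>' = mem \<rho> \<and> (\<forall>r<k. regs \<rho>' r = regs \<rho> r)"

lemma keeps_rel: "keeps k \<rho> \<rho>' \<Longrightarrow> rel \<rho> \<sigma> \<Longrightarrow> K + 2 \<le> k \<Longrightarrow> rel \<rho>' \<sigma>"
  unfolding keeps_def rel_def by auto

lemma exec_address:
  assumes rel: "rel \<rho> \<sigma>" and k: "K + 2 \<le> k" and i: "regs \<rho> k = i" "regs \<rho> (Suc k) = j" and b: "i < NI" "j < NJ" "a < 16"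
  shows "cexec (address a k) \<rho> 5 (\<lambda>\<rho>'. regs \<rho>' k = addr a i j \<and> keeps k \<rho> \<rho>')"
proof -
  have A: "addr a i j \<le> W" using addr_less[OF b(3,1,2)] word by simp
  \<comment> \<open>No intermediate result exceeds the address itself, which is below
    \<open>S\<close> and therefore fits into a word.\<close>
  hence l: "i * NJ \<le> W" "i * NJ + j \<le> W" "(i * NJ + j) * 16 \<le> W" "(i * NJ + j) * 16 + a \<le> W"
    by (auto simp: addr_def)
  have r: "regs \<rho> 0 = NJ" "regs \<rho> (Suc 0) = n" using rel by (auto simp: rel_def)
  have "cexec (address a k) \<rho> (1+(1+(1+(1+1)))) (\<lambda>\<rho>'. regs \<rho>' k = addr a i j \<and> keeps k \<rho> \<rho>')"
    unfolding address_def using k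
    by (intro cexec_Seq cexec_Assign)
      (use A l r i k in \<open>auto simp: keeps_def addr_def algebra_simps\<close>)
  thus ?thesis by (simp add: numeral_eq_Suc)
qed

lemma exec_cex:
  "\<lbrakk> okx e \<sigma>; bounded \<sigma>; wfx K e; rel \<rho> \<sigma>; Y ^ weight e \<le> W; K + 2 \<le> k \<rbrakk> \<Longrightarrow>
    cexec (cex e k) \<rho> (cost e) (\<lambda>\<rho>'. regs \<rho>' k = ev inp e \<sigma> \<and> keeps k \<rho> \<rho>')"
proof (induction e arbitrary: \<rho> k)
  case (N x)
  have "x \<le> W" using ev_bound[of "N x" \<sigma>] N by simp
  thus ?case by (auto intro!: cexec_Assign simp: keeps_def)
next
  case (V r)
  have "var \<sigma> r \<le> W" using ev_bound[of "V r" \<sigma>] V by simp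
  thus ?case using V by (auto intro!: cexec_Assign simp: keeps_def rel_def)
next
  case (B f a b)
  have w: "Y ^ weight a \<le> W" "Y ^ weight b \<le> W"
    using B.prems(5) Y_pow_mono[of "weight a" "weight a + weight b"] Y_pow_mono[of "weight b" "weight a + weight b"]
    by auto
  have v: "arith_val f (ev inp a \<sigma>) (ev inp b \<sigma>) \<le> W" using ev_bound[of "B f a b" \<sigma>] B.prems by simp
  have "cexec (cex (B f a b) k) \<rho> (cost a + (cost b + 1)) (\<lambda>\<rho>'. regs \<rho>' k = ev inp (B f a b) \<sigma> \<and> keeps k \<rho> \<rho>')"
    unfolding cex.simps
  proof (rule cexec_Seq, rule cexec_mono[OF B.IH(1) order_refl])
    fix \<rho>1 assume 1: "regs \<rho>1 k = ev inp a \<sigma> \<and> keeps k \<rho> \<rho>1"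
    have r1: "rel \<rho>1 \<sigma>" using keeps_rel 1 B.prems by blast
    show "cexec (Seq (cex b (Suc k)) (Assign k f (Reg k) (Reg (Suc k)))) \<rho>1 (cost b + 1)
           (\<lambda>\<rho>'. regs \<rho>' k = ev inp (B f a b) \<sigma> \<and> keeps k \<rho> \<rho>')"
    proof (rule cexec_Seq, rule cexec_mono[OF B.IH(2) order_refl])
      fix \<rho>2 assume 2: "regs \<rho>2 (Suc k) = ev inp b \<sigma> \<and> keeps (Suc k) \<rho>1 \<rho>2"
      hence "regs \<rho>2 k = ev inp a \<sigma>" using 1 by (simp add: keeps_def)
      thus "cexec (Assign k f (Reg k) (Reg (Suc k))) \<rho>2 1
           (\<lambda>\<rho>'. regs \<rho>' k = ev inp (B f a b) \<sigma> \<and> keeps k \<rho> \<rho>')"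
        using 1 2 v by (intro cexec_Assign) (auto simp: keeps_def)
    qed (use B.prems w r1 in auto)
  qed (use B.prems w in auto)
  thus ?case by simp
next
  case (Arr a i j)
  have w: "Y ^ weight i \<le> W" "Y ^ weight j \<le> W"
    using Arr.prems(5) Y_pow_mono[of "weight i" "weight i + weight j"] Y_pow_mono[of "weight j" "weight i + weight j"]
    by auto
  let ?i = "ev inp i \<sigma>" and ?j = "ev inp j \<sigma>"
  have b: "?i < NI" "?j < NJ" "a < 16" using Arr.prems by auto
  have "cexec (cex (Arr a i j) k) \<rho> (cost i + (cost j + (5 + 1))) (\<lambda>\<rho>'. regs \<rho>' k = ev inp (Arr a i j) \<sigma> \<and> keeps k \<rho> \<rho>')"
    unfolding cex.simps
  proof (rule cexec_Seq, rule cexec_mono[OF Arr.IH(1) order_refl])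
    fix \<rho>1 assume 1: "regs \<rho>1 k = ?i \<and> keeps k \<rho> \<rho>1"
    have r1: "rel \<rho>1 \<sigma>" using keeps_rel 1 Arr.prems by blast
    show "cexec (Seq (cex j (Suc k)) (Seq (address a k) (Load k (Reg k)))) \<rho>1 (cost j + (5 + 1))
           (\<lambda>\<rho>'. regs \<rho>' k = ev inp (Arr a i j) \<sigma> \<and> keeps k \<rho> \<rho>')"
    proof (rule cexec_Seq, rule cexec_mono[OF Arr.IH(2) order_refl])
      fix \<rho>2 assume 2: "regs \<rho>2 (Suc k) = ?j \<and> keeps (Suc k) \<rho>1 \<rho>2"
      have r2: "rel \<rho>2 \<sigma>" using keeps_rel[of "Suc k" \<rho>1 \<rho>2 \<sigma>] 2 r1 Arr.prems by auto
      have k2: "regs \<rho>2 k = ?i" using 1 2 by (simp add: keeps_def)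
      show "cexec (Seq (address a k) (Load k (Reg k))) \<rho>2 (5 + 1)
           (\<lambda>\<rho>'. regs \<rho>' k = ev inp (Arr a i j) \<sigma> \<and> keeps k \<rho> \<rho>')"
      proof (rule cexec_Seq, rule cexec_mono[OF exec_address[OF r2 Arr.prems(6) k2 _ b] order_refl])
        show "regs \<rho>2 (Suc k) = ?j" using 2 by simp
        fix \<rho>3 assume 3: "regs \<rho>3 k = addr a ?i ?j \<and> keeps k \<rho>2 \<rho>3"
        have "mem \<rho>3 (addr a ?i ?j) = arr \<sigma> a ?i ?j" using 3 r2 b by (simp add: keeps_def rel_def)
        thus "cexec (Load k (Reg k)) \<rho>3 1 (\<lambda>\<rho>'. regs \<rho>' k = ev inp (Arr a i j) \<sigma> \<and> keeps k \<rho> \<rho>')"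
          using 1 2 3 addr_less[OF b(3,1,2)] by (intro cexec_Load) (auto simp: keeps_def)
      qed
    qed (use Arr.prems w r1 in auto)
  qed (use Arr.prems w in auto)
  thus ?case by (simp add: add.assoc)
next
  case (In e)
  show ?case unfolding cex.simps cost.simps
  proof (rule cexec_Seq, rule cexec_mono[OF In.IH order_refl])
    fix \<rho>1 assume 1: "regs \<rho>1 k = ev inp e \<sigma> \<and> keeps k \<rho> \<rho>1"
    thus "cexec (ReadInput k (Reg k)) \<rho>1 1 (\<lambda>\<rho>'. regs \<rho>' k = ev inp (In e) \<sigma> \<and> keeps k \<rho> \<rho>')"
      using In.prems by (intro cexec_Read) (auto simp: keeps_def)
  qed (use In.prems in auto)
qed

lemma exec_cex2:
  assumes "okx e \<sigma>" "okx f \<sigma>" "bounded \<sigma>" "wfx K e" "wfx K f" "rel \<rho> \<sigma>" "Y ^ (weight e + weight f) \<le> W"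
    and q: "\<And>\<rho>'. \<lbrakk> regs \<rho>' (K + 2) = ev inp e \<sigma>; regs \<rho>' (Suc (K + 2)) = ev inp f \<sigma>; keeps (K + 2) \<rho> \<rho>'; rel \<rho>' \<sigma> \<rbrakk>
      \<Longrightarrow> cexec q \<rho>' t Q"
  shows "cexec (Seq (cex e (K + 2)) (Seq (cex f (Suc (K + 2))) q)) \<rho> (cost e + (cost f + t)) Q"
proof (rule cexec_Seq, rule cexec_mono[OF exec_cex order_refl])
  have w: "Y ^ weight e \<le> W" "Y ^ weight f \<le> W"
    using assms(7) Y_pow_mono[of "weight e" "weight e + weight f"] Y_pow_mono[of "weight f" "weight e + weight f"]
    by auto
  show "Y ^ weight e \<le> W" by fact
  fix \<rho>1 assume 1: "regs \<rho>1 (K + 2) = ev inp e \<sigma> \<and> keeps (K + 2) \<rho> \<rho>1"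
  have r1: "rel \<rho>1 \<sigma>" using keeps_rel 1 assms by blast
  show "cexec (Seq (cex f (Suc (K + 2))) q) \<rho>1 (cost f + t) Q"
  proof (rule cexec_Seq, rule cexec_mono[OF exec_cex order_refl])
    fix \<rho>2 assume 2: "regs \<rho>2 (Suc (K + 2)) = ev inp f \<sigma> \<and> keeps (Suc (K + 2)) \<rho>1 \<rho>2"
    have r2: "rel \<rho>2 \<sigma>" using keeps_rel[of "Suc (K + 2)" \<rho>1 \<rho>2 \<sigma>] 2 r1 by auto
    show "cexec q \<rho>2 t Q"
      by (rule q) (use 1 2 r2 in \<open>auto simp: keeps_def\<close>)
  qed (use assms r1 w in auto)
qed (use assms in auto)

lemma rel_set_var: "rel \<rho> \<sigma> \<Longrightarrow> rel (set_reg (r + 2) x \<rho>) (set_var r x \<sigma>)"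
  unfolding rel_def by auto

lemma rel_set_out: "rel \<rho> \<sigma> \<Longrightarrow> i < n \<Longrightarrow> rel (set_mem i x \<rho>) (set_out i x \<sigma>)"
  unfolding rel_def addr_def by simp

lemma rel_set_arr:
  assumes "rel \<rho> \<sigma>" "a < 16" "i < NI" "j < NJ"
  shows "rel (set_mem (addr a i j) x \<rho>) (set_arr a i j x \<sigma>)"
proof -
  have "mem (set_mem (addr a i j) x \<rho>) (addr a' i' j') = arr (set_arr a i j x \<sigma>) a' i' j'"
    if "a' < 16" "i' < NI" "j' < NJ" for a' i' j'
    using addr_eq[OF that(1,3) assms(2,4), of i' i] assms(1) that by (simp add: rel_def)
  moreover have "mem (set_mem (addr a i j) x \<rho>) i' = out (set_arr a i j x \<sigma>) i'" if "i' < n" for i'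
    using that assms(1) by (simp add: rel_def addr_def)
  ultimately show ?thesis using assms(1) by (simp add: rel_def)
qed

text \<open>\<open>safe\<close> supplies the side conditions of the machine. Variable
  \<open>r\<close> lives in register \<open>r + 2\<close>, and registers from \<open>K + 2\<close>
  on are scratch space, which \<open>rel\<close> ignores.\<close>

lemma exec_ccm:
  assumes "safe p \<sigma>" "bounded \<sigma>" "wf_cm K p" "rel \<rho> \<sigma>" "Y ^ weight_cm p \<le> W"
  shows "cexec (ccm (K + 2) p) \<rho> (tm \<beta> p) (\<lambda>\<rho>'. rel \<rho>' (run inp p \<sigma>) \<and> bounded (run inp p \<sigma>))"
  using assms
proof (induction p arbitrary: \<sigma> \<rho>)
  case Nop
  thus ?case unfolding cexec_def by (intro exI[of _ 1] exI[of _ \<rho>]) (simp add: exec.Skip[unfolded One_nat_def])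
next
  case (Set r e)
  have b: "bounded (set_var r (ev inp e \<sigma>) \<sigma>)" using Set by (auto simp: bounded_def)
  show ?case unfolding ccm.simps tm.simps
  proof (rule cexec_Seq, rule cexec_mono[OF exec_cex order_refl])
    fix \<rho>1 assume 1: "regs \<rho>1 (K + 2) = ev inp e \<sigma> \<and> keeps (K + 2) \<rho> \<rho>1"
    have "rel \<rho>1 \<sigma>" using keeps_rel 1 Set by blast
    thus "cexec (mov (r + 2) (Reg (K + 2))) \<rho>1 1 (\<lambda>\<rho>'. rel \<rho>' (run inp (Set r e) \<sigma>) \<and> bounded (run inp (Set r e) \<sigma>))"
      using 1 Set X_W b rel_set_var[of \<rho>1 \<sigma> r] by (intro cexec_Assign) auto
  qed (use Set in auto)
next
  case (Put a i j e)
  let ?i = "ev inp i \<sigma>" and ?j = "ev inp j \<sigma>" and ?x = "ev inp e \<sigma>"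
  have b: "bounded (set_arr a ?i ?j ?x \<sigma>)" using Put by (auto simp: bounded_def)
  have w: "Y ^ (weight i + weight j) \<le> W" "Y ^ weight e \<le> W"
    using Put.prems(5) Y_pow_mono[of "weight i + weight j" "weight_cm (Put a i j e)"]
      Y_pow_mono[of "weight e" "weight_cm (Put a i j e)"] by auto
  have ij: "?i < NI" "?j < NJ" "a < 16" using Put.prems by auto
  have "cexec (ccm (K + 2) (Put a i j e)) \<rho> (cost i + (cost j + (5 + (cost e + 1)))) (\<lambda>\<rho>'. rel \<rho>' (run inp (Put a i j e) \<sigma>) \<and> bounded (run inp (Put a i j e) \<sigma>))"
    unfolding ccm.simps
  proof (rule exec_cex2)
    fix \<rho>1 assume 1: "regs \<rho>1 (K + 2) = ?i" "regs \<rho>1 (Suc (K + 2)) = ?j" "rel \<rho>1 \<sigma>"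
    show "cexec (Seq (address a (K + 2)) (Seq (cex e (Suc (K + 2))) (Store (Reg (K + 2)) (Reg (Suc (K + 2)))))) \<rho>1
      (5 + (cost e + 1)) (\<lambda>\<rho>'. rel \<rho>' (run inp (Put a i j e) \<sigma>) \<and> bounded (run inp (Put a i j e) \<sigma>))"
    proof (rule cexec_Seq, rule cexec_mono[OF exec_address[OF 1(3) order_refl 1(1,2) ij] order_refl])
      fix \<rho>2 assume 2: "regs \<rho>2 (K + 2) = addr a ?i ?j \<and> keeps (K + 2) \<rho>1 \<rho>2"
      have r2: "rel \<rho>2 \<sigma>" using keeps_rel 1 2 by blast
      show "cexec (Seq (cex e (Suc (K + 2))) (Store (Reg (K + 2)) (Reg (Suc (K + 2))))) \<rho>2
        (cost e + 1) (\<lambda>\<rho>'. rel \<rho>' (run inp (Put a i j e) \<sigma>) \<and> bounded (run inp (Put a i j e) \<sigma>))"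
      proof (rule cexec_Seq, rule cexec_mono[OF exec_cex order_refl])
        fix \<rho>3 assume 3: "regs \<rho>3 (Suc (K + 2)) = ?x \<and> keeps (Suc (K + 2)) \<rho>2 \<rho>3"
        have r3: "rel \<rho>3 \<sigma>" using keeps_rel[of "Suc (K + 2)" \<rho>2 \<rho>3 \<sigma>] r2 3 by auto
        have k3: "regs \<rho>3 (K + 2) = addr a ?i ?j" using 2 3 by (simp add: keeps_def)
        show "cexec (Store (Reg (K + 2)) (Reg (Suc (K + 2)))) \<rho>3 1 (\<lambda>\<rho>'. rel \<rho>' (run inp (Put a i j e) \<sigma>) \<and> bounded (run inp (Put a i j e) \<sigma>))"
          using 3 k3 addr_less[OF ij(3,1,2)] rel_set_arr[OF r3 ij(3,1,2)] b X_W Put.prems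
          by (intro cexec_Store) auto
      qed (use Put.prems r2 w in auto)
    qed
  qed (use Put.prems w in auto)
  thus ?case by (rule cexec_mono) auto
next
  case (Out i e)
  have b: "bounded (set_out (ev inp i \<sigma>) (ev inp e \<sigma>) \<sigma>)" using Out by (auto simp: bounded_def)
  have "cexec (ccm (K + 2) (Out i e)) \<rho> (cost i + (cost e + 1)) (\<lambda>\<rho>'. rel \<rho>' (run inp (Out i e) \<sigma>) \<and> bounded (run inp (Out i e) \<sigma>))"
    unfolding ccm.simps
  proof (rule exec_cex2)
    fix \<rho>1 assume 1: "regs \<rho>1 (K + 2) = ev inp i \<sigma>" "regs \<rho>1 (Suc (K + 2)) = ev inp e \<sigma>" "rel \<rho>1 \<sigma>"
    show "cexec (Store (Reg (K + 2)) (Reg (Suc (K + 2)))) \<rho>1 1 (\<lambda>\<rho>'. rel \<rho>' (run inp (Out i e) \<sigma>) \<and> bounded (run inp (Out i e) \<sigma>))"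
      using 1 rel_set_out[OF 1(3)] b X_W Out.prems space by (intro cexec_Store) auto
  qed (use Out.prems in auto)
  thus ?case by (rule cexec_mono) auto
next
  case (Sq p q)
  have w: "Y ^ weight_cm p \<le> W" "Y ^ weight_cm q \<le> W"
    using Sq.prems(5) Y_pow_mono[of "weight_cm p" "weight_cm (Sq p q)"]
      Y_pow_mono[of "weight_cm q" "weight_cm (Sq p q)"] by auto
  show ?case unfolding ccm.simps tm.simps
  proof (rule cexec_Seq, rule cexec_mono[OF Sq.IH(1)[of \<sigma>] order_refl])
    fix \<rho>1 assume "rel \<rho>1 (run inp p \<sigma>) \<and> bounded (run inp p \<sigma>)"
    thus "cexec (ccm (K + 2) q) \<rho>1 (tm \<beta> q) (\<lambda>\<rho>'. rel \<rho>' (run inp (Sq p q) \<sigma>) \<and> bounded (run inp (Sq p q) \<sigma>))"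
      using Sq.IH(2)[of "run inp p \<sigma>" \<rho>1] Sq.prems w by simp
  qed (use Sq.prems w in auto)
next
  case (Cond b p q)
  have w: "Y ^ weight_cm p \<le> W" "Y ^ weight_cm q \<le> W"
    using Cond.prems(5) Y_pow_mono[of "weight_cm p" "weight_cm (Cond b p q)"]
      Y_pow_mono[of "weight_cm q" "weight_cm (Cond b p q)"] by auto
  have br: "cexec (com.If t (ccm (K + 2) p) (ccm (K + 2) q)) \<rho>1 (1 + tm \<beta> p + tm \<beta> q)
      (\<lambda>\<rho>'. rel \<rho>' (run inp (Cond b p q) \<sigma>) \<and> bounded (run inp (Cond b p q) \<sigma>))"
    if r: "rel \<rho>1 \<sigma>" and t: "test_val \<rho>1 t \<longleftrightarrow> evb inp b \<sigma>" for \<rho>1 t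
  proof (cases "evb inp b \<sigma>")
    case True
    hence "cexec (ccm (K + 2) p) \<rho>1 (tm \<beta> p) (\<lambda>\<rho>'. rel \<rho>' (run inp p \<sigma>) \<and> bounded (run inp p \<sigma>))"
      using Cond.IH(1)[of \<sigma> \<rho>1] Cond.prems r w by simp
    then obtain t' \<rho>' where "exec inp S W (ccm (K + 2) p) \<rho>1 t' \<rho>'" "t' \<le> tm \<beta> p"
      "rel \<rho>' (run inp p \<sigma>)" "bounded (run inp p \<sigma>)" by (auto simp: cexec_def)
    thus ?thesis unfolding cexec_def using exec.IfTrue[of \<rho>1 t inp S W "ccm (K + 2) p" t' \<rho>'] True t
      by (intro exI[of _ "1 + t'"] exI[of _ \<rho>']) auto
  next
    case False
    hence "cexec (ccm (K + 2) q) \<rho>1 (tm \<beta> q) (\<lambda>\<rho>'. rel \<rho>' (run inp q \<sigma>) \<and> bounded (run inp q \<sigma>))"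
      using Cond.IH(2)[of \<sigma> \<rho>1] Cond.prems r w by simp
    then obtain t' \<rho>' where "exec inp S W (ccm (K + 2) q) \<rho>1 t' \<rho>'" "t' \<le> tm \<beta> q"
      "rel \<rho>' (run inp q \<sigma>)" "bounded (run inp q \<sigma>)" by (auto simp: cexec_def)
    thus ?thesis unfolding cexec_def using exec.IfFalse[of \<rho>1 t inp S W "ccm (K + 2) q" t' \<rho>'] False t
      by (intro exI[of _ "1 + t'"] exI[of _ \<rho>']) auto
  qed
  let ?Q = "\<lambda>\<rho>'. rel \<rho>' (run inp (Cond b p q) \<sigma>) \<and> bounded (run inp (Cond b p q) \<sigma>)"
  have wxy: "Y ^ (weight x + weight y) \<le> W" if "b = Lt x y \<or> b = Eq x y" for x y
    using Cond.prems(5) Y_pow_mono[of "weight x + weight y" "weight_cm (Cond b p q)"] that by auto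
  show ?case
  proof (cases b)
    case (Lt x y)
    have "cexec (ccm (K + 2) (Cond b p q)) \<rho> (cost x + (cost y + (1 + tm \<beta> p + tm \<beta> q))) ?Q"
      unfolding ccm.simps Lt bx.case
    proof (rule exec_cex2)
      fix \<rho>1 assume 1: "regs \<rho>1 (K + 2) = ev inp x \<sigma>" "regs \<rho>1 (Suc (K + 2)) = ev inp y \<sigma>" "rel \<rho>1 \<sigma>"
      show "cexec (com.If (Less (Reg (K + 2)) (Reg (Suc (K + 2)))) (ccm (K + 2) p) (ccm (K + 2) q)) \<rho>1
        (1 + tm \<beta> p + tm \<beta> q) (\<lambda>\<rho>'. rel \<rho>' (run inp (Cond (Lt x y) p q) \<sigma>) \<and> bounded (run inp (Cond (Lt x y) p q) \<sigma>))"
        unfolding Lt[symmetric] by (rule br[OF 1(3)]) (use 1 Lt in simp)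
    qed (use Cond.prems wxy Lt in auto)
    thus ?thesis by (rule cexec_mono) (auto simp: Lt)
  next
    case (Eq x y)
    have "cexec (ccm (K + 2) (Cond b p q)) \<rho> (cost x + (cost y + (1 + tm \<beta> p + tm \<beta> q))) ?Q"
      unfolding ccm.simps Eq bx.case
    proof (rule exec_cex2)
      fix \<rho>1 assume 1: "regs \<rho>1 (K + 2) = ev inp x \<sigma>" "regs \<rho>1 (Suc (K + 2)) = ev inp y \<sigma>" "rel \<rho>1 \<sigma>"
      show "cexec (com.If (Equal (Reg (K + 2)) (Reg (Suc (K + 2)))) (ccm (K + 2) p) (ccm (K + 2) q)) \<rho>1
        (1 + tm \<beta> p + tm \<beta> q) (\<lambda>\<rho>'. rel \<rho>' (run inp (Cond (Eq x y) p q) \<sigma>) \<and> bounded (run inp (Cond (Eq x y) p q) \<sigma>))"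
        unfolding Eq[symmetric] by (rule br[OF 1(3)]) (use 1 Eq in simp)
    qed (use Cond.prems wxy Eq in auto)
    thus ?thesis by (rule cexec_mono) (auto simp: Eq)
  qed
next
  case (Loop r lo h p)
  let ?l = "ev inp lo \<sigma>" and ?H = "var \<sigma> h"
  let ?f = "\<lambda>\<tau>. incr r (run inp p \<tau>)"
  let ?s = "set_var r ?l \<sigma>"
  let ?T = "K + 2"
  let ?body = "Seq (ccm ?T p) (Assign (r + 2) Add (Reg (r + 2)) (Imm 1))"
  let ?while = "While (Less (Reg (r + 2)) (Reg (h + 2))) ?body"
  have w: "Y ^ weight_cm p \<le> W" "Y ^ weight lo \<le> W"
    using Loop.prems(5) Y_pow_mono[of "weight_cm p" "weight_cm (Loop r lo h p)"]
      Y_pow_mono[of "weight lo" "weight_cm (Loop r lo h p)"] by auto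
  have rK: "r < K" "h < K" "r \<noteq> h" "r \<notin> wv p" "h \<notin> wv p" using Loop.prems by auto
  have HX: "?H \<le> X" using Loop.prems by (auto simp: bounded_def)
  have sv: "var ((?f ^^ k) ?s) r = ?l + k \<and> var ((?f ^^ k) ?s) h = ?H" for k
    using rK by (induction k) (auto simp: incr_def run_frame)
  \<comment> \<open>Induction on the number \<open>m\<close> of remaining rounds: after
    \<open>k\<close> rounds the machine matches the \<open>k\<close>-th iterate in the source
    semantics.\<close>
  have wh: "cexec ?while \<rho>1 (1 + m * (tm \<beta> p + 2)) (\<lambda>\<rho>'. rel \<rho>' ((?f ^^ (?H - ?l)) ?s) \<and> bounded ((?f ^^ (?H - ?l)) ?s))"
    if "m = (?H - ?l) - k" "k \<le> ?H - ?l" "rel \<rho>1 ((?f ^^ k) ?s)" "bounded ((?f ^^ k) ?s)" for m k \<rho>1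
    using that
  proof (induction m arbitrary: k \<rho>1)
    case 0
    hence k: "k = ?H - ?l" by simp
    have "\<not> test_val \<rho>1 (Less (Reg (r + 2)) (Reg (h + 2)))"
      using 0 sv[of k] rK k unfolding rel_def by simp
    hence "exec inp S W ?while \<rho>1 1 \<rho>1" by (rule exec.WhileFalse)
    moreover have "rel \<rho>1 ((?f ^^ (?H - ?l)) ?s) \<and> bounded ((?f ^^ (?H - ?l)) ?s)"
      using 0 unfolding k by blast
    ultimately show ?case unfolding cexec_def
      by (intro exI[of _ 1] exI[of _ \<rho>1] conjI) simp_all
  next
    case (Suc m)
    let ?t = "(?f ^^ k) ?s"
    have k: "k < ?H - ?l" using Suc.prems by simp
    have test: "test_val \<rho>1 (Less (Reg (r + 2)) (Reg (h + 2)))"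
      using Suc.prems sv[of k] rK k unfolding rel_def by simp
    have sp: "safe p ?t" using Loop.prems(1) k by simp
    have "cexec (ccm ?T p) \<rho>1 (tm \<beta> p) (\<lambda>\<rho>'. rel \<rho>' (run inp p ?t) \<and> bounded (run inp p ?t))"
      using Loop.IH[OF sp Suc.prems(4) _ Suc.prems(3)] Loop.prems w by simp
    hence "cexec ?body \<rho>1 (tm \<beta> p + 1) (\<lambda>\<rho>'. rel \<rho>' (?f ?t) \<and> bounded (?f ?t))"
    proof (intro cexec_Seq, elim cexec_mono, simp)
      fix \<rho>2 assume 2: "rel \<rho>2 (run inp p ?t) \<and> bounded (run inp p ?t)"
      have v: "var (run inp p ?t) r = ?l + k" using sv[of k] rK by (simp add: run_frame)
      hence r2: "regs \<rho>2 (r + 2) = ?l + k" using 2 rK by (simp add: rel_def)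
      have le: "Suc (?l + k) \<le> X" using k HX by simp
      have "bounded (?f ?t)" using 2 le v by (auto simp: bounded_def incr_def)
      moreover have "rel (set_reg (r + 2) (Suc (?l + k)) \<rho>2) (?f ?t)"
        using rel_set_var[of \<rho>2 "run inp p ?t" r "Suc (?l + k)"] 2 v by (simp add: incr_def)
      ultimately show "cexec (Assign (r + 2) Add (Reg (r + 2)) (Imm 1)) \<rho>2 1 (\<lambda>\<rho>'. rel \<rho>' (?f ?t) \<and> bounded (?f ?t))"
        using le X_W r2 by (intro cexec_Assign) auto
    qed
    then obtain t2 \<rho>2 where 2: "exec inp S W ?body \<rho>1 t2 \<rho>2" "t2 \<le> tm \<beta> p + 1" "rel \<rho>2 (?f ?t)" "bounded (?f ?t)"
      by (auto simp: cexec_def)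
    have "cexec ?while \<rho>2 (1 + m * (tm \<beta> p + 2)) (\<lambda>\<rho>'. rel \<rho>' ((?f ^^ (?H - ?l)) ?s) \<and> bounded ((?f ^^ (?H - ?l)) ?s))"
      by (rule Suc.IH[of "Suc k"]) (use Suc.prems k 2 in auto)
    then obtain t3 \<rho>3 where 3: "exec inp S W ?while \<rho>2 t3 \<rho>3" "t3 \<le> 1 + m * (tm \<beta> p + 2)"
       "rel \<rho>3 ((?f ^^ (?H - ?l)) ?s) \<and> bounded ((?f ^^ (?H - ?l)) ?s)"
      by (auto simp: cexec_def)
    show ?case unfolding cexec_def
      by (rule exI[of _ "1 + t2 + t3"], rule exI[of _ \<rho>3])
        (use exec.WhileTrue[OF test 2(1) 3(1)] 2(2) 3 in auto)
  qed
  have "cexec (ccm ?T (Loop r lo h p)) \<rho> (cost lo + (1 + (1 + (?H - ?l) * (tm \<beta> p + 2))))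
    (\<lambda>\<rho>'. rel \<rho>' (run inp (Loop r lo h p) \<sigma>) \<and> bounded (run inp (Loop r lo h p) \<sigma>))"
    unfolding ccm.simps
  proof (rule cexec_Seq, rule cexec_mono[OF exec_cex[of lo \<sigma>] order_refl])
    fix \<rho>1 assume 1: "regs \<rho>1 (K + 2) = ?l \<and> keeps (K + 2) \<rho> \<rho>1"
    have r1: "rel \<rho>1 \<sigma>" using keeps_rel 1 Loop.prems by blast
    show "cexec (Seq (mov (r + 2) (Reg ?T)) ?while) \<rho>1 (1 + (1 + (?H - ?l) * (tm \<beta> p + 2)))
      (\<lambda>\<rho>'. rel \<rho>' (run inp (Loop r lo h p) \<sigma>) \<and> bounded (run inp (Loop r lo h p) \<sigma>))"
    proof (rule cexec_Seq, rule cexec_Assign[OF order_refl])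
      show "arith_val Add (operand_val \<rho>1 (Reg ?T)) (operand_val \<rho>1 (Imm 0)) \<le> W"
        using 1 Loop.prems X_W by simp
      have "rel (set_reg (r + 2) ?l \<rho>1) ?s" by (rule rel_set_var[OF r1])
      moreover have "bounded ?s" using Loop.prems by (auto simp: bounded_def)
      ultimately show "cexec ?while (set_reg (r + 2) (arith_val Add (operand_val \<rho>1 (Reg ?T)) (operand_val \<rho>1 (Imm 0))) \<rho>1)
         (1 + (?H - ?l) * (tm \<beta> p + 2)) (\<lambda>\<rho>'. rel \<rho>' (run inp (Loop r lo h p) \<sigma>) \<and> bounded (run inp (Loop r lo h p) \<sigma>))"
        using wh[of "?H - ?l" 0 "set_reg (r + 2) ?l \<rho>1"] 1 by simp
    qed
  qed (use Loop.prems w in auto)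
  moreover have "(?H - ?l) * (tm \<beta> p + 2) \<le> \<beta> h * (tm \<beta> p + 2)"
    using Loop.prems by (intro mult_le_mono1) auto
  ultimately show ?case by (elim cexec_mono) auto
qed

end

section \<open>The program\<close>

abbreviation (input) "vn \<equiv> 0 :: nat"
abbreviation (input) "vc \<equiv> 1 :: nat"
abbreviation (input) "vC \<equiv> 2 :: nat"
abbreviation (input) "vv \<equiv> 3 :: nat"
abbreviation (input) "vi \<equiv> 4 :: nat"
abbreviation (input) "ve \<equiv> 5 :: nat"
abbreviation (input) "vlen \<equiv> 6 :: nat"
abbreviation (input) "vsum \<equiv> 7 :: nat"
abbreviation (input) "vu \<equiv> 8 :: nat"
abbreviation (input) "vy \<equiv> 9 :: nat"
abbreviation (input) "vdeg \<equiv> 10 :: nat"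
abbreviation (input) "vd \<equiv> 11 :: nat"
abbreviation (input) "vr \<equiv> 12 :: nat"
abbreviation (input) "vw \<equiv> 13 :: nat"
abbreviation (input) "vj \<equiv> 14 :: nat"
abbreviation (input) "vjj \<equiv> 15 :: nat"
abbreviation (input) "vb \<equiv> 16 :: nat"
abbreviation (input) "vh \<equiv> 17 :: nat"
abbreviation (input) "vnd \<equiv> 18 :: nat"
abbreviation (input) "vth \<equiv> 19 :: nat"
abbreviation (input) "va \<equiv> 20 :: nat"
abbreviation (input) "vbest \<equiv> 21 :: nat"
abbreviation (input) "vt \<equiv> 22 :: nat"
abbreviation (input) "vo \<equiv> 23 :: nat"
abbreviation (input) "vcnt \<equiv> 24 :: nat"
abbreviation (input) "vk \<equiv> 25 :: nat"

text \<open>Arrays indexed by vertices: \<open>aRL\<close> and \<open>aLEN\<close> hold the lists of reachable vertices and their lengths, \<open>aMARK\<close>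
  the last search that met the vertex, \<open>aWT\<close> and \<open>aDD\<close> the weights of \<open>reach v\<close> and \<open>D v\<close>. Arrays indexed
  by tree nodes: children \<open>aLC\<close> and \<open>aRC\<close>, threshold \<open>aTH\<close> for using the right child, table \<open>aTB\<close>, and
  \<open>aTG\<close>, the weight to be taken from the node.\<close>

abbreviation (input) "aRL \<equiv> 0 :: nat"
abbreviation (input) "aLEN \<equiv> 1 :: nat"
abbreviation (input) "aMARK \<equiv> 2 :: nat"
abbreviation (input) "aWT \<equiv> 3 :: nat"
abbreviation (input) "aDD \<equiv> 4 :: nat"
abbreviation (input) "aCUR \<equiv> 5 :: nat"
abbreviation (input) "aREP \<equiv> 6 :: nat"
abbreviation (input) "aDEAD \<equiv> 7 :: nat"
abbreviation (input) "aLC \<equiv> 8 :: nat"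
abbreviation (input) "aRC \<equiv> 9 :: nat"
abbreviation (input) "aTH \<equiv> 10 :: nat"
abbreviation (input) "aTB \<equiv> 11 :: nat"
abbreviation (input) "aTG \<equiv> 12 :: nat"
abbreviation (input) "aORD \<equiv> 13 :: nat"

abbreviation (input) "Arr1 a e \<equiv> Arr a e (N 0)"
abbreviation (input) "Put1 a e x \<equiv> Put a e (N 0) x"
abbreviation (input) "xadd e f \<equiv> B Add e f"
abbreviation (input) "xsub e f \<equiv> B Sub e f"
abbreviation (input) "xmul e f \<equiv> B Mul e f"
abbreviation (input) "For r h p \<equiv> Loop r (N 0) h p"
abbreviation (input) "When b p \<equiv> Cond b p Nop"
abbreviation (input) "Unless b p \<equiv> Cond b Nop p"

section \<open>Search, ranks and sorting as programs\<close>

definition size_ex :: "ex \<Rightarrow> ex" where "size_ex e = In (xadd (N 2) e)"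
definition offset_ex :: "ex \<Rightarrow> ex" where "offset_ex e = In (xadd (V vn) (xadd (N 2) e))"
definition target_ex :: "ex \<Rightarrow> ex" where "target_ex e = In (xadd (xadd (xmul (N 2) (V vn)) (N 3)) e)"

text \<open>\<open>vC\<close> is \<open>c + 1\<close>, which turns "at most \<open>c\<close>" into a
  strict comparison. A \<open>vsum\<close> above \<open>c\<close> records failure and makes all
  further visits idle. Marks carry the number \<open>v + 1\<close> of the current search, so they
  are never cleared.\<close>

definition visit :: cm where
  "visit = When (Lt (V vsum) (V vC)) (Sq (Set vy (target_ex (xadd (V vo) (V ve))))
     (Unless (Eq (Arr1 aMARK (V vy)) (xadd (V vv) (N 1)))
       (Sq (Set vsum (xadd (V vsum) (size_ex (V vy))))
         (When (Lt (V vsum) (V vC))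
           (Sq (Put1 aMARK (V vy) (xadd (V vv) (N 1)))
           (Sq (Put aRL (V vv) (V vlen) (V vy))
             (Set vlen (xadd (V vlen) (N 1)))))))))"

text \<open>Out-neighbours are distinct and have positive sizes, so more than \<open>c\<close> of
  them weigh more than \<open>c\<close>; \<open>vsum\<close> then receives the failure value at
  once.\<close>

definition neighbours :: cm where
  "neighbours = Cond (Lt (V vdeg) (V vC)) (For ve vdeg visit) (Set vsum (V vC))"

definition expand :: cm where
  "expand = When (Lt (V vi) (V vlen)) (When (Lt (V vsum) (V vC))
     (Sq (Set vu (Arr aRL (V vv) (V vi)))
     (Sq (Set vo (offset_ex (V vu)))
     (Sq (Set vdeg (xsub (offset_ex (xadd (V vu) (N 1))) (V vo)))
       neighbours))))"

text \<open>The queue grows while it is scanned, so the scan is a loop of fixed length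
  \<open>c\<close> that idles past the end. A queue of weight at most \<open>c\<close> has at most
  \<open>c\<close> members.\<close>

definition closures :: cm where
  "closures = For vv vn
     (Sq (Put aRL (V vv) (N 0) (V vv))
     (Sq (Put1 aMARK (V vv) (xadd (V vv) (N 1)))
     (Sq (Set vlen (N 1))
     (Sq (Set vsum (size_ex (V vv)))
     (Sq (For vi vc expand)
     (Sq (Put1 aLEN (V vv) (V vlen))
       (Put1 aWT (V vv) (V vsum))))))))"

text \<open>Row \<open>v\<close> of \<open>aTB\<close> gets its two nonzero entries, at 0 and at the
  weight of the component. The value \<open>c + 1\<close> in \<open>aDD\<close> makes unusable
  vertices fail all later tests on that array.\<close>

definition ranks :: cm where
  "ranks = For vv vn
     (Cond (Lt (Arr1 aWT (V vv)) (V vC))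
       (Sq (Set vlen (Arr1 aLEN (V vv)))
       (Sq (Set vd (N 0))
       (Sq (Set vr (V vv))
       (Sq (For vi vlen
             (Sq (Set vw (Arr aRL (V vv) (V vi)))
               (Cond (Lt (Arr1 aWT (V vw)) (Arr1 aWT (V vv)))
                 (Set vd (xadd (V vd) (size_ex (V vw))))
                 (When (Lt (V vw) (V vr)) (Set vr (V vw))))))
       (Sq (Put1 aDD (V vv) (V vd))
       (Sq (Put1 aCUR (V vv) (V vr))
       (Sq (Put1 aREP (V vv) (V vr))
       (Sq (Put1 aTB (V vv) (N 1))
         (Put aTB (V vv) (xsub (Arr1 aWT (V vv)) (V vd)) (N 1))))))))))
       (Put1 aDD (V vv) (V vC)))"

text \<open>One scan over all vertices for each value of \<open>d\<close> costs only
  \<open>n * c\<close> and is stable in the vertex number.\<close>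

definition sorting :: cm where
  "sorting = Sq (Set vcnt (N 0)) (For vb vc (For vv vn
     (When (Eq (Arr1 aDD (V vv)) (V vb))
       (Sq (Put1 aORD (V vcnt) (V vv)) (Set vcnt (xadd (V vcnt) (N 1)))))))"

lemma if_app: "(if b then f else g) x = (if b then f x else g x)"
  by simp

context ssg
begin

text \<open>Bounds every stored value. The factor 2 leaves room for a sum of at most
  \<open>c\<close> to which one more size is added before the test.\<close>

definition X :: nat where "X = 2 * (length inp + Max (set inp))"
definition \<beta> :: "nat \<Rightarrow> nat" where "\<beta> r = (if r = vn \<or> r = vcnt then n else if r = vnd then 2 * n else c + 1)"

text \<open>Vertices and tree nodes index the rows up to \<open>2 * n - 1\<close>. Row
  \<open>2 * n\<close> stands for the absence of a piece; it is the row that \<open>best\<close>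
  accesses when no vertex is usable.\<close>

definition NI :: nat where "NI = 2 * n + 1"
definition NJ :: nat where "NJ = c + 1"

sublocale machine inp n NI NJ X \<beta> .

lemma less_NI [simp]: "i < NI \<longleftrightarrow> i \<le> 2 * n" and less_NJ [simp]: "j < NJ \<longleftrightarrow> j \<le> c"
  by (auto simp: NI_def NJ_def)

lemma inp_le_Max: "i < length inp \<Longrightarrow> inp ! i \<le> Max (set inp)"
  by (rule Max_ge) auto
lemma inp_le_X: assumes "i < length inp" shows "inp ! i \<le> X"
  using inp_le_Max[OF assms] by (simp add: X_def)
lemma c_le_X: "c + 2 \<le> X" using inp_le_Max[of "Suc 0"] inp_len inp_c by (simp add: X_def)
lemma n_le_X: "2 * n + 4 \<le> X" using inp_len by (simp add: X_def)
lemma s_le_X: assumes "j < n" shows "c + s j \<le> X" 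
proof -
  have "c \<le> Max (set inp)" using inp_le_Max[of "Suc 0"] inp_len inp_c by simp
  moreover have "s j \<le> Max (set inp)" using inp_le_Max[of "Suc (Suc j)"] inp_len assms by (simp add: inp_s)
  ultimately show ?thesis by (simp add: X_def)
qed

lemma size_ex [simp]: "ev inp e \<sigma> < n \<Longrightarrow> ev inp (size_ex e) \<sigma> = s (ev inp e \<sigma>)"
   "okx (size_ex e) \<sigma> \<longleftrightarrow> okx e \<sigma> \<and> 2 + ev inp e \<sigma> < length inp"
  by (auto simp: size_ex_def inp_s)
lemma offset_ex [simp]: "var \<sigma> vn = n \<Longrightarrow> ev inp e \<sigma> \<le> n \<Longrightarrow> ev inp (offset_ex e) \<sigma> = off (ev inp e \<sigma>)"
   "okx (offset_ex e) \<sigma> \<longleftrightarrow> okx e \<sigma> \<and> var \<sigma> vn + (2 + ev inp e \<sigma>) < length inp"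
  using inp_off by (auto simp: offset_ex_def)
lemma target_ex [simp]: "ev inp (target_ex e) \<sigma> = inp ! (2 * var \<sigma> vn + 3 + ev inp e \<sigma>)"
   "okx (target_ex e) \<sigma> \<longleftrightarrow> okx e \<sigma> \<and> 2 * var \<sigma> vn + 3 + ev inp e \<sigma> < length inp"
  by (auto simp: target_ex_def)

definition dims :: "st \<Rightarrow> bool" where
  "dims \<sigma> \<longleftrightarrow> var \<sigma> vn = n \<and> var \<sigma> vc = c \<and> var \<sigma> vC = Suc c"

lemma dimsD: "dims \<sigma> \<Longrightarrow> var \<sigma> 0 = n" "dims \<sigma> \<Longrightarrow> var \<sigma> (Suc 0) = c" "dims \<sigma> \<Longrightarrow> var \<sigma> 2 = Suc c"
  by (auto simp: dims_def)

lemma dims_same: "same vs as \<sigma> \<tau> \<Longrightarrow> dims \<sigma> \<Longrightarrow> 0 \<notin> vs \<Longrightarrow> Suc 0 \<notin> vs \<Longrightarrow> 2 \<notin> vs \<Longrightarrow> dims \<tau>"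
  by (auto simp: dims_def same_def)

lemma dims_set [simp]: "dims (set_arr a i j x \<sigma>) \<longleftrightarrow> dims \<sigma>"
  "2 < r \<Longrightarrow> dims (set_var r x \<sigma>) \<longleftrightarrow> dims \<sigma>"
  by (auto simp: dims_def)

lemma card_le_sum: assumes "A \<subseteq> {..<n}" shows "card A \<le> sum s A"
proof -
  have "card A = (\<Sum>x\<in>A. 1)" by simp
  also have "\<dots> \<le> sum s A" using s_pos assms by (intro sum_mono) (auto simp: Suc_le_eq)
  finally show ?thesis .
qed

section \<open>Transitive closure\<close>

text \<open>\<open>L\<close> is the queue, whose first \<open>i\<close> members have been expanded,
  \<open>z\<close> the weight so far and \<open>mk\<close> the marks. A value \<open>z\<close> above
  \<open>c\<close> need not be the weight of anything; it certifies that \<open>v\<close> is not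
  usable.\<close>

definition search :: "nat \<Rightarrow> nat \<Rightarrow> nat list \<Rightarrow> nat \<Rightarrow> (nat \<Rightarrow> nat) \<Rightarrow> bool" where
  "search v i L z mk \<longleftrightarrow> length L \<le> c \<and> distinct L \<and> v \<in> set L \<and> set L \<subseteq> reach v \<and> (\<forall>y. mk y \<le> Suc v) \<and>
    (\<forall>y<n. mk y = Suc v \<longleftrightarrow> y \<in> set L) \<and>
    (z \<le> c \<longrightarrow> z = sum s (set L) \<and> (\<forall>k<i. k < length L \<longrightarrow> set (adj (L ! k)) \<subseteq> set L)) \<and>
    (c < z \<longrightarrow> c < W v) \<and> z \<le> X"

lemma succ_reach: "u < n \<Longrightarrow> u \<in> reach v \<Longrightarrow> set (adj u) \<subseteq> reach v"
  using adj_set by (auto simp: reach_def intro: rtrancl_into_rtrancl)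

lemma search_init:
  assumes "v < n" "\<And>y. mk y \<le> v"
  shows "search v 0 [v] (s v) (mk(v := Suc v))"
proof -
  have "s v \<le> W v" unfolding W_def using finite_reach[OF assms(1)] reach_refl by (intro member_le_sum) auto
  moreover have "mk y \<noteq> Suc v" "mk y \<le> Suc v" for y using assms(2)[of y] by auto
  ultimately show ?thesis using s_le_X[OF assms(1)] reach_refl c_pos by (auto simp: search_def)
qed

lemma search_push:
  assumes se: "search v i L z mk" and v: "v < n" and z: "z \<le> c" and y: "y \<in> reach v" "y \<notin> set L" "z + s y \<le> c" and i: "i < length L"
  shows "search v i (L @ [y]) (z + s y) (mk(y := Suc v))" "length L < c"
proof -
  have L: "set L \<subseteq> {..<n}" "y < n" using se reach_lt[OF v] y by (auto simp: search_def)
  have zz: "z + s y = sum s (insert y (set L))" using se z y by (auto simp: search_def)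
  have "Suc (length L) = card (insert y (set L))" using se y by (simp add: search_def distinct_card)
  also have "\<dots> \<le> c" using card_le_sum[of "insert y (set L)"] zz y L by auto
  finally show len: "length L < c" by simp
  show "search v i (L @ [y]) (z + s y) (mk(y := Suc v))"
    using se z y i zz len c_le_X unfolding search_def by (auto simp: nth_append)
qed

lemma search_over:
  assumes se: "search v i L z mk" and v: "v < n" and z: "z \<le> c" and y: "y \<in> reach v" "y \<notin> set L" "c < z + s y"
  shows "search v i L (z + s y) mk"
proof -
  have yn: "y < n" using reach_lt[OF v] y by auto
  have "z + s y = sum s (insert y (set L))" using se z y by (auto simp: search_def)
  also have "\<dots> \<le> W v" unfolding W_def using se y finite_reach[OF v] by (intro sum_mono2) (auto simp: search_def)
  finally show ?thesis using se y s_le_X[OF yn] z unfolding search_def by auto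
qed

lemma search_degree:
  assumes se: "search v i L z mk" and v: "v < n" and u: "u \<in> set L" "c < length (adj u)"
  shows "search v i' L (Suc c) mk"
proof -
  have ur: "u \<in> reach v" "u < n" using se u reach_lt[OF v] by (auto simp: search_def)
  have sub: "set (adj u) \<subseteq> reach v" using succ_reach ur by blast
  have "c < card (set (adj u))" using u adj_distinct[OF ur(2)] by (simp add: distinct_card)
  also have "\<dots> \<le> sum s (set (adj u))" using sub reach_lt[OF v] by (intro card_le_sum) auto
  also have "\<dots> \<le> W v" unfolding W_def using sub finite_reach[OF v] by (intro sum_mono2) auto
  finally show ?thesis using se c_le_X unfolding search_def by auto
qed

lemma search_next:
  assumes "search v i L z mk" "z \<le> c \<Longrightarrow> i < length L \<Longrightarrow> set (adj (L ! i)) \<subseteq> set L"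
  shows "search v (Suc i) L z mk"
  using assms unfolding search_def by (auto simp: less_Suc_eq)

text \<open>The queue has at most \<open>c\<close> members, so after \<open>c\<close> rounds all of
  them are expanded and the list is closed under arcs.\<close>

lemma search_final:
  assumes se: "search v c L z mk" and v: "v < n" and z: "z \<le> c"
  shows "set L = reach v" "z = W v"
proof -
  have cl: "set (adj x) \<subseteq> set L" if "x \<in> set L" for x
    using se z that unfolding search_def by (metis in_set_conv_nth less_le_trans)
  have "reach v \<subseteq> set L"
  proof
    fix y assume "y \<in> reach v"
    hence "(v, y) \<in> (parcs G)\<^sup>*" by (simp add: reach_def)
    thus "y \<in> set L"
    proof (induction rule: rtrancl_induct)
      case (step x y)
      thus ?case using cl adj_set arcs by blast
    qed (use se in \<open>simp add: search_def\<close>)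
  qed
  thus "set L = reach v" using se by (auto simp: search_def)
  thus "z = W v" using se z by (auto simp: search_def W_def)
qed

definition row :: "st \<Rightarrow> nat \<Rightarrow> nat \<Rightarrow> nat list" where
  "row \<sigma> v l = map (arr \<sigma> aRL v) [0..<l]"

lemma row_simps [simp]: "length (row \<sigma> v l) = l" "k < l \<Longrightarrow> row \<sigma> v l ! k = arr \<sigma> aRL v k"
  by (auto simp: row_def)

lemma row_snoc: "arr \<tau> aRL v = (arr \<sigma> aRL v)(l := y) \<Longrightarrow> row \<tau> v (Suc l) = row \<sigma> v l @ [y]"
  by (auto simp: row_def)

definition searching :: "nat \<Rightarrow> nat \<Rightarrow> st \<Rightarrow> bool" where
  "searching v i \<sigma> \<longleftrightarrow> search v i (row \<sigma> v (var \<sigma> vlen)) (var \<sigma> vsum) (\<lambda>y. arr \<sigma> aMARK y 0)"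

lemma visit:
  assumes co: "dims \<sigma>" and se: "searching v i \<sigma>" and v: "v < n" "var \<sigma> vv = v" and i: "i < var \<sigma> vlen" "arr \<sigma> aRL v i = u"
    and e: "var \<sigma> ve = e" "e < length (adj u)" and o: "var \<sigma> vo = off u"
    and sub: "var \<sigma> vsum \<le> c \<Longrightarrow> set (take e (adj u)) \<subseteq> set (row \<sigma> v (var \<sigma> vlen))"
  shows "wp visit (\<lambda>\<tau>. searching v i \<tau> \<and> i < var \<tau> vlen \<and> arr \<tau> aRL v i = u \<and> (\<forall>v'. v' \<noteq> v \<longrightarrow> arr \<tau> aRL v' = arr \<sigma> aRL v') \<and>
    (var \<tau> vsum \<le> c \<longrightarrow> set (take (Suc e) (adj u)) \<subseteq> set (row \<tau> v (var \<tau> vlen)))) \<sigma>"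
proof -
  let ?L = "row \<sigma> v (var \<sigma> vlen)" and ?y = "adj u ! e" and ?mk = "\<lambda>y. arr \<sigma> aMARK y 0"
  have se': "search v i ?L (var \<sigma> vsum) ?mk" using se by (simp add: searching_def)
  have uL: "u \<in> set ?L" using i by (metis in_set_conv_nth row_simps)
  have ur: "u \<in> reach v" using uL se' by (auto simp: search_def)
  have un: "u < n" using ur reach_lt[OF v(1)] by auto
  have y: "?y \<in> reach v" using succ_reach[OF un ur] e nth_mem by blast
  have yn: "?y < n" using y reach_lt[OF v(1)] by auto
  have ix: "inp ! (2 * n + 3 + (off u + e)) = ?y" "2 * n + 3 + (off u + e) < length inp"
    using inp_adj[OF un e(2)] inp_len by auto
  have tk: "take (Suc e) (adj u) = take e (adj u) @ [?y]" using e by (simp add: take_Suc_conv_app_nth)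
  show ?thesis
  proof (cases "var \<sigma> vsum \<le> c")
    case False
    thus ?thesis using co se i e by (simp add: visit_def dimsD)
  next
    case z: True
    show ?thesis
    proof (cases "?mk ?y = Suc v")
      case True
      hence "?y \<in> set ?L" using se' yn by (simp add: search_def)
      thus ?thesis using True co se i e z sub o ix yn n_le_X v tk
        by (simp add: visit_def dimsD searching_def row_def)
    next
      case False
      hence yL: "?y \<notin> set ?L" using se' yn by (simp add: search_def)
      have sX: "var \<sigma> vsum + s ?y \<le> X" using s_le_X[OF yn] z by simp
      show ?thesis
      proof (cases "var \<sigma> vsum + s ?y \<le> c")
        case over: False
        have "search v i ?L (var \<sigma> vsum + s ?y) ?mk"
          by (rule search_over[OF se' v(1) z y yL]) (use over in simp)
        thus ?thesis using False co i e z o ix yn n_le_X v sX over inp_len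
          by (simp add: visit_def dimsD searching_def row_def)
      next
        case fit: True
        note push = search_push[OF se' v(1) z y yL fit]
        have p: "search v i (?L @ [?y]) (var \<sigma> vsum + s ?y) (?mk(?y := Suc v))" "var \<sigma> vlen < c"
          using push i by simp_all
        have mk: "(\<lambda>y. ((arr \<sigma> aMARK)(?y := (arr \<sigma> aMARK ?y)(0 := Suc v))) y 0) = ?mk(?y := Suc v)"
          by auto
        show ?thesis using False co i e z o ix yn n_le_X c_le_X v sX fit inp_len p tk sub
          by (simp add: visit_def dimsD searching_def mk row_snoc[of _ v \<sigma> "var \<sigma> vlen" ?y] cong: if_cong)
            (auto simp: row_def fun_upd_def if_app cong: if_cong)
      qed
    qed
  qed
qed

lemma expand:
  assumes co: "dims \<sigma>" and se: "searching v i \<sigma>" and v: "v < n" "var \<sigma> vv = v" and i: "var \<sigma> vi = i" "i < c"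
  shows "wp expand (\<lambda>\<tau>. searching v (Suc i) \<tau> \<and> (\<forall>v'. v' \<noteq> v \<longrightarrow> arr \<tau> aRL v' = arr \<sigma> aRL v')) \<sigma>"
proof -
  let ?L = "row \<sigma> v (var \<sigma> vlen)"
  have se': "search v i ?L (var \<sigma> vsum) (\<lambda>y. arr \<sigma> aMARK y 0)" using se by (simp add: searching_def)
  show ?thesis
  proof (cases "i < var \<sigma> vlen \<and> var \<sigma> vsum \<le> c")
    case False
    have "searching v (Suc i) \<sigma>" unfolding searching_def
      by (rule search_next[OF se']) (use False in auto)
    thus ?thesis using False co i by (auto simp: expand_def dimsD)
  next
    case True
    define u where "u = arr \<sigma> aRL v i"
    have uL: "u \<in> set ?L" unfolding u_def using True by (metis in_set_conv_nth row_simps)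
    have ur: "u \<in> reach v" using uL se' by (auto simp: search_def)
    have un: "u < n" using ur reach_lt[OF v(1)] by auto
    have deg: "off (Suc u) - off u = length (adj u)" using off_Suc by simp
    have oX: "off u \<le> X" using inp_le_X[of "n + Suc (Suc u)"] inp_off[of u] un inp_len by simp
    have oX': "off (Suc u) \<le> X" using inp_le_X[of "n + Suc (Suc (Suc u))"] inp_off[of "Suc u"] un inp_len by simp
    have uX: "u \<le> X" using un n_le_X by simp
    let ?s = "set_var vdeg (length (adj u)) (set_var vo (off u) (set_var vu u \<sigma>))"
    have post: "wp neighbours (\<lambda>\<tau>. searching v (Suc i) \<tau> \<and> (\<forall>v'. v' \<noteq> v \<longrightarrow> arr \<tau> aRL v' = arr \<sigma> aRL v')) ?s"
    proof (cases "length (adj u) \<le> c")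
      case False
      have "search v (Suc i) ?L (Suc c) (\<lambda>y. arr \<sigma> aMARK y 0)"
        by (rule search_degree[OF se' v(1) uL]) (use False in simp)
      thus ?thesis using False co c_le_X by (simp add: neighbours_def dimsD searching_def row_def)
    next
      case small: True
      have "wp (For ve vdeg visit) (\<lambda>\<tau>. searching v (Suc i) \<tau> \<and> (\<forall>v'. v' \<noteq> v \<longrightarrow> arr \<tau> aRL v' = arr \<sigma> aRL v')) ?s"
      proof (rule wp_Loop[where I = "\<lambda>e \<tau>. searching v i \<tau> \<and> i < var \<tau> vlen \<and> arr \<tau> aRL v i = u \<and>
          (\<forall>v'. v' \<noteq> v \<longrightarrow> arr \<tau> aRL v' = arr \<sigma> aRL v') \<and>
          (var \<tau> vsum \<le> c \<longrightarrow> set (take e (adj u)) \<subseteq> set (row \<tau> v (var \<tau> vlen)))"])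
        fix e \<tau> assume e: "e < var ?s vdeg" "var \<tau> ve = e" and sm: "same (insert ve (wv visit)) (wa visit) ?s \<tau>"
          and I: "searching v i \<tau> \<and> i < var \<tau> vlen \<and> arr \<tau> aRL v i = u \<and>
          (\<forall>v'. v' \<noteq> v \<longrightarrow> arr \<tau> aRL v' = arr \<sigma> aRL v') \<and>
          (var \<tau> vsum \<le> c \<longrightarrow> set (take e (adj u)) \<subseteq> set (row \<tau> v (var \<tau> vlen)))"
        have "dims \<tau>" using dims_same[OF sm] co by (simp add: visit_def)
        moreover have "var \<tau> vv = v" "var \<tau> vo = off u"
          using same_var[OF sm] v by (simp_all add: visit_def)
        ultimately show "wp visit (\<lambda>\<tau>'. searching v i (set_var ve (Suc e) \<tau>') \<and> i < var (set_var ve (Suc e) \<tau>') vlen \<and>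
            arr (set_var ve (Suc e) \<tau>') aRL v i = u \<and>
            (\<forall>v'. v' \<noteq> v \<longrightarrow> arr (set_var ve (Suc e) \<tau>') aRL v' = arr \<sigma> aRL v') \<and>
            (var (set_var ve (Suc e) \<tau>') vsum \<le> c \<longrightarrow> set (take (Suc e) (adj u)) \<subseteq>
               set (row (set_var ve (Suc e) \<tau>') v (var (set_var ve (Suc e) \<tau>') vlen)))) \<tau>"
          using I e v(1) by (intro wp_mono[OF visit[of \<tau> v i u e]]) (auto simp: searching_def row_def)
      next
        fix \<tau> assume "searching v i \<tau> \<and> i < var \<tau> vlen \<and> arr \<tau> aRL v i = u \<and>
          (\<forall>v'. v' \<noteq> v \<longrightarrow> arr \<tau> aRL v' = arr \<sigma> aRL v') \<and>
          (var \<tau> vsum \<le> c \<longrightarrow> set (take (max (ev inp (N 0) ?s) (var ?s vdeg)) (adj u)) \<subseteq> set (row \<tau> v (var \<tau> vlen)))"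
        thus "searching v (Suc i) \<tau> \<and> (\<forall>v'. v' \<noteq> v \<longrightarrow> arr \<tau> aRL v' = arr \<sigma> aRL v')"
          unfolding searching_def by (auto intro!: search_next)
      qed (use se True small in \<open>auto simp: visit_def u_def searching_def row_def \<beta>_def\<close>)
      thus ?thesis using small co by (simp add: neighbours_def dimsD)
    qed
    show ?thesis using True co v i un uX oX oX' deg inp_len post off_Suc[of u]
      by (simp add: expand_def dimsD u_def[symmetric] less_Suc_eq_le)
  qed
qed

definition closure_ok :: "nat \<Rightarrow> st \<Rightarrow> bool" where
  "closure_ok v \<sigma> \<longleftrightarrow> arr \<sigma> aLEN v 0 \<le> c \<and> (c < arr \<sigma> aWT v 0 \<longleftrightarrow> v \<notin> U) \<and>
    (v \<in> U \<longrightarrow> arr \<sigma> aWT v 0 = W v \<and> distinct (row \<sigma> v (arr \<sigma> aLEN v 0)) \<and> set (row \<sigma> v (arr \<sigma> aLEN v 0)) = reach v)"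

lemma closures:
  assumes co: "dims \<sigma>" and z: "\<And>y. arr \<sigma> aMARK y 0 = 0"
  shows "wp closures (\<lambda>\<tau>. \<forall>v<n. closure_ok v \<tau>) \<sigma>"
  unfolding closures_def
proof (rule wp_Loop[where I = "\<lambda>v \<tau>. (\<forall>y. arr \<tau> aMARK y 0 \<le> v) \<and> (\<forall>v'<v. closure_ok v' \<tau>)"], goal_cases)
  case (8 v \<tau>)
  note I = 8(5) and sm = 8(4)
  have v: "v < n" "var \<tau> vv = v" using 8 co by (auto simp: dimsD)
  have co': "dims \<tau>" using dims_same[OF sm] co by (simp add: expand_def neighbours_def visit_def)
  let ?s = "set_var vsum (s v) (set_var vlen 1 (set_arr aMARK v 0 (Suc v) (set_arr aRL v 0 v \<tau>)))"
  have "(\<lambda>y. ((arr \<tau> aMARK)(v := (arr \<tau> aMARK v)(0 := Suc v))) y 0) = (\<lambda>y. arr \<tau> aMARK y 0)(v := Suc v)" by auto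
  hence init: "searching v 0 ?s"
    using search_init[OF v(1), of "\<lambda>y. arr \<tau> aMARK y 0"] I by (simp add: searching_def row_def)
  have "wp (For vi vc expand) (\<lambda>\<tau>'. searching v c \<tau>' \<and> var \<tau>' vv = v \<and>
      (\<forall>v'. v' \<noteq> v \<longrightarrow> arr \<tau>' aRL v' = arr \<tau> aRL v') \<and> arr \<tau>' aLEN = arr \<tau> aLEN \<and> arr \<tau>' aWT = arr \<tau> aWT) ?s"
  proof (rule wp_Loop[where I = "\<lambda>i \<tau>'. searching v i \<tau>' \<and> (\<forall>v'. v' \<noteq> v \<longrightarrow> arr \<tau>' aRL v' = arr \<tau> aRL v')"], goal_cases)
    case (8 i \<tau>')
    have "dims \<tau>'" "var \<tau>' vv = v"
      using dims_same[OF 8(4)] same_var[OF 8(4)] co' v by (simp_all add: expand_def neighbours_def visit_def)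
    thus ?case using 8 v(1) co'
      by (intro wp_mono[OF expand[of \<tau>' v i]]) (auto simp: searching_def row_def dimsD)
  next
    case (9 \<tau>')
    thus ?case using co' v same_var[OF 9(1), of vv] same_arr[OF 9(1), of aLEN] same_arr[OF 9(1), of aWT]
      by (simp add: dimsD expand_def neighbours_def visit_def)
  qed (use init co' in \<open>auto simp: expand_def neighbours_def visit_def dimsD \<beta>_def searching_def row_def\<close>)
  moreover have "closure_ok v (set_arr aWT v 0 (var \<tau>' vsum) (set_arr aLEN v 0 (var \<tau>' vlen) \<tau>')) \<and>
      var \<tau>' vlen \<le> X \<and> var \<tau>' vsum \<le> X \<and> (\<forall>y. arr \<tau>' aMARK y 0 \<le> Suc v)"
    if "searching v c \<tau>'" for \<tau>'
  proof -
    let ?L = "row \<tau>' v (var \<tau>' vlen)"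
    have se: "search v c ?L (var \<tau>' vsum) (\<lambda>y. arr \<tau>' aMARK y 0)" using that by (simp add: searching_def)
    have "c < var \<tau>' vsum \<longleftrightarrow> v \<notin> U"
    proof (cases "var \<tau>' vsum \<le> c")
      case True
      thus ?thesis using search_final(2)[OF se v(1) True] v(1) by (simp add: U_def)
    next
      case False
      thus ?thesis using se by (simp add: search_def U_def)
    qed
    moreover have "var \<tau>' vlen \<le> c" "distinct ?L" "\<forall>y. arr \<tau>' aMARK y 0 \<le> Suc v" "var \<tau>' vsum \<le> X"
      using se by (simp_all add: search_def)
    moreover have "row (set_arr aWT v 0 (var \<tau>' vsum) (set_arr aLEN v 0 (var \<tau>' vlen) \<tau>')) v l = row \<tau>' v l" for l
      by (simp add: row_def)
    ultimately show ?thesis using search_final[OF se v(1)] c_le_X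
      by (cases "var \<tau>' vsum \<le> c") (simp_all add: closure_ok_def)
  qed
  ultimately have *: "wp (For vi vc expand) (\<lambda>\<tau>'. var \<tau>' vv = v \<and>
      (\<forall>v'. v' \<noteq> v \<longrightarrow> arr \<tau>' aRL v' = arr \<tau> aRL v') \<and> arr \<tau>' aLEN = arr \<tau> aLEN \<and> arr \<tau>' aWT = arr \<tau> aWT \<and>
      closure_ok v (set_arr aWT v 0 (var \<tau>' vsum) (set_arr aLEN v 0 (var \<tau>' vlen) \<tau>')) \<and>
      var \<tau>' vlen \<le> X \<and> var \<tau>' vsum \<le> X \<and> (\<forall>y. arr \<tau>' aMARK y 0 \<le> Suc v)) ?s"
    by (elim wp_mono) blast
  have "v \<le> X" "Suc v \<le> X" "s v \<le> X" "1 \<le> X" using n_le_X v(1) s_le_X[OF v(1)] by auto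
  hence "wp (Sq (For vi vc expand) (Sq (Put1 aLEN (V vv) (V vlen)) (Put1 aWT (V vv) (V vsum))))
     (\<lambda>\<tau>'. (\<forall>y. arr \<tau>' aMARK y 0 \<le> Suc v) \<and> (\<forall>v'<Suc v. closure_ok v' \<tau>')) ?s"
    using v(1) I unfolding wp_simps(5)
    by (intro wp_mono[OF *]) (auto simp: closure_ok_def row_def less_Suc_eq)
  thus ?case using v co' n_le_X s_le_X[OF v(1)] inp_len
    by (simp add: closure_ok_def row_def wp_def)
qed (use co z in \<open>auto simp: expand_def neighbours_def visit_def dimsD \<beta>_def\<close>)

end

context ssg
begin

section \<open>Ranks and representatives\<close>

definition rank_ok :: "nat \<Rightarrow> st \<Rightarrow> bool" where
  "rank_ok v \<sigma> \<longleftrightarrow> (v \<in> U \<longrightarrow> arr \<sigma> aDD v 0 = d v \<and> arr \<sigma> aCUR v 0 = rep v \<and> arr \<sigma> aREP v 0 = rep v \<and>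
      (\<forall>t. arr \<sigma> aTB v t \<noteq> 0 \<longleftrightarrow> t = 0 \<or> t = W v - d v)) \<and>
    (v \<notin> U \<longrightarrow> arr \<sigma> aDD v 0 = Suc c)"

lemma U_lt: "v \<in> U \<Longrightarrow> v < n" by (simp add: U_def)

lemma closure_ok_cong: "arr \<tau> aRL = arr \<sigma> aRL \<Longrightarrow> arr \<tau> aLEN = arr \<sigma> aLEN \<Longrightarrow> arr \<tau> aWT = arr \<sigma> aWT \<Longrightarrow>
   closure_ok v \<tau> = closure_ok v \<sigma>"
  by (simp add: closure_ok_def row_def)

lemma distinct_take_Suc:
  assumes "distinct L" "i < length L"
  shows "set (take (Suc i) L) = insert (L ! i) (set (take i L))" "L ! i \<notin> set (take i L)"
proof -
  have "take (Suc i) L = take i L @ [L ! i]" using assms by (simp add: take_Suc_conv_app_nth)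
  thus "set (take (Suc i) L) = insert (L ! i) (set (take i L))" "L ! i \<notin> set (take i L)"
    using distinct_take[OF assms(1), of "Suc i"] by auto
qed

definition rank_step :: cm where
  "rank_step = Sq (Set vw (Arr aRL (V vv) (V vi)))
      (Cond (Lt (Arr1 aWT (V vw)) (Arr1 aWT (V vv)))
        (Set vd (xadd (V vd) (size_ex (V vw))))
        (When (Lt (V vw) (V vr)) (Set vr (V vw))))"

text \<open>\<open>vr\<close> starts with \<open>v\<close> itself, hence \<open>insert v\<close>: it
  is the least vertex among \<open>v\<close> and the members of its component seen so far.\<close>

definition ranked :: "nat list \<Rightarrow> nat \<Rightarrow> nat \<Rightarrow> st \<Rightarrow> bool" where
  "ranked L v i \<sigma> \<longleftrightarrow> var \<sigma> vd = sum s {w \<in> set (take i L). W w < W v} \<and> var \<sigma> vr \<le> v \<and>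
     var \<sigma> vr \<in> insert v {w \<in> set (take i L). W w = W v} \<and>
     (\<forall>w \<in> set (take i L). W w = W v \<longrightarrow> var \<sigma> vr \<le> w)"

lemma ranks_loop:
  assumes co: "dims \<sigma>" and cl: "\<And>v. v < n \<Longrightarrow> closure_ok v \<sigma>" and v: "v \<in> U" "var \<sigma> vv = v"
    and init: "var \<sigma> vlen = arr \<sigma> aLEN v 0" "var \<sigma> vd = 0" "var \<sigma> vr = v"
  shows "wp (For vi vlen rank_step) (\<lambda>\<tau>. var \<tau> vd = d v \<and> var \<tau> vr = rep v) \<sigma>"
proof -
  let ?len = "arr \<sigma> aLEN v 0"
  define L where "L = row \<sigma> v ?len"
  have vn: "v < n" by (rule U_lt[OF v(1)])
  have L: "distinct L" "set L = reach v" "length L = ?len" "?len \<le> c" and Wv: "arr \<sigma> aWT v 0 = W v"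
    using cl[OF vn] v(1) by (auto simp: closure_ok_def L_def)
  show ?thesis
  proof (rule wp_Loop[where I = "ranked L v"], goal_cases)
    case (8 i \<tau>)
    have i: "i < ?len" using 8 init by simp
    have sv: "var \<tau> vv = v" "dims \<tau>" using same_var[OF 8(4)] dims_same[OF 8(4)] v co by (simp_all add: rank_step_def)
    have sa: "arr \<tau> = arr \<sigma>" using same_arr[OF 8(4)] by (simp add: rank_step_def fun_eq_iff)
    define w where "w = L ! i"
    have wL: "arr \<sigma> aRL v i = w" using i by (simp add: w_def L_def)
    have wr: "w \<in> reach v" using i L by (metis nth_mem w_def)
    hence wU: "w \<in> U" using R_in_U v(1) by blast
    have wn: "w < n" by (rule U_lt[OF wU])
    have Ww: "arr \<sigma> aWT w 0 = W w" using cl[OF wn] wU by (simp add: closure_ok_def)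
    have tk: "set (take (Suc i) L) = insert w (set (take i L))" "w \<notin> set (take i L)"
      using distinct_take_Suc[of L i] i L by (auto simp: w_def)
    have sub: "insert w {x \<in> set (take i L). W x < W v} \<subseteq> reach v"
      using wr L(2) set_take_subset[of i L] by blast
    have dW: "s w + sum s {x \<in> set (take i L). W x < W v} \<le> W v"
    proof -
      have "s w + sum s {x \<in> set (take i L). W x < W v} = sum s (insert w {x \<in> set (take i L). W x < W v})"
        using tk by simp
      also have "\<dots> \<le> sum s (reach v)" by (rule sum_mono2[OF finite_reach[OF vn] sub]) simp
      also have "\<dots> = W v" by (simp add: W_def)
      finally show ?thesis .
    qed
    have WX: "W v \<le> X" using v(1) c_le_X by (simp add: U_def)
    have wX: "w \<le> X" using wn n_le_X by simp
    have Wle: "W w \<le> W v" using W_mono[OF vn wr] .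
    have e1: "{x. (x = w \<or> x \<in> set (take i L)) \<and> W x < W v} = insert w {x \<in> set (take i L). W x < W v}" if "W w < W v"
      using that by auto
    have e2: "{x. (x = w \<or> x \<in> set (take i L)) \<and> W x < W v} = {x \<in> set (take i L). W x < W v}" if "\<not> W w < W v"
      using that by auto
    show ?case
    proof (cases "W w < W v")
      case True
      thus ?thesis using 8(3,5) sv sa wL Ww Wv wn vn i L(4) inp_len wX tk(2) dW WX e1
        by (auto simp: rank_step_def ranked_def tk(1) add.commute)
    next
      case False
      thus ?thesis using 8(3,5) sv sa wL Ww Wv wn vn i L(4) inp_len wX Wle e2
        by (auto simp: rank_step_def ranked_def tk(1))
    qed
  next
    case (9 \<tau>)
    have tk: "take (max (ev inp (N 0) \<sigma>) (var \<sigma> vlen)) L = L" using L init by simp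
    have I: "var \<tau> vd = sum s {w \<in> reach v. W w < W v}" "var \<tau> vr \<in> insert v {w \<in> reach v. W w = W v}"
      "\<forall>w \<in> reach v. W w = W v \<longrightarrow> var \<tau> vr \<le> w"
      using 9(2) unfolding ranked_def tk L(2) by auto
    have "rep v = var \<tau> vr" unfolding rep_def
      by (rule Min_eqI) (use I finite_reach[OF vn] reach_refl in auto)
    thus ?case using I(1) D_W[OF v(1)] by (simp add: d_def)
  qed (use L init in \<open>auto simp: rank_step_def \<beta>_def ranked_def\<close>)
qed

lemma ranks:
  assumes co: "dims \<sigma>" and cl: "\<And>v. v < n \<Longrightarrow> closure_ok v \<sigma>" and z: "\<And>v t. arr \<sigma> aTB v t = 0"
  shows "wp ranks (\<lambda>\<tau>. (\<forall>v<n. rank_ok v \<tau>) \<and> (\<forall>v\<ge>n. \<forall>t. arr \<tau> aTB v t = 0)) \<sigma>"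
  unfolding ranks_def rank_step_def[symmetric]
proof (rule wp_Loop[where I = "\<lambda>v \<tau>. (\<forall>v'<v. rank_ok v' \<tau>) \<and> (\<forall>v'\<ge>v. \<forall>t. arr \<tau> aTB v' t = 0)"], goal_cases)
  case (8 v \<tau>)
  note I = 8(5) and sm = 8(4)
  have v: "v < n" "var \<tau> vv = v" using 8 co by (auto simp: dimsD)
  have co': "dims \<tau>" using dims_same[OF sm] co by (simp add: rank_step_def)
  have cl': "closure_ok v' \<tau>" if "v' < n" for v'
    using cl[OF that] closure_ok_cong[of \<tau> \<sigma>] same_arr[OF sm] by (simp add: rank_step_def)
  show ?case
  proof (cases "v \<in> U")
    case False
    hence "c < arr \<tau> aWT v 0" using cl'[OF v(1)] by (simp add: closure_ok_def)
    thus ?thesis using False v co' c_le_X I by (auto simp: dimsD rank_ok_def less_Suc_eq)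
  next
    case True
    have c1: "arr \<tau> aLEN v 0 \<le> c" "arr \<tau> aWT v 0 = W v" "W v \<le> c"
      using cl'[OF v(1)] True by (auto simp: closure_ok_def U_def)
    have X: "c \<le> X" "v \<le> X" "1 \<le> X" using c_le_X n_le_X v by auto
    let ?s = "set_var vr v (set_var vd 0 (set_var vlen (arr \<tau> aLEN v 0) \<tau>))"
    have "wp (For vi vlen rank_step) (\<lambda>\<tau>'. var \<tau>' vd = d v \<and> var \<tau>' vr = rep v) ?s"
      by (rule ranks_loop) (use co' True v cl' closure_ok_cong[of ?s \<tau>] in auto)
    hence "wp (For vi vlen rank_step) (\<lambda>\<tau>'. var \<tau>' vd = d v \<and> var \<tau>' vr = rep v \<and> var \<tau>' vv = v \<and> arr \<tau>' = arr \<tau>) ?s"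
      by (rule wp_frame) (use v in \<open>auto simp: rank_step_def same_def fun_eq_iff\<close>)
    moreover have "d v \<le> X" "rep v \<le> X" using d_le_W[OF True] c1 X rep_props(3)[OF True] U_lt n_le_X by force+
    ultimately have "wp (Sq (For vi vlen rank_step) (Sq (Put1 aDD (V vv) (V vd))
       (Sq (Put1 aCUR (V vv) (V vr)) (Sq (Put1 aREP (V vv) (V vr)) (Sq (Put1 aTB (V vv) (N 1))
         (Put aTB (V vv) (xsub (Arr1 aWT (V vv)) (V vd)) (N 1)))))))
      (\<lambda>\<tau>'. (\<forall>v'<Suc v. rank_ok v' \<tau>') \<and> (\<forall>v'\<ge>Suc v. \<forall>t. arr \<tau>' aTB v' t = 0)) ?s"
      unfolding wp_simps(5)
      by (elim wp_mono) (use v I c1 X True in \<open>auto simp: rank_ok_def less_Suc_eq\<close>)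
    thus ?thesis using c1 v X co' by (simp add: dimsD rank_ok_def)
  qed
qed (use co z in \<open>auto simp: rank_step_def dimsD \<beta>_def\<close>)

section \<open>Sorting\<close>

definition ord :: "st \<Rightarrow> nat list" where
  "ord \<sigma> = map (\<lambda>k. arr \<sigma> aORD k 0) [0..<var \<sigma> vcnt]"

text \<open>State of the bucket scan when bucket \<open>b\<close> has reached vertex
  \<open>v\<close>.\<close>

definition ordered :: "nat \<Rightarrow> nat \<Rightarrow> nat list \<Rightarrow> bool" where
  "ordered b v L \<longleftrightarrow> distinct L \<and> set L = {x \<in> U. d x < b \<or> d x = b \<and> x < v} \<and> sorted (map d L)"

lemma ordered_length: "ordered b v L \<Longrightarrow> length L \<le> n"
proof -
  assume o: "ordered b v L"
  hence "set L \<subseteq> {..<n}" using U_lt by (auto simp: ordered_def)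
  hence "card (set L) \<le> n" using card_mono[of "{..<n}"] by fastforce
  moreover have "distinct L" using o by (simp add: ordered_def)
  ultimately show ?thesis by (simp add: distinct_card)
qed

lemma ordered_snoc: assumes "ordered b v L" "v \<in> U" "d v = b" shows "ordered b (Suc v) (L @ [v])" "length L < n"
proof -
  have L: "distinct L" "set L = {x \<in> U. d x < b \<or> d x = b \<and> x < v}" "sorted (map d L)"
    using assms(1) by (simp_all add: ordered_def)
  have "{x \<in> U. d x < b \<or> d x = b \<and> x < Suc v} = insert v {x \<in> U. d x < b \<or> d x = b \<and> x < v}"
    using assms(2,3) less_Suc_eq by blast
  hence "set (L @ [v]) = {x \<in> U. d x < b \<or> d x = b \<and> x < Suc v}" using L(2) by simp
  moreover have "distinct (L @ [v])" using L(1) unfolding distinct_append L(2) using assms(3) by simp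
  moreover have "sorted (map d (L @ [v]))" unfolding map_append sorted_append
    using L(3) assms(3) unfolding set_map L(2) by auto
  ultimately show o: "ordered b (Suc v) (L @ [v])" by (simp only: ordered_def)
  show "length L < n" using ordered_length[OF o] by simp
qed

lemma ordered_skip: assumes "ordered b v L" "v \<notin> U \<or> d v \<noteq> b" shows "ordered b (Suc v) L"
proof -
  have "{x \<in> U. d x < b \<or> d x = b \<and> x < Suc v} = {x \<in> U. d x < b \<or> d x = b \<and> x < v}"
    using assms(2) by (auto simp: less_Suc_eq)
  thus ?thesis using assms(1) by (simp add: ordered_def)
qed

lemma ordered_next: assumes "ordered b n L" shows "ordered (Suc b) 0 L"
proof -
  have "{x \<in> U. d x < Suc b \<or> d x = Suc b \<and> x < 0} = {x \<in> U. d x < b \<or> d x = b \<and> x < n}"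
    using U_lt by (auto simp: less_Suc_eq)
  thus ?thesis using assms by (simp add: ordered_def)
qed

lemma ordered_all: assumes "ordered c 0 L" shows "set L = U"
  using assms d_less_c by (auto simp: ordered_def)

lemma sorting:
  assumes co: "dims \<sigma>" and rk: "\<And>v. v < n \<Longrightarrow> rank_ok v \<sigma>"
  shows "wp sorting (\<lambda>\<tau>. ordered c 0 (ord \<tau>)) \<sigma>"
proof -
  let ?body = "When (Eq (Arr1 aDD (V vv)) (V vb)) (Sq (Put1 aORD (V vcnt) (V vv)) (Set vcnt (xadd (V vcnt) (N 1))))"
  let ?s = "set_var vcnt 0 \<sigma>"
  have inner: "wp (For vv vn ?body) (\<lambda>\<tau>'. ordered (Suc b) 0 (ord \<tau>')) \<tau>"
    if co: "dims \<tau>" and dd: "arr \<tau> aDD = arr \<sigma> aDD" and b: "var \<tau> vb = b" "b < c" and o: "ordered b 0 (ord \<tau>)" for \<tau> b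
  proof (rule wp_Loop[where I = "\<lambda>v \<tau>'. ordered b v (ord \<tau>')"], goal_cases)
    case (8 v \<tau>')
    have v: "v < n" using 8(2) co by (simp add: dimsD)
    have dd': "arr \<tau>' aDD v 0 = (if v \<in> U then d v else Suc c)"
      using rk[OF v] same_arr[OF 8(4), of aDD] dd by (auto simp: rank_ok_def)
    have vb: "var \<tau>' vb = b" using same_var[OF 8(4), of vb] b by simp
    show ?case
    proof (cases "v \<in> U \<and> d v = b")
      case True
      note sn = ordered_snoc[OF 8(5) conjunct1[OF True] conjunct2[OF True]]
      have cn: "var \<tau>' vcnt < n" using sn(2) by (simp add: ord_def)
      have "ord (set_var vv (Suc v) (set_var vcnt (Suc (var \<tau>' vcnt)) (set_arr aORD (var \<tau>' vcnt) 0 v \<tau>'))) = ord \<tau>' @ [v]"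
        by (simp add: ord_def if_app cong: if_cong)
      thus ?thesis using True vb dd' sn(1) cn v n_le_X 8(3) by simp
    next
      case False
      have "ordered b (Suc v) (ord \<tau>')" by (rule ordered_skip[OF 8(5)]) (use False in blast)
      thus ?thesis using False vb dd' v b 8(3) by (auto simp: ord_def)
    qed
  next
    case (9 \<tau>')
    thus ?case using ordered_next co by (simp add: dimsD)
  qed (use co o in \<open>auto simp: dimsD \<beta>_def ord_def\<close>)
  have "wp (For vb vc (For vv vn ?body)) (\<lambda>\<tau>. ordered c 0 (ord \<tau>)) ?s"
  proof (rule wp_Loop[where I = "\<lambda>b \<tau>. ordered b 0 (ord \<tau>)"], goal_cases)
    case (8 b \<tau>)
    have "dims \<tau>" using dims_same[OF 8(4)] co by simp
    moreover have "arr \<tau> aDD = arr \<sigma> aDD" using same_arr[OF 8(4), of aDD] by simp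
    ultimately show ?case using 8 co by (intro wp_mono[OF inner[of \<tau> b]]) (auto simp: ord_def dimsD)
  next
    case (9 \<tau>)
    thus ?case using co by (simp add: dimsD)
  qed (use co in \<open>auto simp: dimsD \<beta>_def ord_def ordered_def\<close>)
  thus ?thesis by (simp add: sorting_def)
qed

end

text \<open>Afterwards \<open>vh\<close> names the new node, so repeated joins accumulate. The new
  node is alive without a write, because \<open>aDEAD\<close> is still 0 from \<open>vnd\<close>
  on.\<close>

definition join :: cm where
  "join = Sq (Put1 aLC (V vnd) (V vh)) (Sq (Put1 aRC (V vnd) (V vy)) (Sq (Put1 aTH (V vnd) (V vth))
    (Sq (Put1 aDEAD (V vh) (N 1)) (Sq (Put1 aDEAD (V vy) (N 1))
    (Sq (Set vh (V vnd)) (Set vnd (xadd (V vnd) (N 1))))))))"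

text \<open>\<open>2 * n\<close> in \<open>vh\<close> means that no piece has been met. Several
  vertices can carry the same number; the tests for a dead node and for \<open>vh\<close> itself
  filter out repetitions.\<close>

definition absorb :: cm where
  "absorb = When (Eq (Arr1 aDD (V vw)) (V vj)) (Sq (Set vy (Arr1 aCUR (V vw)))
     (When (Eq (Arr1 aDEAD (V vy)) (N 0)) (Unless (Eq (V vy) (V vh))
       (Cond (Eq (V vh) (xadd (V vn) (V vn))) (Set vh (V vy)) (Sq (Set vth (N 0)) join)))))"

text \<open>\<open>reach v\<close> is scanned twice: for uniting the pieces of the lowest elements
  of the layer, and, after the piece of \<open>v\<close> has been put on top, for giving these
  elements the new number. \<open>vb - vj\<close> is the weight of the layer.\<close>

definition merge :: cm where
  "merge = Sq (Set vh (xadd (V vn) (V vn)))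
     (Sq (For vi vlen (Sq (Set vw (Arr aRL (V vv) (V vi))) absorb))
     (Sq (Set vy (Arr1 aCUR (V vv)))
     (Sq (Set vth (xsub (V vb) (V vj)))
     (Sq join
       (For vi vlen (Sq (Set vw (Arr aRL (V vv) (V vi)))
         (When (Eq (Arr1 aDD (V vw)) (V vj)) (Put1 aCUR (V vw) (V vh)))))))))"

text \<open>Computes the weight of \<open>K v j\<close>, to be compared with \<open>j\<close>. With
  order of \<open>c\<close> steps for up to \<open>n\<close> vertices and \<open>c\<close> values of
  \<open>j\<close>, this test stays within the total time bound.\<close>

definition split_test :: cm where
  "split_test = Sq (Set vsum (N 0)) (For vi vlen (Sq (Set vw (Arr aRL (V vv) (V vi)))
     (When (Lt (Arr1 aDD (V vw)) (V vj)) (Set vsum (xadd (V vsum) (size_ex (V vw)))))))"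

definition merge_step :: cm where
  "merge_step = Sq (Set vv (Arr1 aORD (V vk)))
     (When (Eq (Arr1 aDEAD (Arr1 aCUR (V vv))) (N 0))
       (Sq (Set vb (Arr1 aDD (V vv)))
       (Sq (Set vlen (Arr1 aLEN (V vv)))
       (Sq split_test
         (When (Eq (V vsum) (V vj)) (When (Lt (V vj) (V vb)) merge))))))"

text \<open>\<open>vj\<close> descends from \<open>c - 1\<close> to 0; this reaches all context
  weights, since \<open>cx v < d v < c\<close> whenever \<open>d v\<close> is positive.\<close>

definition merging :: cm where
  "merging = Sq (Set vnd (V vn)) (For vjj vc (Sq (Set vj (xsub (V vc) (xadd (V vjj) (N 1)))) (For vk vcnt merge_step)))"

text \<open>After the merging, the live numbers are those of the vertices with
  \<open>d v = 0\<close>, so \<open>absorb\<close> with \<open>vj = 0\<close> unites all remaining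
  pieces.\<close>

definition rooting :: cm where
  "rooting = Sq (Set vj (N 0)) (Sq (Set vh (xadd (V vn) (V vn))) (For vw vn absorb))"

context machine
begin

lemma wp_SetI: "ev inp e \<sigma> = x \<Longrightarrow> okx e \<sigma> \<Longrightarrow> x \<le> X \<Longrightarrow> wp p Q (set_var r x \<sigma>) \<Longrightarrow> wp (Sq (Set r e) p) Q \<sigma>"
  by simp
lemma wp_SqI: "wp p (wp q Q) \<sigma> \<Longrightarrow> wp (Sq p q) Q \<sigma>"
  by simp

end

context ssg
begin

section \<open>Merging modules\<close>

text \<open>Facts settled before the merging starts; the later phases write none of the arrays and
  variables mentioned here.\<close>

definition stat :: "nat list \<Rightarrow> st \<Rightarrow> bool" where
  "stat L \<sigma> \<longleftrightarrow> dims \<sigma> \<and> (\<forall>v<n. closure_ok v \<sigma> \<and> arr \<sigma> aDD v 0 = (if v \<in> U then d v else Suc c)) \<and>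
     ord \<sigma> = L \<and> ordered c 0 L"

lemma stat_same:
  assumes "same vs as \<sigma> \<tau>" "stat L \<sigma>" "vs \<inter> {0, 1, 2, vcnt} = {}" "as \<inter> {aRL, aLEN, aWT, aDD, aORD} = {}"
  shows "stat L \<tau>"
proof -
  have "var \<tau> 0 = var \<sigma> 0" "var \<tau> 1 = var \<sigma> 1" "var \<tau> 2 = var \<sigma> 2" "var \<tau> vcnt = var \<sigma> vcnt"
    using assms(1,3) by (auto simp: same_def)
  moreover have "arr \<tau> aRL = arr \<sigma> aRL" "arr \<tau> aLEN = arr \<sigma> aLEN" "arr \<tau> aWT = arr \<sigma> aWT" "arr \<tau> aDD = arr \<sigma> aDD" "arr \<tau> aORD = arr \<sigma> aORD"
    using assms(1,4) by (auto simp: same_def)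
  ultimately show ?thesis using assms(2) closure_ok_cong[of \<tau> \<sigma>]
    by (simp add: stat_def dims_def ord_def)
qed

lemma statD:
  assumes "stat L \<sigma>"
  shows "dims \<sigma>" "v < n \<Longrightarrow> closure_ok v \<sigma>" "v < n \<Longrightarrow> arr \<sigma> aDD v 0 = (if v \<in> U then d v else Suc c)"
    "ord \<sigma> = L" "ordered c 0 L" "set L = U" "distinct L" "sorted (map d L)"
  using assms ordered_all[of L] by (auto simp: stat_def ordered_def)

definition alive :: "st \<Rightarrow> nat set" where
  "alive \<sigma> = {y. y < var \<sigma> vnd \<and> arr \<sigma> aDEAD y 0 = 0}"

text \<open>\<open>Nd\<close> is a ghost: the tree is stored, the vertex sets of its nodes are not.
  Nonemptiness of the children is what the correctness of the tables needs to exclude leaves without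
  a component.\<close>

definition nodes :: "st \<Rightarrow> (nat \<Rightarrow> nat set) \<Rightarrow> bool" where
  "nodes \<sigma> Nd \<longleftrightarrow> pool n (var \<sigma> vnd) (alive \<sigma>) Nd (\<lambda>i. arr \<sigma> aLC i 0) (\<lambda>i. arr \<sigma> aRC i 0) (\<lambda>i. arr \<sigma> aTH i 0) \<and>
    (\<forall>i\<ge>var \<sigma> vnd. arr \<sigma> aDEAD i 0 = 0) \<and> (\<forall>i<n. Nd i = {x \<in> U. rep x = i}) \<and>
    (\<forall>i. n \<le> i \<longrightarrow> i < var \<sigma> vnd \<longrightarrow> Nd (arr \<sigma> aLC i 0) \<noteq> {} \<and> Nd (arr \<sigma> aRC i 0) \<noteq> {}) \<and>
    (\<forall>i<var \<sigma> vnd. Nd i \<subseteq> U)"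

lemma nodes_cong:
  assumes "var \<tau> vnd = var \<sigma> vnd" "arr \<tau> aDEAD = arr \<sigma> aDEAD" "arr \<tau> aLC = arr \<sigma> aLC" "arr \<tau> aRC = arr \<sigma> aRC" "arr \<tau> aTH = arr \<sigma> aTH"
  shows "nodes \<tau> Nd = nodes \<sigma> Nd" "alive \<tau> = alive \<sigma>"
  using assms by (simp_all add: nodes_def alive_def)

lemma nodes_set_var [simp]: "r \<noteq> vnd \<Longrightarrow> nodes (set_var r x \<sigma>) Nd = nodes \<sigma> Nd" "r \<noteq> vnd \<Longrightarrow> alive (set_var r x \<sigma>) = alive \<sigma>"
  using nodes_cong[of "set_var r x \<sigma>" \<sigma>] by auto

lemma nodes_bound: "nodes \<sigma> Nd \<Longrightarrow> n \<le> var \<sigma> vnd \<and> var \<sigma> vnd \<le> 2 * n"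
  by (auto simp: nodes_def pool_def)

lemma join:
  assumes nd: "nodes \<sigma> Nd" and hy: "var \<sigma> vh \<in> alive \<sigma>" "var \<sigma> vy \<in> alive \<sigma>" "var \<sigma> vh \<noteq> var \<sigma> vy"
    and ok: "node_ok (Nd (var \<sigma> vh)) (Nd (var \<sigma> vy)) (var \<sigma> vth)" and th: "var \<sigma> vth \<le> X"
    and ne: "Nd (var \<sigma> vh) \<noteq> {}" "Nd (var \<sigma> vy) \<noteq> {}"
  shows "wp join (\<lambda>\<tau>. nodes \<tau> (Nd(var \<sigma> vnd := Nd (var \<sigma> vh) \<union> Nd (var \<sigma> vy))) \<and> var \<tau> vh = var \<sigma> vnd \<and>
    var \<tau> vnd = Suc (var \<sigma> vnd) \<and> alive \<tau> = insert (var \<sigma> vnd) (alive \<sigma> - {var \<sigma> vh, var \<sigma> vy})) \<sigma>"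
proof -
  let ?h = "var \<sigma> vh" and ?y = "var \<sigma> vy" and ?nd = "var \<sigma> vnd" and ?th = "var \<sigma> vth"
  have p: "pool n ?nd (alive \<sigma>) Nd (\<lambda>i. arr \<sigma> aLC i 0) (\<lambda>i. arr \<sigma> aRC i 0) (\<lambda>i. arr \<sigma> aTH i 0)"
    using nd by (simp add: nodes_def)
  note pj = pool_join[OF p hy ok]
  have n_nd: "n \<le> ?nd" using nodes_bound[OF nd] by simp
  define \<tau> where "\<tau> = run inp join \<sigma>"
  have \<tau>: "var \<tau> vh = ?nd" "var \<tau> vnd = Suc ?nd"
    "arr \<tau> aLC = (arr \<sigma> aLC)(?nd := (arr \<sigma> aLC ?nd)(0 := ?h))"
    "arr \<tau> aRC = (arr \<sigma> aRC)(?nd := (arr \<sigma> aRC ?nd)(0 := ?y))"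
    "arr \<tau> aTH = (arr \<sigma> aTH)(?nd := (arr \<sigma> aTH ?nd)(0 := ?th))"
    "\<And>i. arr \<tau> aDEAD i 0 = (if i = ?h \<or> i = ?y then 1 else arr \<sigma> aDEAD i 0)"
    by (auto simp: \<tau>_def join_def)
  have al: "alive \<tau> = insert ?nd (alive \<sigma> - {?h, ?y})"
    using pj(3,4) nd unfolding alive_def \<tau> by (auto simp: nodes_def less_Suc_eq)
  have "nodes \<tau> (Nd(?nd := Nd ?h \<union> Nd ?y))"
    unfolding nodes_def
  proof (intro conjI allI impI)
    show "pool n (var \<tau> vnd) (alive \<tau>) (Nd(?nd := Nd ?h \<union> Nd ?y)) (\<lambda>i. arr \<tau> aLC i 0) (\<lambda>i. arr \<tau> aRC i 0) (\<lambda>i. arr \<tau> aTH i 0)"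
      unfolding \<tau>(2) by (rule pool_cong[OF pj(1)]) (simp_all add: al \<tau>)
  next
    fix i assume "var \<tau> vnd \<le> i"
    thus "arr \<tau> aDEAD i 0 = 0" using pj(3,4) nd by (simp add: \<tau> nodes_def)
  next
    fix i assume "i < n"
    thus "(Nd(?nd := Nd ?h \<union> Nd ?y)) i = {x \<in> U. rep x = i}" using nd n_nd by (simp add: nodes_def)
  next
    fix i assume i: "n \<le> i" "i < var \<tau> vnd"
    have "arr \<sigma> aLC i 0 < i \<and> arr \<sigma> aRC i 0 < i \<and> Nd (arr \<sigma> aLC i 0) \<noteq> {} \<and> Nd (arr \<sigma> aRC i 0) \<noteq> {}" if "i \<noteq> ?nd"
      using that i nd p by (simp add: \<tau> nodes_def pool_def)
    thus "(Nd(?nd := Nd ?h \<union> Nd ?y)) (arr \<tau> aLC i 0) \<noteq> {}" "(Nd(?nd := Nd ?h \<union> Nd ?y)) (arr \<tau> aRC i 0) \<noteq> {}"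
      using pj(3,4) ne i by (auto simp: \<tau>)
  next
    fix i assume "i < var \<tau> vnd"
    thus "(Nd(?nd := Nd ?h \<union> Nd ?y)) i \<subseteq> U" using pj(3,4) nd by (auto simp: \<tau> nodes_def less_Suc_eq)
  qed
  moreover have "safe join \<sigma>"
    using pj(2-4) th n_le_X by (simp add: join_def)
  ultimately show ?thesis using al \<tau> by (simp add: wp_def \<tau>_def)
qed

definition unrelated :: "(nat \<Rightarrow> nat set) \<Rightarrow> nat \<Rightarrow> nat \<Rightarrow> bool" where
  "unrelated Nd z y \<longleftrightarrow> Nd z \<inter> Nd y = {} \<and> (\<forall>x\<in>Nd z. reach x \<inter> Nd y = {}) \<and> (\<forall>x\<in>Nd y. reach x \<inter> Nd z = {})"

lemma absorb:
  assumes co: "dims \<sigma>" and nd: "nodes \<sigma> Nd" and ab: "absorbed (2 * n) Al0 Nd0 S (var \<sigma> vh) (alive \<sigma>) Nd"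
    and Al0: "Al0 \<subseteq> {..<nd0}" "nd0 \<le> var \<sigma> vnd" and w: "var \<sigma> vw < n" "arr \<sigma> aCUR (var \<sigma> vw) 0 = y"
    and sel: "arr \<sigma> aDD (var \<sigma> vw) 0 = var \<sigma> vj \<Longrightarrow> y \<in> Al0 \<and> Nd0 y \<noteq> {} \<and> (\<forall>z\<in>S. Nd0 z \<noteq> {} \<and> (z \<noteq> y \<longrightarrow> unrelated Nd0 z y))"
  shows "wp absorb (\<lambda>\<tau>. nd0 \<le> var \<tau> vnd \<and> (\<exists>Nd'. nodes \<tau> Nd' \<and> absorbed (2 * n) Al0 Nd0
     (if arr \<sigma> aDD (var \<sigma> vw) 0 = var \<sigma> vj then insert y S else S) (var \<tau> vh) (alive \<tau>) Nd')) \<sigma>"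
proof (cases "arr \<sigma> aDD (var \<sigma> vw) 0 = var \<sigma> vj")
  case False
  thus ?thesis using assms by (auto simp: absorb_def)
next
  case True
  have y: "y \<in> Al0" "Nd0 y \<noteq> {}" and un: "\<And>z. z \<in> S \<Longrightarrow> Nd0 z \<noteq> {} \<and> (z \<noteq> y \<longrightarrow> unrelated Nd0 z y)" using sel[OF True] by auto
  have ynd: "y < var \<sigma> vnd" using y Al0 by auto
  have bd: "var \<sigma> vnd \<le> 2 * n" using nodes_bound[OF nd] by simp
  have n2: "2 * n \<notin> Al0" using Al0 bd by auto
  have yal: "y \<in> alive \<sigma> \<longleftrightarrow> arr \<sigma> aDEAD y 0 = 0" using ynd by (simp add: alive_def)
  have cn: "nodes (set_var r x \<sigma>) Nd \<longleftrightarrow> nodes \<sigma> Nd" "alive (set_var r x \<sigma>) = alive \<sigma>" if "r \<noteq> vnd" for r x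
    using that nodes_cong[of "set_var r x \<sigma>" \<sigma>] by auto
  have yX: "y \<le> X" "y \<le> 2 * n" using ynd bd n_le_X by auto
  show ?thesis
  proof (cases "y \<in> alive \<sigma> \<and> y \<noteq> var \<sigma> vh")
    case False
    have "absorbed (2 * n) Al0 Nd0 (insert y S) (var \<sigma> vh) (alive \<sigma>) Nd"
      by (rule absorbed_skip[OF ab y(1) n2]) (use False in blast)
    hence "\<exists>Nd'. nodes (set_var vy y \<sigma>) Nd' \<and> absorbed (2 * n) Al0 Nd0 (insert y S) (var \<sigma> vh) (alive (set_var vy y \<sigma>)) Nd'"
      using nd cn[of vy y] by auto
    moreover have "arr \<sigma> aDEAD y 0 \<noteq> 0 \<or> y = var \<sigma> vh" using False yal by blast
    ultimately show ?thesis using True w yX Al0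
      by (cases "arr \<sigma> aDEAD y 0 = 0") (simp_all add: absorb_def)
  next
    case new: True
    show ?thesis
    proof (cases "S = {}")
      case S: True
      hence h: "var \<sigma> vh = 2 * n" using ab by (simp add: absorbed_def)
      have "absorbed (2 * n) Al0 Nd0 {y} y (alive \<sigma>) Nd" using absorbed_first[OF ab[unfolded S] y(1)] .
      hence "\<exists>Nd'. nodes (set_var vh y (set_var vy y \<sigma>)) Nd' \<and>
          absorbed (2 * n) Al0 Nd0 {y} y (alive (set_var vh y (set_var vy y \<sigma>))) Nd'"
        using nd nodes_cong[of "set_var vh y (set_var vy y \<sigma>)" \<sigma>] by auto
      thus ?thesis using new yal True w yX Al0 h co S by (simp add: absorb_def dimsD)
    next
      case S: False
      have h: "var \<sigma> vh \<in> alive \<sigma>" and Ndh: "Nd (var \<sigma> vh) = (\<Union>y\<in>S. Nd0 y)" and Ndy: "Nd y = Nd0 y"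
        using ab S y by (auto simp: absorbed_def)
      have h2: "var \<sigma> vh \<noteq> 2 * n" using h bd by (auto simp: alive_def)
      have yS: "y \<notin> S" using ab S new by (auto simp: absorbed_def)
      have un': "unrelated Nd0 z y" if "z \<in> S" for z using un[OF that] that yS by blast
      have ok: "node_ok (Nd (var \<sigma> vh)) (Nd y) 0"
        by (rule absorbed_unrelated[OF ab S y(1)]) (use un' in \<open>unfold unrelated_def, blast+\<close>)
      let ?s = "set_var vth 0 (set_var vy y \<sigma>)"
      have cs: "nodes ?s Nd" "alive ?s = alive \<sigma>" using nd nodes_cong[of ?s \<sigma>] by auto
      have "wp join (\<lambda>\<tau>. nodes \<tau> (Nd(var ?s vnd := Nd (var ?s vh) \<union> Nd (var ?s vy))) \<and> var \<tau> vh = var ?s vnd \<and>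
          var \<tau> vnd = Suc (var ?s vnd) \<and> alive \<tau> = insert (var ?s vnd) (alive ?s - {var ?s vh, var ?s vy})) ?s"
        by (rule join[OF cs(1)]) (use h new ok un S Ndh Ndy y cs(2) in auto)
      moreover have "absorbed (2 * n) Al0 Nd0 (insert y S) (var \<sigma> vnd) (insert (var \<sigma> vnd) (alive \<sigma> - {var \<sigma> vh, y}))
          (Nd(var \<sigma> vnd := Nd (var \<sigma> vh) \<union> Nd y))"
        by (rule absorbed_more[OF ab y(1) _ _ S]) (use new Al0 in \<open>auto simp: alive_def\<close>)
      ultimately have "wp join (\<lambda>\<tau>. nd0 \<le> var \<tau> vnd \<and> (\<exists>Nd'. nodes \<tau> Nd' \<and> absorbed (2 * n) Al0 Nd0
         (insert y S) (var \<tau> vh) (alive \<tau>) Nd')) ?s"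
        using Al0(2) by (elim wp_mono) (auto simp: cs(2))
      thus ?thesis using new yal True w yX h2 co by (simp add: absorb_def dimsD)
    qed
  qed
qed

text \<open>Realises \<open>minv_step\<close> on the machine. The premise on \<open>aCUR\<close>
  makes the number \<open>vnd\<close> fresh for every vertex.\<close>

lemma merge:
  assumes st: "stat L \<sigma>" and nd: "nodes \<sigma> Nd" and cn: "\<And>x. x \<in> U \<Longrightarrow> arr \<sigma> aCUR x 0 < var \<sigma> vnd"
    and ms: "module_step U reach s j b P (\<lambda>x. arr \<sigma> aCUR x 0) (alive \<sigma>) Nd v"
    and vars: "var \<sigma> vv = v" "var \<sigma> vb = b" "var \<sigma> vj = j" "var \<sigma> vlen = arr \<sigma> aLEN v 0"
  shows "wp merge (\<lambda>\<tau>. \<exists>Nd'. nodes \<tau> Nd' \<and> module_inv U reach s j b (insert v P) (\<lambda>x. arr \<tau> aCUR x 0) (alive \<tau>) Nd' \<and>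
    (\<forall>x\<in>U. arr \<tau> aCUR x 0 < var \<tau> vnd)) \<sigma>"
proof -
  interpret ms: module_step U reach s j b P "\<lambda>x. arr \<sigma> aCUR x 0" "alive \<sigma>" Nd v by (rule ms)
  let ?cur = "\<lambda>x. arr \<sigma> aCUR x 0" and ?nd = "var \<sigma> vnd" and ?len = "arr \<sigma> aLEN v 0"
  have vU: "v \<in> U" by (rule ms.v)
  have vn: "v < n" by (rule U_lt[OF vU])
  have co: "dims \<sigma>" by (rule statD(1)[OF st])
  have cl: "closure_ok v \<sigma>" by (rule statD(2)[OF st vn])
  define M where "M = row \<sigma> v ?len"
  have M: "set M = reach v" "length M = ?len" "?len \<le> c" "distinct M" using cl vU by (auto simp: closure_ok_def M_def)
  have Mi: "arr \<sigma> aRL v i = M ! i" "M ! i \<in> reach v" "M ! i \<in> U" "M ! i < n" "M ! i \<le> X" if "i < ?len" for i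
  proof -
    show "arr \<sigma> aRL v i = M ! i" using that by (simp add: M_def)
    show "M ! i \<in> reach v" using that M by (metis nth_mem)
    thus "M ! i \<in> U" using R_in_U vU by blast
    thus "M ! i < n" by (rule U_lt)
    thus "M ! i \<le> X" using n_le_X by simp
  qed
  have DD: "arr \<sigma> aDD x 0 = d x" if "x \<in> U" for x using statD(3)[OF st U_lt[OF that]] that by simp
  have bn: "n \<le> ?nd" "?nd \<le> 2 * n" using nodes_bound[OF nd] by auto
  have Al: "alive \<sigma> \<subseteq> {..<?nd}" by (auto simp: alive_def)
  have Ms_def': "ms.Ms = {w \<in> set M. d w = j}" using M by (simp add: ms.Ms_def)
  have b_c: "b \<le> c" using d_less_c[OF vU] ms.vb by simp

  \<comment> \<open>The numbers met among the first \<open>i\<close> members of the list; lowest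
    elements of the layer may share one.\<close>
  define Sel where "Sel i = ?cur ` {w \<in> set (take i M). d w = j}" for i
  let ?s = "set_var vh (2 * n) \<sigma>"
  have loop1: "wp (For vi vlen (Sq (Set vw (Arr aRL (V vv) (V vi))) absorb))
     (\<lambda>\<tau>. ?nd \<le> var \<tau> vnd \<and> (\<exists>Nd'. nodes \<tau> Nd' \<and> absorbed (2 * n) (alive \<sigma>) Nd (?cur ` ms.Ms) (var \<tau> vh) (alive \<tau>) Nd')) ?s"
  proof (rule wp_Loop[where I = "\<lambda>i \<tau>. ?nd \<le> var \<tau> vnd \<and> (\<exists>Nd'. nodes \<tau> Nd' \<and>
       absorbed (2 * n) (alive \<sigma>) Nd (Sel i) (var \<tau> vh) (alive \<tau>) Nd')"], goal_cases)
    case (7)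
    have "nodes (set_var vi 0 ?s) Nd" "alive (set_var vi 0 ?s) = alive \<sigma>" using nd nodes_cong[of "set_var vi 0 ?s" \<sigma>] by auto
    thus ?case using absorbed_init[of "2 * n" "alive \<sigma>" Nd] by (auto simp: Sel_def)
  next
    case (8 i \<tau>)
    note sm = 8(4)
    have i: "i < ?len" using 8 vars by simp
    have sv: "var \<tau> vv = v" "var \<tau> vj = j" using same_var[OF sm] vars by (simp_all add: absorb_def join_def)
    have sa: "arr \<tau> aRL = arr \<sigma> aRL" "arr \<tau> aCUR = arr \<sigma> aCUR" "arr \<tau> aDD = arr \<sigma> aDD"
      using same_arr[OF sm] by (simp_all add: absorb_def join_def)
    have co': "dims \<tau>" using dims_same[OF sm] co by (simp add: absorb_def join_def)
    obtain Nd' where Nd': "nodes \<tau> Nd'" "absorbed (2 * n) (alive \<sigma>) Nd (Sel i) (var \<tau> vh) (alive \<tau>) Nd'" "?nd \<le> var \<tau> vnd"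
      using 8(5) by blast
    let ?w = "M ! i" let ?t = "set_var vw ?w \<tau>"
    have nt: "nodes ?t Nd'" "alive ?t = alive \<tau>" using Nd' nodes_cong[of ?t \<tau>] by auto
    have tk: "set (take (Suc i) M) = insert ?w (set (take i M))" using distinct_take_Suc(1)[of M i] M i by simp
    have sel: "?cur ?w \<in> alive \<sigma> \<and> Nd (?cur ?w) \<noteq> {} \<and>
      (\<forall>z\<in>Sel i. Nd z \<noteq> {} \<and> (z \<noteq> ?cur ?w \<longrightarrow> unrelated Nd z (?cur ?w)))" if "d ?w = j"
    proof -
      have wM: "?w \<in> ms.Ms" using that Mi(2)[OF i] by (simp add: ms.Ms_def)
      have ne: "Nd (?cur x) \<noteq> {}" if "x \<in> ms.Ms" for x using ms.minv_self[OF ms.Ms(1,4)[OF that]] by blast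
      have "unrelated Nd (?cur x) (?cur ?w)" if x: "x \<in> ms.Ms" and df: "?cur x \<noteq> ?cur ?w" for x
        unfolding unrelated_def
        using ms.minv_disj[OF ms.Ms(1)[OF x] ms.Ms(1)[OF wM] ms.Ms(4)[OF x] ms.Ms(4)[OF wM] df]
          ms.minv_unrelated[OF ms.Ms(1)[OF x] ms.Ms(1)[OF wM] ms.Ms(4)[OF x] ms.Ms(4)[OF wM] df]
          ms.minv_unrelated[OF ms.Ms(1)[OF wM] ms.Ms(1)[OF x] ms.Ms(4)[OF wM] ms.Ms(4)[OF x] df[symmetric]]
          ms.Ms(3)[OF x] ms.Ms(3)[OF wM] by simp
      moreover have "x \<in> ms.Ms" if "x \<in> set (take i M)" "d x = j" for x
        using that set_take_subset[of i M] by (auto simp: Ms_def')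
      ultimately show ?thesis using ne ms.Ms(4)[OF wM] wM unfolding Sel_def by blast
    qed
    have S': "Sel (Suc i) = (if d ?w = j then insert (?cur ?w) (Sel i) else Sel i)"
      unfolding Sel_def tk by auto
    have dw: "arr ?t aDD (var ?t vw) 0 = var ?t vj \<longleftrightarrow> d ?w = j" using DD[OF Mi(3)[OF i]] sa sv by simp
    have "wp absorb (\<lambda>\<tau>'. ?nd \<le> var \<tau>' vnd \<and> (\<exists>Nd'. nodes \<tau>' Nd' \<and> absorbed (2 * n) (alive \<sigma>) Nd
        (if arr ?t aDD (var ?t vw) 0 = var ?t vj then insert (?cur ?w) (Sel i) else Sel i) (var \<tau>' vh) (alive \<tau>') Nd')) ?t"
      by (rule absorb[OF _ nt(1) _ Al]) (use co' Nd' nt Mi[OF i] sa sel dw in auto)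
    hence "wp absorb (\<lambda>\<tau>'. ?nd \<le> var \<tau>' vnd \<and> (\<exists>Nd'. nodes \<tau>' Nd' \<and> absorbed (2 * n) (alive \<sigma>) Nd
        (Sel (Suc i)) (var \<tau>' vh) (alive \<tau>') Nd')) ?t"
      unfolding dw S' .
    hence "wp absorb (\<lambda>\<tau>'. ?nd \<le> var (set_var vi (Suc i) \<tau>') vnd \<and> (\<exists>Nd'. nodes (set_var vi (Suc i) \<tau>') Nd' \<and> absorbed (2 * n) (alive \<sigma>) Nd
        (Sel (Suc i)) (var (set_var vi (Suc i) \<tau>') vh) (alive (set_var vi (Suc i) \<tau>')) Nd')) ?t"
      by (rule wp_mono) simp
    thus ?case using 8(3) sv sa Mi[OF i] i M vn by simp
  next
    case (9 \<tau>)
    have "Sel (max (ev inp (N 0) ?s) (var ?s vlen)) = ?cur ` ms.Ms" using vars M by (simp add: Sel_def Ms_def')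
    thus ?case using 9(2) by simp
  qed (use vars M in \<open>auto simp: \<beta>_def absorb_def join_def\<close>)

  \<comment> \<open>Stated for an arbitrary continuation \<open>q\<close> together with all that
    \<open>q\<close> may assume, which separates the join from the renumbering.\<close>
  have join_part: "wp (Sq (Set vy (Arr1 aCUR (V vv))) (Sq (Set vth (xsub (V vb) (V vj))) (Sq join q))) Q \<tau>"
    if same: "same (insert vi (wv (Sq (Set vw (Arr aRL (V vv) (V vi))) absorb))) (wa (Sq (Set vw (Arr aRL (V vv) (V vi))) absorb)) ?s \<tau>"
      and I: "?nd \<le> var \<tau> vnd" "nodes \<tau> Nd1" "absorbed (2 * n) (alive \<sigma>) Nd (?cur ` ms.Ms) (var \<tau> vh) (alive \<tau>) Nd1"
      and q: "\<And>\<tau>' Nd2. \<lbrakk> nodes \<tau>' Nd2; var \<tau>' vh \<notin> alive \<sigma>; \<And>x. x \<in> U \<Longrightarrow> ?cur x \<noteq> var \<tau>' vh; var \<tau>' vh < var \<tau>' vnd; ?nd \<le> var \<tau>' vnd;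
          alive \<tau>' = alive \<sigma> - ?cur ` ms.Ms - {?cur v} \<union> {var \<tau>' vh}; Nd2 (var \<tau>' vh) = ms.X \<union> Nd (?cur v);
          \<And>y. y \<in> alive \<sigma> \<Longrightarrow> Nd2 y = Nd y; dims \<tau>'; var \<tau>' vv = v; var \<tau>' vj = j; var \<tau>' vlen = ?len; arr \<tau>' aRL = arr \<sigma> aRL; arr \<tau>' aDD = arr \<sigma> aDD; arr \<tau>' aCUR = arr \<sigma> aCUR \<rbrakk>
          \<Longrightarrow> wp q Q \<tau>'" for Nd1 q Q \<tau>
  proof -
    have sv: "var \<tau> vv = v" "var \<tau> vj = j" "var \<tau> vb = b" "var \<tau> vlen = ?len" using same_var[OF same] vars by (simp_all add: absorb_def join_def)
    have sa: "arr \<tau> aRL = arr \<sigma> aRL" "arr \<tau> aCUR = arr \<sigma> aCUR" "arr \<tau> aDD = arr \<sigma> aDD"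
      using same_arr[OF same] by (simp_all add: absorb_def join_def)
    have co': "dims \<tau>" using dims_same[OF same] co by (simp add: absorb_def join_def)
    have ne: "?cur ` ms.Ms \<noteq> {}" using ms.Ms_nonempty by simp
    have cv: "?cur v \<in> alive \<sigma> - ?cur ` ms.Ms" using ms.al ms.cur_v_notin by force
    have A: "var \<tau> vh \<in> alive \<tau>" "var \<tau> vh \<notin> alive \<sigma> - ?cur ` ms.Ms" "Nd1 (var \<tau> vh) = (\<Union>y\<in>?cur ` ms.Ms. Nd y)"
      "alive \<tau> = insert (var \<tau> vh) (alive \<sigma> - ?cur ` ms.Ms)" "\<And>y. y \<in> alive \<sigma> \<Longrightarrow> Nd1 y = Nd y"
      using I(3) ne by (auto simp: absorbed_def)
    have Xh: "Nd1 (var \<tau> vh) = ms.X" using A(3) by (simp add: ms.X_def)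
    have Nv: "Nd1 (?cur v) = Nd (?cur v)" using A(5) cv by simp
    have neX: "ms.X \<noteq> {}" "Nd (?cur v) \<noteq> {}"
      using ms.Ms_nonempty ms.minv_self[OF ms.Ms(1,4)] ms.minv_self[OF vU ms.al] unfolding ms.X_def by blast+
    let ?t = "set_var vth (b - j) (set_var vy (?cur v) \<tau>)"
    have nt: "nodes ?t Nd1" "alive ?t = alive \<tau>" using I nodes_cong[of ?t \<tau>] by auto
    have bX: "b - j \<le> X" using b_c c_le_X by simp
    have cvh: "?cur v \<noteq> var \<tau> vh" using cv A(2) by auto
    have "wp join (\<lambda>\<tau>'. nodes \<tau>' (Nd1(var ?t vnd := Nd1 (var ?t vh) \<union> Nd1 (var ?t vy))) \<and> var \<tau>' vh = var ?t vnd \<and>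
          var \<tau>' vnd = Suc (var ?t vnd) \<and> alive \<tau>' = insert (var ?t vnd) (alive ?t - {var ?t vh, var ?t vy})) ?t"
      by (rule join[OF nt(1)]) (use A Xh Nv cv cvh nt(2) neX bX ms.node_ok_v in auto)
    hence "wp join (wp q Q) ?t"
    proof (rule wp_frame)
      fix \<tau>' assume sj: "same (wv join) (wa join) ?t \<tau>'"
        and J: "nodes \<tau>' (Nd1(var ?t vnd := Nd1 (var ?t vh) \<union> Nd1 (var ?t vy))) \<and> var \<tau>' vh = var ?t vnd \<and>
          var \<tau>' vnd = Suc (var ?t vnd) \<and> alive \<tau>' = insert (var ?t vnd) (alive ?t - {var ?t vh, var ?t vy})"
      show "wp q Q \<tau>'"
      proof (rule q)
        show "nodes \<tau>' (Nd1(var ?t vnd := Nd1 (var ?t vh) \<union> Nd1 (var ?t vy)))" using J by simp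
        show "var \<tau>' vh \<notin> alive \<sigma>" using J I(1) by (auto simp: alive_def)
        show "?cur x \<noteq> var \<tau>' vh" if "x \<in> U" for x using cn[OF that] J I(1) by simp
        show "alive \<tau>' = alive \<sigma> - ?cur ` ms.Ms - {?cur v} \<union> {var \<tau>' vh}" using J nt(2) A(2,4) by auto
        show "(Nd1(var ?t vnd := Nd1 (var ?t vh) \<union> Nd1 (var ?t vy))) (var \<tau>' vh) = ms.X \<union> Nd (?cur v)" using J Xh Nv by simp
        show "(Nd1(var ?t vnd := Nd1 (var ?t vh) \<union> Nd1 (var ?t vy))) y = Nd y" if "y \<in> alive \<sigma>" for y
          using A(5)[OF that] that I(1) by (auto simp: alive_def)
        show "dims \<tau>'" using dims_same[OF sj] co' by (simp add: join_def)
        show "var \<tau>' vv = v" "var \<tau>' vj = j" "var \<tau>' vlen = ?len" using same_var[OF sj] sv by (simp_all add: join_def)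
        show "arr \<tau>' aRL = arr \<sigma> aRL" "arr \<tau>' aDD = arr \<sigma> aDD" "arr \<tau>' aCUR = arr \<sigma> aCUR" using same_arr[OF sj] sa by (simp_all add: join_def)
      qed (use J I(1) in auto)
    qed
    thus ?thesis using sv sa vn cn[OF vU] bn n_le_X bX by simp
  qed

  have loop2: "wp (For vi vlen (Sq (Set vw (Arr aRL (V vv) (V vi))) (When (Eq (Arr1 aDD (V vw)) (V vj)) (Put1 aCUR (V vw) (V vh)))))
      (\<lambda>\<tau>'. \<exists>Nd'. nodes \<tau>' Nd' \<and> module_inv U reach s j b (insert v P) (\<lambda>x. arr \<tau>' aCUR x 0) (alive \<tau>') Nd' \<and>
    (\<forall>x\<in>U. arr \<tau>' aCUR x 0 < var \<tau>' vnd)) \<tau>"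
    if nd2: "nodes \<tau> Nd2" "var \<tau> vh \<notin> alive \<sigma>" "\<And>x. x \<in> U \<Longrightarrow> ?cur x \<noteq> var \<tau> vh" "var \<tau> vh < var \<tau> vnd" "?nd \<le> var \<tau> vnd"
          "alive \<tau> = alive \<sigma> - ?cur ` ms.Ms - {?cur v} \<union> {var \<tau> vh}" "Nd2 (var \<tau> vh) = ms.X \<union> Nd (?cur v)"
          "\<And>y. y \<in> alive \<sigma> \<Longrightarrow> Nd2 y = Nd y" and c2: "dims \<tau>" "var \<tau> vv = v" "var \<tau> vj = j" "var \<tau> vlen = ?len" "arr \<tau> aRL = arr \<sigma> aRL" "arr \<tau> aDD = arr \<sigma> aDD" "arr \<tau> aCUR = arr \<sigma> aCUR" for \<tau> Nd2
  proof (rule wp_Loop[where I = "\<lambda>i \<tau>'. \<forall>x. arr \<tau>' aCUR x 0 = (if x \<in> set (take i M) \<and> d x = j then var \<tau> vh else ?cur x)"], goal_cases)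
    case (8 i \<tau>')
    have i: "i < ?len" using 8 c2 by simp
    have sv: "var \<tau>' vv = v" "var \<tau>' vj = j" "var \<tau>' vh = var \<tau> vh" using same_var[OF 8(4)] c2 by simp_all
    have sa: "arr \<tau>' aRL = arr \<sigma> aRL" "arr \<tau>' aDD = arr \<sigma> aDD" using same_arr[OF 8(4)] c2 by simp_all
    have tk: "set (take (Suc i) M) = insert (M ! i) (set (take i M))" using distinct_take_Suc(1)[of M i] M i by simp
    have hX: "var \<tau> vh \<le> X" using nd2(4) nodes_bound[OF nd2(1)] n_le_X by simp
    show ?case using 8(3,5) sv sa Mi[OF i] i M(3) vn tk DD[OF Mi(3)[OF i]] hX by auto
  next
    case (9 \<tau>')
    have cur: "arr \<tau>' aCUR x 0 = (if x \<in> ms.Ms then var \<tau> vh else ?cur x)" for x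
      using 9(2) c2 M by (simp add: Ms_def')
    have nt: "nodes \<tau>' Nd2" "alive \<tau>' = alive \<tau>" "var \<tau>' vnd = var \<tau> vnd"
      using nodes_cong[of \<tau>' \<tau>] nd2(1) same_var[OF 9(1)] same_arr[OF 9(1)] by simp_all
    have "module_inv U reach s j b (insert v P) (\<lambda>x. arr \<tau>' aCUR x 0) (alive \<tau>) Nd2"
      by (rule ms.minv_step[OF nd2(2,3,6) cur nd2(7,8)])
    moreover have "arr \<tau>' aCUR x 0 < var \<tau>' vnd" if "x \<in> U" for x
      using cur[of x] cn[OF that] nd2(4,5) nt(3) by simp
    ultimately show ?case using nt by auto
  qed (use c2 M in \<open>auto simp: \<beta>_def\<close>)

  have "wp (For vi vlen (Sq (Set vw (Arr aRL (V vv) (V vi))) absorb)) (wp (Sq (Set vy (Arr1 aCUR (V vv))) (Sq (Set vth (xsub (V vb) (V vj)))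
     (Sq join (For vi vlen (Sq (Set vw (Arr aRL (V vv) (V vi)))
         (When (Eq (Arr1 aDD (V vw)) (V vj)) (Put1 aCUR (V vw) (V vh)))))))) 
     (\<lambda>\<tau>'. \<exists>Nd'. nodes \<tau>' Nd' \<and> module_inv U reach s j b (insert v P) (\<lambda>x. arr \<tau>' aCUR x 0) (alive \<tau>') Nd' \<and>
    (\<forall>x\<in>U. arr \<tau>' aCUR x 0 < var \<tau>' vnd))) ?s"
  proof (rule wp_frame[OF loop1])
    fix \<tau> assume sm: "same (wv (For vi vlen (Sq (Set vw (Arr aRL (V vv) (V vi))) absorb))) (wa (For vi vlen (Sq (Set vw (Arr aRL (V vv) (V vi))) absorb))) ?s \<tau>"
      and "?nd \<le> var \<tau> vnd \<and> (\<exists>Nd'. nodes \<tau> Nd' \<and> absorbed (2 * n) (alive \<sigma>) Nd (?cur ` ms.Ms) (var \<tau> vh) (alive \<tau>) Nd')"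
    then obtain Nd1 where I: "?nd \<le> var \<tau> vnd" "nodes \<tau> Nd1" "absorbed (2 * n) (alive \<sigma>) Nd (?cur ` ms.Ms) (var \<tau> vh) (alive \<tau>) Nd1" by blast
    have sm': "same (insert vi (wv (Sq (Set vw (Arr aRL (V vv) (V vi))) absorb))) (wa (Sq (Set vw (Arr aRL (V vv) (V vi))) absorb)) ?s \<tau>"
      using sm by (simp only: wv.simps(7) wa.simps(7))
    show "wp (Sq (Set vy (Arr1 aCUR (V vv))) (Sq (Set vth (xsub (V vb) (V vj)))
     (Sq join (For vi vlen (Sq (Set vw (Arr aRL (V vv) (V vi)))
         (When (Eq (Arr1 aDD (V vw)) (V vj)) (Put1 aCUR (V vw) (V vh)))))))) 
     (\<lambda>\<tau>'. \<exists>Nd'. nodes \<tau>' Nd' \<and> module_inv U reach s j b (insert v P) (\<lambda>x. arr \<tau>' aCUR x 0) (alive \<tau>') Nd' \<and>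
    (\<forall>x\<in>U. arr \<tau>' aCUR x 0 < var \<tau>' vnd)) \<tau>"
    proof (rule join_part[OF sm' I], goal_cases)
      case (1 \<tau>' Nd2)
      show ?case by (rule loop2[OF 1])
    qed
  qed
  from wp_SqI[OF this] show ?thesis
    unfolding merge_def by (rule wp_SetI[rotated 3]) (use co n_le_X in \<open>simp_all add: dimsD\<close>)
qed

text \<open>All context weights above \<open>j\<close> are dealt with, and context weight \<open>j\<close> for the vertices in \<open>P\<close>.\<close>

definition merged :: "nat \<Rightarrow> nat set \<Rightarrow> st \<Rightarrow> bool" where
  "merged j P \<sigma> \<longleftrightarrow> (\<exists>Nd b. nodes \<sigma> Nd \<and> module_inv U reach s j b P (\<lambda>x. arr \<sigma> aCUR x 0) (alive \<sigma>) Nd \<and>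
     (\<forall>x\<in>U. arr \<sigma> aCUR x 0 < var \<sigma> vnd) \<and> (\<forall>x\<in>U. x \<notin> P \<longrightarrow> b \<le> d x))"

lemma merged_set_var [simp]: "r \<noteq> vnd \<Longrightarrow> merged j P (set_var r x \<sigma>) = merged j P \<sigma>"
  by (simp add: merged_def)

lemma split_test:
  assumes st: "stat L \<sigma>" and v: "v \<in> U" "var \<sigma> vv = v" "var \<sigma> vlen = arr \<sigma> aLEN v 0"
  shows "wp split_test (\<lambda>\<tau>. var \<tau> vsum = sum s (K v (var \<sigma> vj))) \<sigma>"
proof -
  let ?len = "arr \<sigma> aLEN v 0"
  have vn: "v < n" by (rule U_lt[OF v(1)])
  have co: "dims \<sigma>" by (rule statD(1)[OF st])
  have cl: "closure_ok v \<sigma>" by (rule statD(2)[OF st vn])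
  define M where "M = row \<sigma> v ?len"
  have M: "set M = reach v" "length M = ?len" "?len \<le> c" "distinct M" using cl v(1) by (auto simp: closure_ok_def M_def)
  let ?j = "var \<sigma> vj" and ?body = "Sq (Set vw (Arr aRL (V vv) (V vi)))
     (When (Lt (Arr1 aDD (V vw)) (V vj)) (Set vsum (xadd (V vsum) (size_ex (V vw)))))"
  have "wp (For vi vlen ?body) (\<lambda>\<tau>. var \<tau> vsum = sum s (K v ?j)) (set_var vsum 0 \<sigma>)"
  proof (rule wp_Loop[where I = "\<lambda>i \<tau>. var \<tau> vsum = sum s {w \<in> set (take i M). d w < ?j}"], goal_cases)
    case (8 i \<tau>)
    have i: "i < ?len" using 8 v by simp
    let ?w = "M ! i"
    have wR: "?w \<in> reach v" using i M by (metis nth_mem)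
    have wU: "?w \<in> U" using R_in_U[OF v(1) wR] .
    have wn: "?w < n" by (rule U_lt[OF wU])
    have sv: "var \<tau> vv = v" "var \<tau> vj = ?j" using same_var[OF 8(4)] v by simp_all
    have sa: "arr \<tau> = arr \<sigma>" using same_arr[OF 8(4)] by (simp add: fun_eq_iff)
    have co': "dims \<tau>" using dims_same[OF 8(4)] co by simp
    have dw: "arr \<sigma> aDD ?w 0 = d ?w" using statD(3)[OF st wn] wU by simp
    have wv: "arr \<sigma> aRL v i = ?w" using i by (simp add: M_def)
    have tk1: "set (take (Suc i) M) = insert ?w (set (take i M))" "?w \<notin> set (take i M)"
      using distinct_take_Suc[of M i] M i by auto
    have e1: "{x. (x = ?w \<or> x \<in> set (take i M)) \<and> d x < ?j} = insert ?w {x \<in> set (take i M). d x < ?j}" if "d ?w < ?j"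
      using that by auto
    have e2: "{x. (x = ?w \<or> x \<in> set (take i M)) \<and> d x < ?j} = {x \<in> set (take i M). d x < ?j}" if "\<not> d ?w < ?j"
      using that by auto
    have "s ?w + sum s {x \<in> set (take i M). d x < ?j} = sum s (insert ?w {x \<in> set (take i M). d x < ?j})"
      using tk1 by simp
    also have "\<dots> \<le> sum s (reach v)"
      using wR M(1) set_take_subset[of i M] finite_reach[OF vn] by (intro sum_mono2) auto
    also have "\<dots> \<le> c" using v(1) by (simp add: U_def W_def)
    finally have le: "sum s {x \<in> set (take i M). d x < ?j} + s ?w \<le> X" using c_le_X by simp
    have wX: "?w \<le> X" using wn n_le_X by simp
    show ?case
    proof (cases "d ?w < ?j")
      case True
      thus ?thesis using 8(3,5) sv sa wv wn vn i M(3) inp_len wX le dw tk1(2) e1[OF True]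
        by (simp add: tk1(1) add.commute)
    next
      case False
      thus ?thesis using 8(3,5) sv sa wv wn vn i M(3) inp_len wX dw e2[OF False]
        by (simp add: tk1(1))
    qed
  next
    case (9 \<tau>)
    thus ?case using v M by (simp add: K_def)
  qed (use v M in \<open>auto simp: \<beta>_def\<close>)
  thus ?thesis unfolding split_test_def by (intro wp_SetI[of _ _ 0]) auto
qed

lemma merge_step:
  assumes st: "stat L \<sigma>" and k: "k < length L" "var \<sigma> vk = k" and mg: "merged j (set (take k L)) \<sigma>" and j: "var \<sigma> vj = j"
  shows "wp merge_step (merged j (set (take (Suc k) L))) \<sigma>"
proof -
  define v where "v = L ! k"
  have L: "set L = U" "distinct L" "sorted (map d L)" using statD[OF st] by auto
  have vU: "v \<in> U" using k L by (metis nth_mem v_def)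
  have vn: "v < n" by (rule U_lt[OF vU])
  have co: "dims \<sigma>" by (rule statD(1)[OF st])
  have kn: "k < n" using ordered_length[OF statD(5)[OF st]] k by simp
  have ord: "arr \<sigma> aORD k 0 = v" using statD(4)[OF st] k unfolding v_def ord_def by auto
  have tk: "set (take (Suc k) L) = insert v (set (take k L))" "v \<notin> set (take k L)"
    using distinct_take_Suc[OF L(2) k(1)] by (auto simp: v_def)
  obtain Nd b where I: "nodes \<sigma> Nd" "module_inv U reach s j b (set (take k L)) (\<lambda>x. arr \<sigma> aCUR x 0) (alive \<sigma>) Nd"
    "\<And>x. x \<in> U \<Longrightarrow> arr \<sigma> aCUR x 0 < var \<sigma> vnd" "\<And>x. x \<in> U \<Longrightarrow> x \<notin> set (take k L) \<Longrightarrow> b \<le> d x"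
    using mg unfolding merged_def by blast
  \<comment> \<open>The vertices not yet treated have \<open>d\<close> at least \<open>b\<close>, so
    the bound may be raised to \<open>d v\<close> before \<open>v\<close> is treated.\<close>
  have bv: "b \<le> d v" using I(4)[OF vU tk(2)] .
  have inv: "module_inv U reach s j (d v) (set (take k L)) (\<lambda>x. arr \<sigma> aCUR x 0) (alive \<sigma>) Nd"
    by (rule module_inv_mono_b[OF I(2) bv])
  have below: "x \<in> set (take k L)" if x: "x \<in> U" "d x < d v" for x
  proof -
    obtain i where i: "i < length L" "L ! i = x" using x L by (metis in_set_conv_nth)
    have "i < k"
    proof (rule ccontr)
      assume "\<not> i < k"
      hence "map d L ! k \<le> map d L ! i" using L(3) i by (intro sorted_nth_mono) auto
      thus False using x i k by (simp add: v_def)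
    qed
    thus ?thesis using i k by (metis in_set_conv_nth length_take min_less_iff_conj nth_take)
  qed
  have above: "d v \<le> d x" if "x \<in> U" "x \<notin> set (take (Suc k) L)" for x
    using below[OF that(1)] that(2) tk(1) by (metis insert_iff leI)
  have bd: "n \<le> var \<sigma> vnd" "var \<sigma> vnd \<le> 2 * n" using nodes_bound[OF I(1)] by auto
  have curb: "arr \<sigma> aCUR v 0 < var \<sigma> vnd" by (rule I(3)[OF vU])
  have cural: "arr \<sigma> aCUR v 0 \<in> alive \<sigma> \<longleftrightarrow> arr \<sigma> aDEAD (arr \<sigma> aCUR v 0) 0 = 0" using curb by (simp add: alive_def)
  have skip: "merged j (set (take (Suc k) L)) \<tau>"
    if "nodes \<tau> Nd" "alive \<tau> = alive \<sigma>" "arr \<tau> aCUR = arr \<sigma> aCUR" "var \<tau> vnd = var \<sigma> vnd"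
      "arr \<sigma> aCUR v 0 \<notin> alive \<sigma> \<or> \<not> split v j" for \<tau>
    unfolding merged_def tk(1)
    by (rule exI[of _ Nd], rule exI[of _ "d v"])
      (use that module_inv_skip[OF inv that(5)] I(3) above tk(1) in auto)
  have vX: "v \<le> X" using vn n_le_X by simp
  show ?thesis
  proof (cases "arr \<sigma> aCUR v 0 \<in> alive \<sigma>")
    case False
    have "merged j (set (take (Suc k) L)) (set_var vv v \<sigma>)" by (rule skip) (use I False in auto)
    thus ?thesis using False cural ord k kn vX curb bd vn by (simp add: merge_step_def)
  next
    case True
    let ?s = "set_var vlen (arr \<sigma> aLEN v 0) (set_var vb (d v) (set_var vv v \<sigma>))"
    have cl: "arr \<sigma> aLEN v 0 \<le> c" using statD(2)[OF st vn] by (simp add: closure_ok_def)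
    have DD: "arr \<sigma> aDD v 0 = d v" using statD(3)[OF st vn] vU by simp
    have st': "stat L ?s" by (rule stat_same[of "{vlen, vb, vv}" "{}" \<sigma>]) (use st in \<open>auto simp: same_def\<close>)
    have "wp split_test (\<lambda>\<tau>. var \<tau> vsum = sum s (K v (var ?s vj))) ?s"
      by (rule split_test[OF st' vU]) simp_all
    hence test: "wp split_test (wp (When (Eq (V vsum) (V vj)) (When (Lt (V vj) (V vb)) merge)) (merged j (set (take (Suc k) L)))) ?s"
    proof (rule wp_frame)
      fix \<tau> assume sm: "same (wv split_test) (wa split_test) ?s \<tau>" and sum: "var \<tau> vsum = sum s (K v (var ?s vj))"
      have sv: "var \<tau> vv = v" "var \<tau> vj = j" "var \<tau> vb = d v" "var \<tau> vlen = arr \<sigma> aLEN v 0" "var \<tau> vnd = var \<sigma> vnd"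
        using same_var[OF sm] j by (simp_all add: split_test_def)
      have sa: "arr \<tau> = arr \<sigma>" using same_arr[OF sm] by (simp add: split_test_def fun_eq_iff)
      have nt: "nodes \<tau> Nd" "alive \<tau> = alive \<sigma>" using nodes_cong[of \<tau> \<sigma>] sv sa I(1) by auto
      have st2: "stat L \<tau>" by (rule stat_same[OF sm st']) (auto simp: split_test_def)
      show "wp (When (Eq (V vsum) (V vj)) (When (Lt (V vj) (V vb)) merge)) (merged j (set (take (Suc k) L))) \<tau>"
      proof (cases "split v j")
        case False
        have "merged j (set (take (Suc k) L)) \<tau>" by (rule skip) (use nt sv sa False in auto)
        thus ?thesis using False sum sv j by (auto simp: split_def)
      next
        case sp: True
        have ms: "module_step U reach s j (d v) (set (take k L)) (\<lambda>x. arr \<tau> aCUR x 0) (alive \<tau>) Nd v"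
          unfolding module_step_def module_step_axioms_def nt(2) sa
          using inv below vU True sp by blast
        have "wp merge (\<lambda>\<tau>'. \<exists>Nd'. nodes \<tau>' Nd' \<and> module_inv U reach s j (d v) (insert v (set (take k L))) (\<lambda>x. arr \<tau>' aCUR x 0) (alive \<tau>') Nd' \<and>
            (\<forall>x\<in>U. arr \<tau>' aCUR x 0 < var \<tau>' vnd)) \<tau>"
          by (rule merge[OF st2 nt(1) _ ms]) (use I(3) sv sa in auto)
        hence "wp merge (merged j (set (take (Suc k) L))) \<tau>"
        proof (rule wp_mono)
          fix \<tau>' assume "\<exists>Nd'. nodes \<tau>' Nd' \<and> module_inv U reach s j (d v) (insert v (set (take k L))) (\<lambda>x. arr \<tau>' aCUR x 0) (alive \<tau>') Nd' \<and>
            (\<forall>x\<in>U. arr \<tau>' aCUR x 0 < var \<tau>' vnd)"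
          thus "merged j (set (take (Suc k) L)) \<tau>'"
            unfolding merged_def tk(1)[symmetric] using above by blast
        qed
        thus ?thesis using sp sum sv j by (simp add: split_def)
      qed
    qed
    have dX: "d v \<le> X" "arr \<sigma> aLEN v 0 \<le> X" using d_less_c[OF vU] cl c_le_X by auto
    have "wp (Sq (Set vb (Arr1 aDD (V vv))) (Sq (Set vlen (Arr1 aLEN (V vv)))
       (Sq split_test (When (Eq (V vsum) (V vj)) (When (Lt (V vj) (V vb)) merge))))) (merged j (set (take (Suc k) L))) (set_var vv v \<sigma>)"
      by (rule wp_SetI[of _ _ "d v"], use vn DD dX in \<open>simp_all del: wp_simps\<close>,
        rule wp_SetI[of _ _ "arr \<sigma> aLEN v 0"], use vn dX wp_SqI[OF test] in \<open>simp_all del: wp_simps\<close>)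
    hence "wp (When (Eq (Arr1 aDEAD (Arr1 aCUR (V vv))) (N 0)) (Sq (Set vb (Arr1 aDD (V vv))) (Sq (Set vlen (Arr1 aLEN (V vv)))
       (Sq split_test (When (Eq (V vsum) (V vj)) (When (Lt (V vj) (V vb)) merge)))))) (merged j (set (take (Suc k) L))) (set_var vv v \<sigma>)"
      using True cural curb bd vn by (subst wp_simps(6)) (simp del: wp_simps)
    thus ?thesis unfolding merge_step_def
      by (intro wp_SetI[of _ _ v]) (use ord k kn vX in \<open>simp_all del: wp_simps\<close>)
  qed
qed

lemma alive_init: "var \<sigma> vnd = n \<Longrightarrow> (\<And>i. arr \<sigma> aDEAD i 0 = 0) \<Longrightarrow> alive \<sigma> = {..<n}"
  by (auto simp: alive_def)

lemma merging:
  assumes st: "stat L \<sigma>" and cur: "\<And>v. v \<in> U \<Longrightarrow> arr \<sigma> aCUR v 0 = rep v" and z: "\<And>i. arr \<sigma> aDEAD i 0 = 0"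
  shows "wp merging (merged 0 U) \<sigma>"
proof -
  have co: "dims \<sigma>" by (rule statD(1)[OF st])
  have LU: "set L = U" by (rule statD(6)[OF st])
  have repn: "rep v < n" if "v \<in> U" for v using rep_props(3)[OF that] U_lt by blast
  let ?s = "set_var vnd n \<sigma>"
  \<comment> \<open>At counter \<open>c\<close> all vertices may count as treated, since no context
    weight reaches \<open>c\<close>.\<close>
  have init: "merged c U ?s"
  proof -
    let ?Nd = "\<lambda>i. {x \<in> U. rep x = i}"
    have al: "alive ?s = {..<n}" by (rule alive_init) (use z in auto)
    have "nodes ?s ?Nd" unfolding nodes_def al using z by (auto simp: pool_def)
    moreover have "module_inv U reach s c 0 U (\<lambda>x. arr ?s aCUR x 0) (alive ?s) ?Nd"
      unfolding al
    proof (rule module_inv_init)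
      show "arr ?s aCUR x 0 = arr ?s aCUR y 0 \<longleftrightarrow> y \<in> reach x \<and> x \<in> reach y" if "x \<in> U" "y \<in> U" for x y
        using cur that rep_eq[OF that] by simp
      show "{y \<in> U. rep y = arr ?s aCUR x 0} = {y \<in> U. arr ?s aCUR y 0 = arr ?s aCUR x 0}" for x
        using cur by auto
      show "d x \<le> c" if "x \<in> U" for x using d_less_c[OF that] by simp
    qed (use cur repn in auto)
    ultimately show ?thesis unfolding merged_def using cur repn by (intro exI[of _ ?Nd] exI[of _ 0]) auto
  qed
  have next_j: "merged j {} \<tau>" if "merged (Suc j) U \<tau>" for j \<tau>
    using that module_inv_next[OF _ subset_refl] unfolding merged_def by blast
  have inner: "wp (For vk vcnt merge_step) (merged j U) \<tau>"
    if st: "stat L \<tau>" and m: "merged j {} \<tau>" and j: "var \<tau> vj = j" for j \<tau>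
  proof (rule wp_Loop[where I = "\<lambda>k. merged j (set (take k L))"], goal_cases)
    case (8 k \<tau>')
    have len: "var \<tau> vcnt = length L" using statD(4)[OF st] by (auto simp: ord_def)
    have st': "stat L \<tau>'" by (rule stat_same[OF 8(4) st])
      (auto simp: merge_step_def split_test_def merge_def absorb_def join_def)
    have "var \<tau>' vj = j" using same_var[OF 8(4)] j
      by (simp add: merge_step_def split_test_def merge_def absorb_def join_def)
    hence "wp merge_step (merged j (set (take (Suc k) L))) \<tau>'"
      by (intro merge_step[OF st' _ 8(3) 8(5)]) (use 8(2) len in auto)
    thus ?case by (rule wp_mono) simp
  next
    case (9 \<tau>')
    have "var \<tau> vcnt = length L" using statD(4)[OF st] by (auto simp: ord_def)
    thus ?case using 9(2) LU by simp
  next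
    case 6
    have "var \<tau> vcnt = length L" using statD(4)[OF st] by (auto simp: ord_def)
    thus ?case using ordered_length[OF statD(5)[OF st]] by (simp add: \<beta>_def)
  qed (use m in \<open>auto simp: merge_step_def split_test_def merge_def absorb_def join_def\<close>)
  have st0: "stat L ?s" by (rule stat_same[of "{vnd}" "{}" \<sigma>]) (use st in \<open>auto simp: same_def\<close>)
  have "wp (For vjj vc (Sq (Set vj (xsub (V vc) (xadd (V vjj) (N 1)))) (For vk vcnt merge_step))) (merged 0 U) ?s"
  proof (rule wp_Loop[where I = "\<lambda>i. merged (c - i) U"], goal_cases)
    case (8 i \<tau>)
    have i: "i < c" using 8(2) co by (simp add: dimsD)
    have st': "stat L \<tau>" by (rule stat_same[OF 8(4) st0])
      (auto simp: merge_step_def split_test_def merge_def absorb_def join_def)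
    let ?j = "c - Suc i" let ?t = "set_var vj ?j \<tau>"
    have "Suc ?j = c - i" using i by simp
    hence m: "merged ?j {} ?t" using 8(5) next_j by simp
    have "stat L ?t" by (rule stat_same[of "{vj}" "{}" \<tau>]) (use st' in \<open>auto simp: same_def\<close>)
    hence "wp (For vk vcnt merge_step) (merged ?j U) ?t" by (rule inner[OF _ m]) simp
    hence "wp (For vk vcnt merge_step) (\<lambda>\<tau>'. merged ?j U (set_var vjj (Suc i) \<tau>')) ?t" by (rule wp_mono) simp
    thus ?case using 8(3) statD(1)[OF st'] c_le_X
      by (intro wp_SetI[of _ _ ?j]) (simp_all add: dimsD del: wp_simps)
  next
    case (9 \<tau>)
    thus ?case using co by (simp add: dimsD)
  qed (use init co in \<open>auto simp: dimsD \<beta>_def merge_step_def split_test_def merge_def absorb_def join_def\<close>)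
  thus ?thesis unfolding merging_def
    by (intro wp_SetI[of _ _ n]) (use co n_le_X in \<open>simp_all add: dimsD del: wp_simps\<close>)
qed

text \<open>Vertices with live numbers have an empty strict part, so their pieces are pairwise
  unrelated, and they cover \<open>U\<close>. If nothing is usable, an inner node would need
  nonempty children inside the empty \<open>U\<close>, so there is none.\<close>

lemma rooting:
  assumes st: "stat L \<sigma>" and mg: "merged 0 U \<sigma>"
  shows "wp rooting (\<lambda>\<tau>. \<exists>Nd. nodes \<tau> Nd \<and>
     (if U = {} then var \<tau> vh = 2 * n \<and> var \<tau> vnd = n else var \<tau> vh \<in> alive \<tau> \<and> Nd (var \<tau> vh) = U)) \<sigma>"
proof -
  have co: "dims \<sigma>" by (rule statD(1)[OF st])
  obtain Nd b where I: "nodes \<sigma> Nd" "module_inv U reach s 0 b U (\<lambda>x. arr \<sigma> aCUR x 0) (alive \<sigma>) Nd"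
    "\<And>x. x \<in> U \<Longrightarrow> arr \<sigma> aCUR x 0 < var \<sigma> vnd" using mg unfolding merged_def by blast
  interpret mi: module_inv U reach s 0 b U "\<lambda>x. arr \<sigma> aCUR x 0" "alive \<sigma>" Nd by (rule I(2))
  let ?cur = "\<lambda>x. arr \<sigma> aCUR x 0" and ?nd = "var \<sigma> vnd"
  have al: "?cur x \<in> alive \<sigma> \<longleftrightarrow> d x = 0" if "x \<in> U" for x
    using module_inv_final[OF I(2) subset_refl that] .
  have D0: "D x = {}" if "x \<in> U" "d x = 0" for x using sum_0_empty[OF D_sub_U[OF that(1)]] that(2) by (simp add: d_def)
  have bn: "n \<le> ?nd" "?nd \<le> 2 * n" using nodes_bound[OF I(1)] by auto
  have Al: "alive \<sigma> \<subseteq> {..<?nd}" by (auto simp: alive_def)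
  have DD: "arr \<sigma> aDD v 0 = (if v \<in> U then d v else Suc c)" if "v < n" for v using statD(3)[OF st that] .
  define Sel where "Sel i = ?cur ` {w \<in> U. w < i \<and> d w = 0}" for i
  have un: "unrelated Nd (?cur x) (?cur w)" if "x \<in> U" "d x = 0" "w \<in> U" "d w = 0" "?cur x \<noteq> ?cur w" for x w
    unfolding unrelated_def using that al D0
      mi.minv_disj[of x w] mi.minv_unrelated[of x w] mi.minv_unrelated[of w x] by simp
  have ne: "Nd (?cur x) \<noteq> {}" if "x \<in> U" "d x = 0" for x using mi.minv_self[of x] al that by blast
  let ?s = "set_var vh (2 * n) (set_var vj 0 \<sigma>)"
  have UN: "(\<Union>y\<in>Sel n. Nd y) = U"
  proof
    show "(\<Union>y\<in>Sel n. Nd y) \<subseteq> U" using mi.minv_sub al unfolding Sel_def by blast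
    show "U \<subseteq> (\<Union>y\<in>Sel n. Nd y)"
    proof
      fix u assume "u \<in> U"
      then obtain x where x: "x \<in> U" "?cur x \<in> alive \<sigma>" "u \<in> Nd (?cur x)" using mi.minv_cover by blast
      have "?cur x \<in> Sel n" unfolding Sel_def using x al[OF x(1)] U_lt[OF x(1)] by blast
      thus "u \<in> (\<Union>y\<in>Sel n. Nd y)" using x(3) by blast
    qed
  qed
  have "wp (For vw vn absorb) (\<lambda>\<tau>. \<exists>Nd. nodes \<tau> Nd \<and>
     (if U = {} then var \<tau> vh = 2 * n \<and> var \<tau> vnd = n else var \<tau> vh \<in> alive \<tau> \<and> Nd (var \<tau> vh) = U)) ?s"
  proof (rule wp_Loop[where I = "\<lambda>i \<tau>. ?nd \<le> var \<tau> vnd \<and> (\<exists>Nd'. nodes \<tau> Nd' \<and>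
       absorbed (2 * n) (alive \<sigma>) Nd (Sel i) (var \<tau> vh) (alive \<tau>) Nd')"], goal_cases)
    case (8 i \<tau>)
    have i: "i < n" using 8(2) co by (simp add: dimsD)
    have sv: "var \<tau> vj = 0" using same_var[OF 8(4)] by (simp add: absorb_def join_def)
    have sa: "arr \<tau> aCUR = arr \<sigma> aCUR" "arr \<tau> aDD = arr \<sigma> aDD" using same_arr[OF 8(4)] by (simp_all add: absorb_def join_def)
    have co': "dims \<tau>" using dims_same[OF 8(4)] co by (simp add: absorb_def join_def)
    obtain Nd' where Nd': "nodes \<tau> Nd'" "absorbed (2 * n) (alive \<sigma>) Nd (Sel i) (var \<tau> vh) (alive \<tau>) Nd'" "?nd \<le> var \<tau> vnd"
      using 8(5) by blast
    have di: "arr \<tau> aDD (var \<tau> vw) 0 = var \<tau> vj \<longleftrightarrow> i \<in> U \<and> d i = 0" using DD[OF i] 8(3) sa sv by simp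
    have S': "Sel (Suc i) = (if i \<in> U \<and> d i = 0 then insert (?cur i) (Sel i) else Sel i)"
      unfolding Sel_def by (auto simp: less_Suc_eq)
    have "wp absorb (\<lambda>\<tau>'. ?nd \<le> var \<tau>' vnd \<and> (\<exists>Nd'. nodes \<tau>' Nd' \<and> absorbed (2 * n) (alive \<sigma>) Nd
        (if arr \<tau> aDD (var \<tau> vw) 0 = var \<tau> vj then insert (?cur i) (Sel i) else Sel i) (var \<tau>' vh) (alive \<tau>') Nd')) \<tau>"
    proof (rule absorb[OF co' Nd'(1,2) Al Nd'(3)])
      show "var \<tau> vw < n" "arr \<tau> aCUR (var \<tau> vw) 0 = ?cur i" using 8(3) i sa by auto
      assume "arr \<tau> aDD (var \<tau> vw) 0 = var \<tau> vj"
      hence iU: "i \<in> U" "d i = 0" using di by auto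
      show "?cur i \<in> alive \<sigma> \<and> Nd (?cur i) \<noteq> {} \<and> (\<forall>z\<in>Sel i. Nd z \<noteq> {} \<and> (z \<noteq> ?cur i \<longrightarrow> unrelated Nd z (?cur i)))"
        unfolding Sel_def using al[OF iU(1)] iU ne un by auto
    qed
    hence "wp absorb (\<lambda>\<tau>'. ?nd \<le> var \<tau>' vnd \<and> (\<exists>Nd'. nodes \<tau>' Nd' \<and> absorbed (2 * n) (alive \<sigma>) Nd
        (Sel (Suc i)) (var \<tau>' vh) (alive \<tau>') Nd')) \<tau>" unfolding di S' .
    thus ?case by (rule wp_mono) simp
  next
    case (9 \<tau>)
    then obtain Nd' where N: "nodes \<tau> Nd'" "absorbed (2 * n) (alive \<sigma>) Nd (Sel n) (var \<tau> vh) (alive \<tau>) Nd'" "?nd \<le> var \<tau> vnd"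
      using co by (auto simp: dimsD)
    show ?case
    proof (cases "U = {}")
      case False
      hence "Sel n \<noteq> {}" using UN by auto
      hence "var \<tau> vh \<in> alive \<tau>" "Nd' (var \<tau> vh) = U" using N(2) UN by (auto simp: absorbed_def)
      thus ?thesis using N(1) False by auto
    next
      case True
      have "Sel n = {}" using True by (simp add: Sel_def)
      hence "var \<tau> vh = 2 * n" using N(2) by (simp add: absorbed_def)
      moreover have "var \<tau> vnd = n"
      proof (rule ccontr)
        assume "var \<tau> vnd \<noteq> n"
        hence i: "n \<le> n" "n < var \<tau> vnd" using nodes_bound[OF N(1)] by auto
        have p: "arr \<tau> aLC n 0 < n" using N(1) i by (auto simp: nodes_def pool_def)
        have "Nd' (arr \<tau> aLC n 0) \<noteq> {}" using N(1) i by (simp add: nodes_def)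
        moreover have "Nd' (arr \<tau> aLC n 0) \<subseteq> U" using N(1) p i by (simp add: nodes_def)
        ultimately show False using True by blast
      qed
      ultimately show ?thesis using N(1) True by auto
    qed
  qed (use co I(1) absorbed_init[of "2 * n" "alive \<sigma>" Nd] in \<open>auto simp: dimsD \<beta>_def absorb_def join_def Sel_def\<close>)
  thus ?thesis unfolding rooting_def
    by (intro wp_SetI[of _ _ 0] wp_SetI[of _ _ "2 * n"]) (use co n_le_X in \<open>simp_all add: dimsD del: wp_simps\<close>)
qed

end

text \<open>With truncated subtraction \<open>1 - (1 - b)\<close> is 0 for \<open>b = 0\<close> and
  1 otherwise, so the threshold counts only if the right child contributes. The product is nonzero
  iff both entries are. The stored \<open>va + 1\<close> encodes the left share and is never
  0.\<close>

definition cell :: cm where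
  "cell = When (Lt (xadd (V va) (V vb)) (V vC))
     (Unless (Eq (xmul (Arr aTB (Arr1 aLC (V vu)) (V va)) (Arr aTB (Arr1 aRC (V vu)) (V vb))) (N 0))
       (Unless (Lt (V va) (xmul (Arr1 aTH (V vu)) (xsub (N 1) (xsub (N 1) (V vb)))))
         (Put aTB (V vu) (xadd (V va) (V vb)) (xadd (V va) (N 1)))))"

text \<open>Children have smaller numbers than their parents, so increasing order meets them in
  time.\<close>

definition tables :: cm where
  "tables = Loop vu (V vn) vnd (For va vC (For vb vC cell))"

text \<open>Weights are tried in increasing order, so the last success is the largest.\<close>

definition best :: cm where
  "best = Sq (Set vbest (N 0)) (Sq (For vt vC (Unless (Eq (Arr aTB (V vh) (V vt)) (N 0)) (Set vbest (V vt))))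
     (Put1 aTG (V vh) (V vbest)))"

text \<open>Loops only count upwards; the mirrored index \<open>vu\<close> runs from
  \<open>vnd - 1\<close> down to \<open>vn\<close>, so parents come before children.\<close>

definition trace :: cm where
  "trace = Loop vk (V vn) vnd (Sq (Set vu (xsub (xadd (V vnd) (V vn)) (xadd (V vk) (N 1))))
     (Sq (Set va (xsub (Arr aTB (V vu) (Arr1 aTG (V vu))) (N 1)))
     (Sq (Set vb (xsub (Arr1 aTG (V vu)) (V va)))
     (Sq (Put1 aTG (Arr1 aLC (V vu)) (V va)) (Put1 aTG (Arr1 aRC (V vu)) (V vb))))))"

text \<open>A component is chosen as a whole, so the demand at its leaf decides for each of its
  vertices.\<close>

definition answer :: cm where
  "answer = For vv vn (When (Lt (Arr1 aWT (V vv)) (V vC))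
     (Unless (Eq (Arr1 aTG (Arr1 aREP (V vv))) (N 0)) (Out (V vv) (N 1))))"

definition read_header :: cm where
  "read_header = Sq (Set vn (In (N 0))) (Sq (Set vc (In (N 1))) (Set vC (xadd (V vc) (N 1))))"

definition program :: cm where
  "program = Sq read_header (Sq closures (Sq ranks (Sq sorting (Sq merging (Sq rooting (Sq tables (Sq best (Sq trace answer))))))))"

lemmas program_defs = closures_def expand_def neighbours_def visit_def ranks_def sorting_def merging_def merge_step_def
  split_test_def merge_def rooting_def absorb_def join_def

primrec no_out :: "cm \<Rightarrow> bool" where
  "no_out Nop \<longleftrightarrow> True"
| "no_out (Set r e) \<longleftrightarrow> True"
| "no_out (Put a i j e) \<longleftrightarrow> True"
| "no_out (Out i e) \<longleftrightarrow> False"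
| "no_out (Sq p q) \<longleftrightarrow> no_out p \<and> no_out q"
| "no_out (Cond b p q) \<longleftrightarrow> no_out p \<and> no_out q"
| "no_out (Loop r lo h p) \<longleftrightarrow> no_out p"

lemma run_no_out: "no_out p \<Longrightarrow> out (run inp p \<sigma>) = out \<sigma>"
proof (induction p arbitrary: \<sigma>)
  case (Loop r lo h p)
  have "out (((\<lambda>\<tau>. incr r (run inp p \<tau>)) ^^ k) \<tau>) = out \<tau>" for k \<tau>
    using Loop by (induction k) (auto simp: incr_def)
  thus ?case by simp
qed auto

lemma (in machine) wp_no_out: "wp p Q \<sigma> \<Longrightarrow> no_out p \<Longrightarrow> wp p (\<lambda>\<tau>. Q \<tau> \<and> out \<tau> = out \<sigma>) \<sigma>"
  by (simp add: wp_def run_no_out)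

context ssg
begin

section \<open>Tables and traceback\<close>

definition fits :: "(nat \<Rightarrow> nat \<Rightarrow> nat) \<Rightarrow> nat \<Rightarrow> nat \<Rightarrow> nat \<Rightarrow> nat \<Rightarrow> nat \<Rightarrow> bool" where
  "fits T l r \<theta> a b \<longleftrightarrow> T l a \<noteq> 0 \<and> T r b \<noteq> 0 \<and> (b = 0 \<or> \<theta> \<le> a)"

text \<open>\<open>M\<close> contains the pairs tried so far. Besides a correct zero test, each
  nonzero entry must name an admissible left share, whichever pair wrote it last.\<close>

definition filled :: "(nat \<Rightarrow> nat \<Rightarrow> nat) \<Rightarrow> nat \<Rightarrow> nat \<Rightarrow> nat \<Rightarrow> nat \<Rightarrow> (nat \<times> nat) set \<Rightarrow> bool" where
  "filled T i l r \<theta> M \<longleftrightarrow> (\<forall>t\<le>c. (T i t \<noteq> 0 \<longleftrightarrow> (\<exists>a b. (a, b) \<in> M \<and> t = a + b \<and> fits T l r \<theta> a b)) \<and>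
     (T i t \<noteq> 0 \<longrightarrow> T i t - 1 \<le> t \<and> fits T l r \<theta> (T i t - 1) (t - (T i t - 1))))"

text \<open>The pairs that precede \<open>(a, b)\<close> in the two nested loops.\<close>

definition before :: "nat \<Rightarrow> nat \<Rightarrow> (nat \<times> nat) set" where
  "before a b = {(a', b'). a' < a \<and> b' \<le> c \<or> a' = a \<and> b' < b}"

lemma filled_put:
  assumes f: "filled T i l r \<theta> (before a b)" and lr: "l \<noteq> i" "r \<noteq> i" and ab: "a + b \<le> c" "fits T l r \<theta> a b"
  shows "filled (T(i := (T i)(a + b := Suc a))) i l r \<theta> (before a (Suc b))"
proof -
  have ft: "fits (T(i := (T i)(a + b := Suc a))) l r \<theta> a' b' = fits T l r \<theta> a' b'" for a' b'
    using lr by (simp add: fits_def)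
  have bf: "(a', b') \<in> before a (Suc b) \<longleftrightarrow> (a', b') \<in> before a b \<or> a' = a \<and> b' = b" for a' b'
    by (auto simp: before_def)
  show ?thesis unfolding filled_def ft bf
  proof (intro allI impI)
    fix t assume t: "t \<le> c"
    show "((T(i := (T i)(a + b := Suc a))) i t \<noteq> 0 \<longleftrightarrow> (\<exists>a' b'. ((a', b') \<in> before a b \<or> a' = a \<and> b' = b) \<and> t = a' + b' \<and> fits T l r \<theta> a' b')) \<and>
      ((T(i := (T i)(a + b := Suc a))) i t \<noteq> 0 \<longrightarrow> (T(i := (T i)(a + b := Suc a))) i t - 1 \<le> t \<and>
        fits T l r \<theta> ((T(i := (T i)(a + b := Suc a))) i t - 1) (t - ((T(i := (T i)(a + b := Suc a))) i t - 1)))"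
    proof (cases "t = a + b")
      case True
      thus ?thesis using ab by auto
    next
      case False
      have e: "(\<exists>a' b'. ((a', b') \<in> before a b \<or> a' = a \<and> b' = b) \<and> t = a' + b' \<and> fits T l r \<theta> a' b') \<longleftrightarrow>
        (\<exists>a' b'. (a', b') \<in> before a b \<and> t = a' + b' \<and> fits T l r \<theta> a' b')" using False by blast
      have v: "(T(i := (T i)(a + b := Suc a))) i t = T i t" using False by simp
      show ?thesis unfolding v e using f t unfolding filled_def by blast
    qed
  qed
qed

lemma filled_skip:
  assumes f: "filled T i l r \<theta> (before a b)" and ab: "\<not> (a + b \<le> c \<and> fits T l r \<theta> a b)"
  shows "filled T i l r \<theta> (before a (Suc b))"
proof -
  have bf: "(a', b') \<in> before a (Suc b) \<longleftrightarrow> (a', b') \<in> before a b \<or> a' = a \<and> b' = b" for a' b'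
    by (auto simp: before_def)
  have e: "(\<exists>a' b'. ((a', b') \<in> before a b \<or> a' = a \<and> b' = b) \<and> t = a' + b' \<and> fits T l r \<theta> a' b') \<longleftrightarrow>
        (\<exists>a' b'. (a', b') \<in> before a b \<and> t = a' + b' \<and> fits T l r \<theta> a' b')" if "t \<le> c" for t
    using ab that by blast
  show ?thesis unfolding filled_def bf
  proof (intro allI impI)
    fix t assume t: "t \<le> c"
    show "(T i t \<noteq> 0 \<longleftrightarrow> (\<exists>a' b'. ((a', b') \<in> before a b \<or> a' = a \<and> b' = b) \<and> t = a' + b' \<and> fits T l r \<theta> a' b')) \<and>
      (T i t \<noteq> 0 \<longrightarrow> T i t - 1 \<le> t \<and> fits T l r \<theta> (T i t - 1) (t - (T i t - 1)))"
      unfolding e[OF t] using f t unfolding filled_def by blast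
  qed
qed

lemma before_next: "before a (Suc c) = before (Suc a) 0"
  by (auto simp: before_def less_Suc_eq)

lemma filled_cong:
  assumes "T' i = T i" "T' l = T l" "T' r = T r"
  shows "filled T' i l r \<theta> M = filled T i l r \<theta> M"
  using assms by (simp add: filled_def fits_def)

lemma cell:
  assumes co: "dims \<sigma>" and v: "var \<sigma> vu = i" "var \<sigma> va = a" "var \<sigma> vb = b" "a \<le> c" "b \<le> c" "i \<le> 2 * n"
    and ch: "arr \<sigma> aLC i 0 = l" "arr \<sigma> aRC i 0 = r" "arr \<sigma> aTH i 0 = \<theta>" "l < i" "r < i"
    and f: "filled (arr \<sigma> aTB) i l r \<theta> (before a b)"
  shows "wp cell (\<lambda>\<tau>. filled (arr \<tau> aTB) i l r \<theta> (before a (Suc b)) \<and> (\<forall>i'. i' \<noteq> i \<longrightarrow> arr \<tau> aTB i' = arr \<sigma> aTB i')) \<sigma>"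
proof -
  let ?T = "arr \<sigma> aTB"
  have lt: "a < \<theta> * (1 - (1 - b)) \<longleftrightarrow> \<not> (b = 0 \<or> \<theta> \<le> a)" by (cases b) auto
  show ?thesis
  proof (cases "a + b \<le> c \<and> fits ?T l r \<theta> a b")
    case True
    have "filled (?T(i := (?T i)(a + b := Suc a))) i l r \<theta> (before a (Suc b))"
      by (rule filled_put[OF f]) (use ch True in auto)
    moreover have "\<not> (a < \<theta> * (1 - (1 - b)))" using True lt by (simp add: fits_def)
    ultimately show ?thesis using True co v ch c_le_X by (simp add: cell_def dimsD fits_def)
  next
    case False
    have "filled ?T i l r \<theta> (before a (Suc b))" by (rule filled_skip[OF f False])
    moreover have "a + b \<le> c \<longrightarrow> ?T l a * ?T r b = 0 \<or> a < \<theta> * (1 - (1 - b))" using False lt by (auto simp: fits_def)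
    ultimately show ?thesis using co v ch
      by (cases "a + b \<le> c"; cases "?T l a * ?T r b = 0") (simp_all add: cell_def dimsD)
  qed
qed

definition table_at :: "st \<Rightarrow> nat \<Rightarrow> bool" where
  "table_at \<sigma> i \<longleftrightarrow> filled (arr \<sigma> aTB) i (arr \<sigma> aLC i 0) (arr \<sigma> aRC i 0) (arr \<sigma> aTH i 0) (before (Suc c) 0)"

lemma tables:
  assumes co: "dims \<sigma>" and nd: "nodes \<sigma> Nd" and z: "\<And>i t. n \<le> i \<Longrightarrow> arr \<sigma> aTB i t = 0"
  shows "wp tables (\<lambda>\<tau>. (\<forall>i. n \<le> i \<longrightarrow> i < var \<sigma> vnd \<longrightarrow> table_at \<tau> i) \<and> (\<forall>i<n. arr \<tau> aTB i = arr \<sigma> aTB i) \<and>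
     (\<forall>i\<ge>var \<sigma> vnd. \<forall>t. arr \<tau> aTB i t = 0)) \<sigma>"
proof -
  let ?nd = "var \<sigma> vnd" and ?L = "\<lambda>i. arr \<sigma> aLC i 0" and ?R = "\<lambda>i. arr \<sigma> aRC i 0" and ?Th = "\<lambda>i. arr \<sigma> aTH i 0"
  have bd: "n \<le> ?nd" "?nd \<le> 2 * n" using nodes_bound[OF nd] by auto
  have ch: "?L i < i" "?R i < i" if "n \<le> i" "i < ?nd" for i using nd that by (auto simp: nodes_def pool_def)
  have vals: "var \<sigma> vn = n" "var \<sigma> 2 = Suc c" using co by (simp_all add: dimsD)
  have row: "wp (For va vC (For vb vC cell)) (\<lambda>\<tau>'. filled (arr \<tau>' aTB) i (?L i) (?R i) (?Th i) (before (Suc c) 0) \<and>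
      (\<forall>i'. i' \<noteq> i \<longrightarrow> arr \<tau>' aTB i' = arr \<tau> aTB i')) \<tau>"
    if i: "n \<le> i" "i < ?nd" "var \<tau> vu = i" and co: "dims \<tau>" and ar: "arr \<tau> aLC = arr \<sigma> aLC" "arr \<tau> aRC = arr \<sigma> aRC" "arr \<tau> aTH = arr \<sigma> aTH"
      and zi: "\<And>t. arr \<tau> aTB i t = 0" for \<tau> i
  proof (rule wp_Loop[where I = "\<lambda>a \<tau>'. filled (arr \<tau>' aTB) i (?L i) (?R i) (?Th i) (before a 0) \<and>
      (\<forall>i'. i' \<noteq> i \<longrightarrow> arr \<tau>' aTB i' = arr \<tau> aTB i')"], goal_cases)
    case 7
    show ?case using zi by (simp add: filled_def before_def)
  next
    case (8 a \<tau>1)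
    have a: "a \<le> c" using 8(2) co by (simp add: dimsD)
    have c1: "dims \<tau>1" using dims_same[OF 8(4)] co by (simp add: cell_def)
    have u1: "var \<tau>1 vu = i" using same_var[OF 8(4)] i by (simp add: cell_def)
    have ar1: "arr \<tau>1 aLC = arr \<sigma> aLC" "arr \<tau>1 aRC = arr \<sigma> aRC" "arr \<tau>1 aTH = arr \<sigma> aTH"
      using same_arr[OF 8(4)] ar by (simp_all add: cell_def)
    show ?case
    proof (rule wp_Loop[where I = "\<lambda>b \<tau>'. filled (arr \<tau>' aTB) i (?L i) (?R i) (?Th i) (before a b) \<and>
       (\<forall>i'. i' \<noteq> i \<longrightarrow> arr \<tau>' aTB i' = arr \<tau> aTB i')"], goal_cases)
      case inner: (8 b \<tau>2)
      have b: "b \<le> c" using inner(2) c1 by (simp add: dimsD)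
      have c2: "dims \<tau>2" using dims_same[OF inner(4)] c1 by (simp add: cell_def)
      have u2: "var \<tau>2 vu = i" "var \<tau>2 va = a" using same_var[OF inner(4)] u1 8(3) by (simp_all add: cell_def)
      have ar2: "arr \<tau>2 aLC = arr \<sigma> aLC" "arr \<tau>2 aRC = arr \<sigma> aRC" "arr \<tau>2 aTH = arr \<sigma> aTH"
        using same_arr[OF inner(4)] ar1 by (simp_all add: cell_def)
      have "wp cell (\<lambda>\<tau>'. filled (arr \<tau>' aTB) i (?L i) (?R i) (?Th i) (before a (Suc b)) \<and> (\<forall>i'. i' \<noteq> i \<longrightarrow> arr \<tau>' aTB i' = arr \<tau>2 aTB i')) \<tau>2"
        by (rule cell[OF c2]) (use u2 inner a b ar2 ch[OF i(1,2)] i bd in auto)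
      thus ?case using inner(5) by (elim wp_mono) auto
    next
      case inner: (9 \<tau>2)
      thus ?case using c1 before_next by (simp add: dimsD)
    qed (use 8(5) c1 in \<open>auto simp: cell_def dimsD \<beta>_def\<close>)
  next
    case (9 \<tau>1)
    thus ?case using co by (simp add: dimsD)
  qed (use co in \<open>auto simp: cell_def dimsD \<beta>_def\<close>)
  show ?thesis unfolding tables_def
  proof (rule wp_Loop[where I = "\<lambda>m \<tau>. (\<forall>i. n \<le> i \<longrightarrow> i < m \<longrightarrow> table_at \<tau> i) \<and> (\<forall>i<n. arr \<tau> aTB i = arr \<sigma> aTB i) \<and>
     (\<forall>i\<ge>m. \<forall>t. arr \<tau> aTB i t = 0)"], goal_cases)
    case (8 m \<tau>)
    have m: "n \<le> m" "m < ?nd" using 8 vals by simp_all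
    have c1: "dims \<tau>" using dims_same[OF 8(4)] co by (simp add: cell_def)
    have ar1: "arr \<tau> aLC = arr \<sigma> aLC" "arr \<tau> aRC = arr \<sigma> aRC" "arr \<tau> aTH = arr \<sigma> aTH"
      using same_arr[OF 8(4)] by (simp_all add: cell_def)
    have "wp (For va vC (For vb vC cell)) (\<lambda>\<tau>'. filled (arr \<tau>' aTB) m (?L m) (?R m) (?Th m) (before (Suc c) 0) \<and>
      (\<forall>i'. i' \<noteq> m \<longrightarrow> arr \<tau>' aTB i' = arr \<tau> aTB i')) \<tau>"
      by (rule row[OF m 8(3) c1 ar1]) (use 8(5) in auto)
    thus ?case
    proof (rule wp_frame)
      fix \<tau>' assume sm: "same (wv (For va vC (For vb vC cell))) (wa (For va vC (For vb vC cell))) \<tau> \<tau>'"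
        and f: "filled (arr \<tau>' aTB) m (?L m) (?R m) (?Th m) (before (Suc c) 0) \<and>
          (\<forall>i'. i' \<noteq> m \<longrightarrow> arr \<tau>' aTB i' = arr \<tau> aTB i')"
      have ar2: "arr \<tau>' aLC = arr \<sigma> aLC" "arr \<tau>' aRC = arr \<sigma> aRC" "arr \<tau>' aTH = arr \<sigma> aTH"
        using same_arr[OF sm] ar1 by (simp_all add: cell_def)
      have "table_at \<tau>' i" if i: "n \<le> i" "i < Suc m" for i
      proof (cases "i = m")
        case True
        thus ?thesis using f ar2 by (simp add: table_at_def)
      next
        case False
        hence im: "i < m" using i by simp
        have "table_at \<tau> i" using 8(5) i im by blast
        moreover have "?L i \<noteq> m" "?R i \<noteq> m" using ch[of i] i im m by auto
        ultimately show ?thesis using f im ar1 ar2 filled_cong[of "arr \<tau>' aTB" i "arr \<tau> aTB" "?L i" "?R i"]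
          by (simp add: table_at_def)
      qed
      thus "(\<forall>i. n \<le> i \<longrightarrow> i < Suc m \<longrightarrow> table_at (set_var vu (Suc m) \<tau>') i) \<and> (\<forall>i<n. arr (set_var vu (Suc m) \<tau>') aTB i = arr \<sigma> aTB i) \<and>
         (\<forall>i\<ge>Suc m. \<forall>t. arr (set_var vu (Suc m) \<tau>') aTB i t = 0)"
        using f 8(5) m by (simp add: table_at_def)
    qed
  next
    case (9 \<tau>)
    thus ?case using vals bd by simp
  qed (use vals bd n_le_X z in \<open>auto simp: cell_def \<beta>_def\<close>)
qed

lemma best:
  assumes co: "dims \<sigma>" and h: "var \<sigma> vh \<le> 2 * n"
  shows "wp best (\<lambda>\<tau>. var \<tau> vbest \<le> c \<and> (var \<tau> vbest = 0 \<or> arr \<sigma> aTB (var \<sigma> vh) (var \<tau> vbest) \<noteq> 0) \<and>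
    (\<forall>t\<le>c. arr \<sigma> aTB (var \<sigma> vh) t \<noteq> 0 \<longrightarrow> t \<le> var \<tau> vbest) \<and>
    (\<forall>y. arr \<tau> aTG y 0 = (if y = var \<sigma> vh then var \<tau> vbest else arr \<sigma> aTG y 0))) \<sigma>"
proof -
  let ?h = "var \<sigma> vh" let ?T = "arr \<sigma> aTB ?h"
  have "wp (For vt vC (Unless (Eq (Arr aTB (V vh) (V vt)) (N 0)) (Set vbest (V vt))))
     (\<lambda>\<tau>. var \<tau> vh = ?h \<and> arr \<tau> aTG = arr \<sigma> aTG \<and> var \<tau> vbest \<le> c \<and> (var \<tau> vbest = 0 \<or> ?T (var \<tau> vbest) \<noteq> 0) \<and> (\<forall>t\<le>c. ?T t \<noteq> 0 \<longrightarrow> t \<le> var \<tau> vbest)) (set_var vbest 0 \<sigma>)"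
  proof (rule wp_Loop[where I = "\<lambda>m \<tau>. var \<tau> vbest \<le> c \<and> (var \<tau> vbest = 0 \<or> ?T (var \<tau> vbest) \<noteq> 0) \<and> (\<forall>t<m. ?T t \<noteq> 0 \<longrightarrow> t \<le> var \<tau> vbest)"], goal_cases)
    case (8 m \<tau>)
    have m: "m \<le> c" using 8(2) co by (simp add: dimsD)
    have "var \<tau> vh = ?h" "arr \<tau> = arr \<sigma>" using same_var[OF 8(4)] same_arr[OF 8(4)] by (simp_all add: fun_eq_iff)
    thus ?case using 8(3,5) m h c_le_X by (auto simp: less_Suc_eq)
  next
    case (9 \<tau>)
    have "var \<tau> vh = ?h" "arr \<tau> = arr \<sigma>" using same_var[OF 9(1)] same_arr[OF 9(1)] by (simp_all add: fun_eq_iff)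
    thus ?case using 9(2) co by (simp add: dimsD less_Suc_eq_le)
  qed (use co in \<open>auto simp: dimsD \<beta>_def\<close>)
  hence "wp (For vt vC (Unless (Eq (Arr aTB (V vh) (V vt)) (N 0)) (Set vbest (V vt)))) (wp (Put1 aTG (V vh) (V vbest))
    (\<lambda>\<tau>. var \<tau> vbest \<le> c \<and> (var \<tau> vbest = 0 \<or> ?T (var \<tau> vbest) \<noteq> 0) \<and>
    (\<forall>t\<le>c. ?T t \<noteq> 0 \<longrightarrow> t \<le> var \<tau> vbest) \<and>
    (\<forall>y. arr \<tau> aTG y 0 = (if y = ?h then var \<tau> vbest else arr \<sigma> aTG y 0)))) (set_var vbest 0 \<sigma>)"
    by (rule wp_mono) (use h c_le_X in auto)
  from wp_SqI[OF this] show ?thesis unfolding best_def by (intro wp_SetI[of _ _ 0]) simp_all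
qed

lemma rep_rep: "x \<in> U \<Longrightarrow> rep (rep x) = rep x"
  using rep_eq[of "rep x" x] rep_props[of x] by simp

lemma solution_table:
  assumes nd: "nodes \<sigma> Nd" and tb: "\<And>i. n \<le> i \<Longrightarrow> i < var \<sigma> vnd \<Longrightarrow> table_at \<sigma> i"
    and lf: "\<And>v t. v \<in> U \<Longrightarrow> arr \<sigma> aTB v t \<noteq> 0 \<longleftrightarrow> t = 0 \<or> t = W v - d v"
  shows "solution_table U reach s n (var \<sigma> vnd) c Nd (\<lambda>i. arr \<sigma> aLC i 0) (\<lambda>i. arr \<sigma> aRC i 0) (\<lambda>i. arr \<sigma> aTH i 0) (arr \<sigma> aTB) (alive \<sigma>)"
proof unfold_locales
  let ?T = "arr \<sigma> aTB"
  have leafs: "Nd i = {x \<in> U. rep x = i}" if "i < n" for i using nd that by (simp add: nodes_def)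
  show "pool n (var \<sigma> vnd) (alive \<sigma>) Nd (\<lambda>i. arr \<sigma> aLC i 0) (\<lambda>i. arr \<sigma> aRC i 0) (\<lambda>i. arr \<sigma> aTH i 0)"
    using nd by (simp add: nodes_def)
  show "Nd i \<subseteq> U" if "i < var \<sigma> vnd" for i using nd that by (simp add: nodes_def)
  show "Nd (arr \<sigma> aLC i 0) \<noteq> {} \<and> Nd (arr \<sigma> aRC i 0) \<noteq> {}" if "n \<le> i" "i < var \<sigma> vnd" for i
    using nd that by (simp add: nodes_def)
  show "Nd i \<subseteq> reach x" if "i < n" "x \<in> Nd i" for i x
  proof
    fix y assume "y \<in> Nd i"
    thus "y \<in> reach x" using that(2) leafs[OF that(1)] rep_eq[of x y] by simp
  qed
  fix i t assume t: "t \<le> c"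
  { assume i: "i < n" "Nd i \<noteq> {}"
    then obtain x where x: "x \<in> U" "rep x = i" using leafs by auto
    \<comment> \<open>A nonempty leaf is numbered by the representative of its component, and row
      \<open>i\<close> of the table was filled for exactly this vertex.\<close>
    hence iU: "i \<in> U" "rep i = i" using rep_props(3)[OF x(1)] rep_rep[OF x(1)] by auto
    have "sum s (Nd i) = W i - d i" using class_weight[OF iU(1)] iU(2) leafs[OF i(1)] by simp
    thus "?T i t \<noteq> 0 \<longleftrightarrow> t = 0 \<or> t = sum s (Nd i)" using lf[OF iU(1)] by simp }
  assume i: "n \<le> i" "i < var \<sigma> vnd"
  let ?l = "arr \<sigma> aLC i 0" and ?r = "arr \<sigma> aRC i 0" and ?th = "arr \<sigma> aTH i 0"
  have f: "(?T i t \<noteq> 0 \<longleftrightarrow> (\<exists>a b. (a, b) \<in> before (Suc c) 0 \<and> t = a + b \<and> fits ?T ?l ?r ?th a b)) \<and>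
     (?T i t \<noteq> 0 \<longrightarrow> ?T i t - 1 \<le> t \<and> fits ?T ?l ?r ?th (?T i t - 1) (t - (?T i t - 1)))"
    using tb[OF i] t unfolding table_at_def filled_def by blast
  have "(a, b) \<in> before (Suc c) 0" if "t = a + b" for a b using that t by (auto simp: before_def)
  hence e: "(\<exists>a b. (a, b) \<in> before (Suc c) 0 \<and> t = a + b \<and> fits ?T ?l ?r ?th a b) \<longleftrightarrow> (\<exists>a b. t = a + b \<and> fits ?T ?l ?r ?th a b)"
    by blast
  show "?T i t \<noteq> 0 \<longleftrightarrow> (\<exists>a b. t = a + b \<and> ?T ?l a \<noteq> 0 \<and> ?T ?r b \<noteq> 0 \<and> (b = 0 \<or> ?th \<le> a))"
    using f unfolding e unfolding fits_def by blast
  { assume "?T i t \<noteq> 0"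
    thus "let a = ?T i t - 1 in a \<le> t \<and> ?T ?l a \<noteq> 0 \<and> ?T ?r (t - a) \<noteq> 0 \<and> (t - a = 0 \<or> ?th \<le> a)"
      using f unfolding fits_def Let_def by blast }
qed

text \<open>Without usable vertices there is no root to start from; the premises on the table are
  then void, and the loop is empty because \<open>vnd = n\<close>.\<close>

lemma trace:
  assumes co: "dims \<sigma>" and bd: "n \<le> var \<sigma> vnd" "var \<sigma> vnd \<le> 2 * n" and U: "U = {} \<Longrightarrow> var \<sigma> vnd = n"
    and st: "U \<noteq> {} \<Longrightarrow> solution_table U reach s n (var \<sigma> vnd) c Nd (\<lambda>i. arr \<sigma> aLC i 0) (\<lambda>i. arr \<sigma> aRC i 0) (\<lambda>i. arr \<sigma> aTH i 0) (arr \<sigma> aTB) (alive \<sigma>)"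
    and tr: "U \<noteq> {} \<Longrightarrow> solution_table.traced n (var \<sigma> vnd) c Nd (\<lambda>i. arr \<sigma> aLC i 0) (\<lambda>i. arr \<sigma> aRC i 0) (arr \<sigma> aTB) rt t (var \<sigma> vnd) (\<lambda>y. arr \<sigma> aTG y 0)"
  shows "wp trace (\<lambda>\<tau>. U \<noteq> {} \<longrightarrow> solution_table.traced n (var \<sigma> vnd) c Nd (\<lambda>i. arr \<sigma> aLC i 0) (\<lambda>i. arr \<sigma> aRC i 0) (arr \<sigma> aTB) rt t n (\<lambda>y. arr \<tau> aTG y 0)) \<sigma>"
proof -
  let ?nd = "var \<sigma> vnd" and ?T = "arr \<sigma> aTB"
  let ?tr = "\<lambda>m \<tau>. solution_table.traced n ?nd c Nd (\<lambda>i. arr \<sigma> aLC i 0) (\<lambda>i. arr \<sigma> aRC i 0) ?T rt t m (\<lambda>y. arr \<tau> aTG y 0)"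
  let ?tr' = "solution_table.traced n ?nd c Nd (\<lambda>i. arr \<sigma> aLC i 0) (\<lambda>i. arr \<sigma> aRC i 0) ?T rt t"
  have vals: "var \<sigma> vn = n" using co by (simp add: dimsD)
  show ?thesis unfolding trace_def
  proof (rule wp_Loop[where I = "\<lambda>k \<tau>. U \<noteq> {} \<longrightarrow> ?tr (?nd + n - k) \<tau>"], goal_cases)
    case (8 k \<tau>)
    have k: "n \<le> k" "k < ?nd" using 8 vals by simp_all
    have ne: "U \<noteq> {}" using k U by auto
    note ST = st[OF ne]
    define m where "m = ?nd + n - Suc k"
    have m: "n \<le> m" "m < ?nd" "Suc m = ?nd + n - k" using k by (auto simp: m_def)
    have sv: "var \<tau> vn = n" "var \<tau> vnd = ?nd" using same_var[OF 8(4)] vals by simp_all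
    have sa: "arr \<tau> aLC = arr \<sigma> aLC" "arr \<tau> aRC = arr \<sigma> aRC" "arr \<tau> aTB = ?T" using same_arr[OF 8(4)] by simp_all
    have T: "?tr' (Suc m) (\<lambda>y. arr \<tau> aTG y 0)" using 8(5) ne m(3) by simp
    let ?x = "arr \<tau> aTG m 0" let ?a = "?T m ?x - 1"
    have x: "?x \<le> c" using T unfolding solution_table.traced_def[OF ST] by (cases "?x = 0") auto
    have T0: "?T m 0 \<noteq> 0" using solution_table.table[OF ST m(2) solution_table.inner_nonempty[OF ST m(1,2)]] zero_weights by simp
    have Tx: "?T m ?x \<noteq> 0" using T T0 unfolding solution_table.traced_def[OF ST] by (cases "?x = 0"; simp)
    have ax: "?a \<le> ?x" using solution_table.retrace[OF ST m(1,2) x Tx] by (simp add: Let_def)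
    note ch = solution_table.children(1-3)[OF ST m(1,2)]
    have step: "?tr' m ((\<lambda>y. arr \<tau> aTG y 0)(arr \<sigma> aLC m 0 := ?a, arr \<sigma> aRC m 0 := ?x - ?a))"
      by (rule solution_table.traced_step[OF ST T m(1,2) refl])
    have mX: "m \<le> 2 * n" "m \<le> X" "?x \<le> X" "?a \<le> X" "?x - ?a \<le> X" using m bd n_le_X x c_le_X ax by auto
    have m': "?nd + n - (k + 1) = m" by (simp add: m_def)
    let ?s = "set_var vb (?x - ?a) (set_var va ?a (set_var vu m \<tau>))"
    have "wp (Sq (Put1 aTG (Arr1 aLC (V vu)) (V va)) (Put1 aTG (Arr1 aRC (V vu)) (V vb)))
      (\<lambda>\<tau>'. U \<noteq> {} \<longrightarrow> ?tr (?nd + n - Suc k) (set_var vk (Suc k) \<tau>')) ?s"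
      using ch sa mX step[unfolded fun_upd_def] ch(3)[symmetric]
      by (simp add: m_def[symmetric] fun_upd_def if_app cong: if_cong)
    thus ?case using 8(3) sv sa mX x m'
      by (intro wp_SetI[of _ _ m] wp_SetI[of _ _ ?a] wp_SetI[of _ _ "?x - ?a"]) (simp_all del: wp_simps)
  next
    case (9 \<tau>)
    thus ?case using vals bd by simp
  qed (use vals bd n_le_X tr in \<open>auto simp: \<beta>_def\<close>)
qed

lemma answer:
  assumes co: "dims \<sigma>" and cl: "\<And>v. v < n \<Longrightarrow> closure_ok v \<sigma>" and rp: "\<And>v. v \<in> U \<Longrightarrow> arr \<sigma> aREP v 0 = rep v" and z: "\<And>v. out \<sigma> v = 0"
  shows "wp answer (\<lambda>\<tau>. \<forall>v<n. out \<tau> v = 1 \<longleftrightarrow> v \<in> U \<and> arr \<sigma> aTG (rep v) 0 \<noteq> 0) \<sigma>"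
  unfolding answer_def
proof (rule wp_Loop[where I = "\<lambda>m \<tau>. (\<forall>v<m. out \<tau> v = 1 \<longleftrightarrow> v \<in> U \<and> arr \<sigma> aTG (rep v) 0 \<noteq> 0) \<and> (\<forall>v\<ge>m. out \<tau> v = 0)"], goal_cases)
  case (8 v \<tau>)
  have v: "v < n" using 8(2) co by (simp add: dimsD)
  have sa: "arr \<tau> = arr \<sigma>" "dims \<tau>" using same_arr[OF 8(4)] dims_same[OF 8(4)] co by (simp_all add: fun_eq_iff)
  have w: "arr \<sigma> aWT v 0 < Suc c \<longleftrightarrow> v \<in> U" using cl[OF v] by (auto simp: closure_ok_def)
  show ?case
  proof (cases "v \<in> U")
    case True
    have "rep v \<le> 2 * n" using U_lt[OF rep_props(3)[OF True]] by simp
    thus ?thesis using True w rp[OF True] v 8(3,5) sa n_le_X by (auto simp: dimsD less_Suc_eq)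
  next
    case False
    thus ?thesis using w v 8(3,5) sa by (auto simp: dimsD less_Suc_eq)
  qed
next
  case (9 \<tau>)
  thus ?case using co by (simp add: dimsD)
qed (use co z in \<open>auto simp: dimsD \<beta>_def\<close>)


section \<open>The whole program\<close>

lemma wp_step:
  assumes "wp p P \<sigma>" "no_out p" "\<And>\<tau>. \<lbrakk> same (wv p) (wa p) \<sigma> \<tau>; P \<tau>; out \<tau> = out \<sigma> \<rbrakk> \<Longrightarrow> wp q Q \<tau>"
  shows "wp (Sq p q) Q \<sigma>"
  unfolding wp_simps(5) by (rule wp_frame[OF wp_no_out[OF assms(1,2)]]) (use assms(3) in blast)

definition leafs :: "st \<Rightarrow> bool" where
  "leafs \<sigma> \<longleftrightarrow> (\<forall>v\<in>U. arr \<sigma> aREP v 0 = rep v \<and> (\<forall>t. arr \<sigma> aTB v t \<noteq> 0 \<longleftrightarrow> t = 0 \<or> t = W v - d v))"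

text \<open>At the end only leaves carry demands, and a leaf with a nonzero demand contributes its
  class. For optimality, the weight of a feasible set occurs in the table of the root because
  \<open>Nd rt = U\<close>.\<close>

lemma solution_from_trace:
  assumes ST: "solution_table U reach s n nd c Nd Lc Rc Th T Al" and nd: "n \<le> nd" and lf: "\<And>i. i < n \<Longrightarrow> Nd i = {x \<in> U. rep x = i}"
    and rt: "rt < nd" "Nd rt = U" "U \<noteq> {}" and t: "t \<le> c" "T rt t \<noteq> 0" "\<And>t'. t' \<le> c \<Longrightarrow> T rt t' \<noteq> 0 \<Longrightarrow> t' \<le> t"
    and tr: "solution_table.traced n nd c Nd Lc Rc T rt t n tg"
  shows "ssg_solution s c G {v. v \<in> U \<and> tg (rep v) \<noteq> 0}"
proof -
  let ?sol = "solution_table.sol n nd Nd Lc Rc T"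
  have "?sol y (tg y) = {x \<in> U. rep x = y \<and> tg y \<noteq> 0}" if "y < n" for y
    using solution_table.sol.simps[OF ST, of y "tg y"] that lf[OF that] by auto
  hence "(\<Union>y<n. ?sol y (tg y)) = (\<Union>y<n. {x \<in> U. rep x = y \<and> tg y \<noteq> 0})" by auto
  also have "\<dots> = {v. v \<in> U \<and> tg (rep v) \<noteq> 0}" using rep_props(3) U_lt by blast
  finally have A: "?sol rt t = {v. v \<in> U \<and> tg (rep v) \<noteq> 0}"
    using tr unfolding solution_table.traced_def[OF ST] by simp
  have so: "closed_in U (?sol rt t)" "sum s (?sol rt t) = t"
    using solution_table.sol[OF ST rt(1) _ t(1,2)] rt by auto
  have "sum s B \<le> t" if "ssg_feasible s c G B" for B
  proof -
    have B: "closed_in U B" "sum s B \<le> c" using that feasible_iff by auto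
    hence "sum s B \<in> weights (Nd rt)" using rt by (auto simp: weights_def)
    hence "T rt (sum s B) \<noteq> 0" using solution_table.table[OF ST rt(1) _ B(2)] rt by simp
    thus ?thesis using t(3) B(2) by simp
  qed
  thus ?thesis unfolding A[symmetric] ssg_solution_def is_arg_max_def
    using so t(1) feasible_iff by (auto simp: not_less)
qed

lemma final_phase:
  assumes st: "stat L \<sigma>" and nd: "nodes \<sigma> Nd" and rt: "if U = {} then var \<sigma> vh = 2 * n \<and> var \<sigma> vnd = n else var \<sigma> vh \<in> alive \<sigma> \<and> Nd (var \<sigma> vh) = U"
    and lf: "leafs \<sigma>" and z: "\<And>i t. n \<le> i \<Longrightarrow> arr \<sigma> aTB i t = 0" "\<And>i. arr \<sigma> aTG i 0 = 0" "\<And>i. out \<sigma> i = 0"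
  shows "wp (Sq tables (Sq best (Sq trace answer))) (\<lambda>\<tau>. ssg_solution s c G {v. v < n \<and> out \<tau> v = 1}) \<sigma>"
proof (rule wp_step[OF tables[OF statD(1)[OF st] nd z(1)]])
  let ?nd = "var \<sigma> vnd" and ?h = "var \<sigma> vh"
  show "no_out tables" by (simp add: tables_def cell_def)
  fix \<tau>1 assume sm: "same (wv tables) (wa tables) \<sigma> \<tau>1" and P: "(\<forall>i. n \<le> i \<longrightarrow> i < ?nd \<longrightarrow> table_at \<tau>1 i) \<and> (\<forall>i<n. arr \<tau>1 aTB i = arr \<sigma> aTB i) \<and>
     (\<forall>i\<ge>?nd. \<forall>t. arr \<tau>1 aTB i t = 0)" and o1: "out \<tau>1 = out \<sigma>"
  have bd: "n \<le> ?nd" "?nd \<le> 2 * n" using nodes_bound[OF nd] by auto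
  have st1: "stat L \<tau>1" by (rule stat_same[OF sm st]) (auto simp: tables_def cell_def)
  have v1: "var \<tau>1 vnd = ?nd" "var \<tau>1 vh = ?h" using same_var[OF sm] by (simp_all add: tables_def cell_def)
  have a1: "arr \<tau>1 aLC = arr \<sigma> aLC" "arr \<tau>1 aRC = arr \<sigma> aRC" "arr \<tau>1 aTH = arr \<sigma> aTH" "arr \<tau>1 aDEAD = arr \<sigma> aDEAD"
    "arr \<tau>1 aREP = arr \<sigma> aREP" "arr \<tau>1 aTG = arr \<sigma> aTG" using same_arr[OF sm] by (simp_all add: tables_def cell_def)
  have nd1: "nodes \<tau>1 Nd" "alive \<tau>1 = alive \<sigma>" using nodes_cong[OF v1(1) a1(4,1,2,3)] nd by auto
  have lf1: "leafs \<tau>1" using lf P a1(5) U_lt by (simp add: leafs_def)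
  have ST: "solution_table U reach s n (var \<tau>1 vnd) c Nd (\<lambda>i. arr \<tau>1 aLC i 0) (\<lambda>i. arr \<tau>1 aRC i 0) (\<lambda>i. arr \<tau>1 aTH i 0) (arr \<tau>1 aTB) (alive \<tau>1)"
    by (rule solution_table[OF nd1(1)]) (use P v1 lf1 in \<open>auto simp: leafs_def\<close>)
  have hb: "?h \<le> 2 * n" using rt bd by (auto simp: alive_def split: if_splits)
  show "wp (Sq best (Sq trace answer)) (\<lambda>\<tau>. ssg_solution s c G {v. v < n \<and> out \<tau> v = 1}) \<tau>1"
  proof (rule wp_step[OF best[OF statD(1)[OF st1]]])
    show "var \<tau>1 vh \<le> 2 * n" using hb v1 by simp
    show "no_out best" by (simp add: best_def)
    let ?T = "arr \<tau>1 aTB"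
    fix \<tau>2 assume sm2: "same (wv best) (wa best) \<tau>1 \<tau>2" and o2: "out \<tau>2 = out \<tau>1"
      and P2: "var \<tau>2 vbest \<le> c \<and> (var \<tau>2 vbest = 0 \<or> ?T (var \<tau>1 vh) (var \<tau>2 vbest) \<noteq> 0) \<and>
        (\<forall>t\<le>c. ?T (var \<tau>1 vh) t \<noteq> 0 \<longrightarrow> t \<le> var \<tau>2 vbest) \<and>
        (\<forall>y. arr \<tau>2 aTG y 0 = (if y = var \<tau>1 vh then var \<tau>2 vbest else arr \<tau>1 aTG y 0))"
    have st2: "stat L \<tau>2" by (rule stat_same[OF sm2 st1]) (auto simp: best_def)
    have v2: "var \<tau>2 vnd = var \<tau>1 vnd" using same_var[OF sm2] by (simp add: best_def)
    have a2: "arr \<tau>2 aLC = arr \<tau>1 aLC" "arr \<tau>2 aRC = arr \<tau>1 aRC" "arr \<tau>2 aTH = arr \<tau>1 aTH" "arr \<tau>2 aDEAD = arr \<tau>1 aDEAD"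
      "arr \<tau>2 aREP = arr \<tau>1 aREP" "arr \<tau>2 aTB = ?T" using same_arr[OF sm2] by (simp_all add: best_def)
    have al2: "alive \<tau>2 = alive \<tau>1" using v2 a2(4) by (simp add: alive_def)
    let ?b = "var \<tau>2 vbest"
    have h: "?h \<in> alive \<tau>1" "Nd ?h = U" "?h < var \<tau>1 vnd" if "U \<noteq> {}" using rt that nd1(2) v1 by (auto simp: alive_def)
    have Tb: "?T ?h ?b \<noteq> 0" if "U \<noteq> {}"
      using P2 v1(2) solution_table.table[OF ST h(3)[OF that], of 0] h(2)[OF that] that zero_weights by auto
    have tg2: "(\<lambda>y. arr \<tau>2 aTG y 0) = (\<lambda>y. if y = ?h then ?b else 0)" using P2 v1 a1(6) z(2) by auto
    have ST2: "solution_table U reach s n (var \<tau>2 vnd) c Nd (\<lambda>i. arr \<tau>2 aLC i 0) (\<lambda>i. arr \<tau>2 aRC i 0) (\<lambda>i. arr \<tau>2 aTH i 0) (arr \<tau>2 aTB) (alive \<tau>2)"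
      using ST unfolding a2 v2 al2 .
    have tr: "solution_table.traced n (var \<tau>2 vnd) c Nd (\<lambda>i. arr \<tau>2 aLC i 0) (\<lambda>i. arr \<tau>2 aRC i 0) (arr \<tau>2 aTB) ?h ?b (var \<tau>2 vnd) (\<lambda>y. arr \<tau>2 aTG y 0)"
      if "U \<noteq> {}"
      unfolding tg2 a2 v2
      by (rule solution_table.traced_init[OF ST]) (use h[OF that] P2 Tb[OF that] that in auto)
    show "wp (Sq trace answer) (\<lambda>\<tau>. ssg_solution s c G {v. v < n \<and> out \<tau> v = 1}) \<tau>2"
    proof (rule wp_step[OF trace[OF statD(1)[OF st2] _ _ _ ST2 tr]])
      show "n \<le> var \<tau>2 vnd" "var \<tau>2 vnd \<le> 2 * n" using bd v1 v2 by auto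
      show "var \<tau>2 vnd = n" if "U = {}" using rt that v1 v2 by simp
      show "no_out trace" by (simp add: trace_def)
      fix \<tau>3 assume sm3: "same (wv trace) (wa trace) \<tau>2 \<tau>3" and o3: "out \<tau>3 = out \<tau>2"
        and P3: "U \<noteq> {} \<longrightarrow> solution_table.traced n (var \<tau>2 vnd) c Nd (\<lambda>i. arr \<tau>2 aLC i 0) (\<lambda>i. arr \<tau>2 aRC i 0) (arr \<tau>2 aTB) ?h ?b n (\<lambda>y. arr \<tau>3 aTG y 0)"
      have st3: "stat L \<tau>3" by (rule stat_same[OF sm3 st2]) (auto simp: trace_def)
      have a3: "arr \<tau>3 aREP = arr \<sigma> aREP" using same_arr[OF sm3] a1 a2 by (simp add: trace_def)
      have "wp answer (\<lambda>\<tau>. \<forall>v<n. out \<tau> v = 1 \<longleftrightarrow> v \<in> U \<and> arr \<tau>3 aTG (rep v) 0 \<noteq> 0) \<tau>3"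
        by (rule answer[OF statD(1,2)[OF st3]]) (use lf a3 o1 o2 o3 z(3) in \<open>auto simp: leafs_def\<close>)
      thus "wp answer (\<lambda>\<tau>. ssg_solution s c G {v. v < n \<and> out \<tau> v = 1}) \<tau>3"
      proof (rule wp_mono)
        fix \<tau> assume a: "\<forall>v<n. out \<tau> v = 1 \<longleftrightarrow> v \<in> U \<and> arr \<tau>3 aTG (rep v) 0 \<noteq> 0"
        have A: "{v. v < n \<and> out \<tau> v = 1} = {v. v \<in> U \<and> arr \<tau>3 aTG (rep v) 0 \<noteq> 0}" using a U_lt by blast
        show "ssg_solution s c G {v. v < n \<and> out \<tau> v = 1}"
        proof (cases "U = {}")
          case False
          show ?thesis unfolding A
            by (rule solution_from_trace[OF ST2, where rt = ?h and t = ?b])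
              (use bd v1 v2 nd h[OF False] False P2 P3 Tb[OF False] a2 in \<open>auto simp: nodes_def\<close>)
        next
          case True
          have "ssg_feasible s c G B \<longleftrightarrow> B = {}" for B
            unfolding feasible_iff using True by (auto simp: closed_in_def)
          thus ?thesis unfolding A using True by (simp add: ssg_solution_def is_arg_max_def)
        qed
      qed
    qed
  qed
qed

section \<open>Composition of the phases\<close>

definition start :: st where "start = \<lparr>var = \<lambda>_. 0, arr = \<lambda>_ _ _. 0, out = \<lambda>_. 0\<rparr>"

lemma program:
  "wp program (\<lambda>\<tau>. ssg_solution s c G {v. v < n \<and> out \<tau> v = 1}) start"
proof -
  let ?Q = "\<lambda>\<tau>. ssg_solution s c G {v. v < n \<and> out \<tau> v = 1}"
  let ?s = "set_var vC (Suc c) (set_var vc c (set_var vn n start))"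
  have d0: "dims ?s" by (simp add: dims_def)
  have z0: "arr ?s a i j = 0" "out ?s i = 0" for a i j by (simp_all add: start_def)
  have "wp (Sq closures (Sq ranks (Sq sorting (Sq merging (Sq rooting (Sq tables (Sq best (Sq trace answer)))))))) ?Q ?s"
  proof (rule wp_step[OF closures[OF d0 z0(1)]])
    show "no_out closures" by (simp add: program_defs)
    fix \<tau>1 assume sm: "same (wv closures) (wa closures) ?s \<tau>1" and cl: "\<forall>v<n. closure_ok v \<tau>1" and o1: "out \<tau>1 = out ?s"
    have d1: "dims \<tau>1" using dims_same[OF sm d0] by (simp add: program_defs)
    have z1: "arr \<tau>1 aTB i j = 0" "arr \<tau>1 aDEAD i j = 0" "arr \<tau>1 aTG i j = 0" for i j
      using same_arr[OF sm] z0 by (simp_all add: program_defs)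
    show "wp (Sq ranks (Sq sorting (Sq merging (Sq rooting (Sq tables (Sq best (Sq trace answer))))))) ?Q \<tau>1"
    proof (rule wp_step[OF ranks[OF d1 _ z1(1)]])
      show "closure_ok v \<tau>1" if "v < n" for v using cl that by blast
      show "no_out ranks" by (simp add: program_defs)
      fix \<tau>2 assume sm2: "same (wv ranks) (wa ranks) \<tau>1 \<tau>2" and rk: "(\<forall>v<n. rank_ok v \<tau>2) \<and> (\<forall>v\<ge>n. \<forall>t. arr \<tau>2 aTB v t = 0)" and o2: "out \<tau>2 = out \<tau>1"
      have d2: "dims \<tau>2" using dims_same[OF sm2 d1] by (simp add: program_defs)
      have z2: "arr \<tau>2 aDEAD i j = 0" "arr \<tau>2 aTG i j = 0" for i j
        using same_arr[OF sm2] z1 by (simp_all add: program_defs)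
      have a2: "arr \<tau>2 aRL = arr \<tau>1 aRL" "arr \<tau>2 aLEN = arr \<tau>1 aLEN" "arr \<tau>2 aWT = arr \<tau>1 aWT"
        using same_arr[OF sm2] by (simp_all add: program_defs)
      show "wp (Sq sorting (Sq merging (Sq rooting (Sq tables (Sq best (Sq trace answer)))))) ?Q \<tau>2"
      proof (rule wp_step[OF sorting[OF d2]])
        show "rank_ok v \<tau>2" if "v < n" for v using rk that by blast
        show "no_out sorting" by (simp add: program_defs)
        fix \<tau>3 assume sm3: "same (wv sorting) (wa sorting) \<tau>2 \<tau>3" and so: "ordered c 0 (ord \<tau>3)" and o3: "out \<tau>3 = out \<tau>2"
        have d3: "dims \<tau>3" using dims_same[OF sm3 d2] by (simp add: program_defs)
        have a3: "arr \<tau>3 a = arr \<tau>2 a" if "a \<noteq> aORD" for a using same_arr[OF sm3] that by (simp add: program_defs)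
        have st3: "stat (ord \<tau>3) \<tau>3"
          using d3 so cl rk closure_ok_cong[of \<tau>3 \<tau>1] a2 by (simp add: stat_def a3 rank_ok_def)
        have lf3: "leafs \<tau>3" using rk U_lt by (auto simp: leafs_def a3 rank_ok_def)
        show "wp (Sq merging (Sq rooting (Sq tables (Sq best (Sq trace answer))))) ?Q \<tau>3"
        proof (rule wp_step[OF merging[OF st3]])
          show "arr \<tau>3 aCUR v 0 = rep v" if "v \<in> U" for v using rk U_lt[OF that] that by (simp add: a3 rank_ok_def)
          show "arr \<tau>3 aDEAD i 0 = 0" for i using z2 by (simp add: a3)
          show "no_out merging" by (simp add: program_defs)
          fix \<tau>4 assume sm4: "same (wv merging) (wa merging) \<tau>3 \<tau>4" and mg: "merged 0 U \<tau>4" and o4: "out \<tau>4 = out \<tau>3"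
          have st4: "stat (ord \<tau>3) \<tau>4" by (rule stat_same[OF sm4 st3]) (auto simp: program_defs)
          have a4: "arr \<tau>4 aREP = arr \<tau>3 aREP" "arr \<tau>4 aTB = arr \<tau>3 aTB" "arr \<tau>4 aTG = arr \<tau>3 aTG"
            using same_arr[OF sm4] by (simp_all add: program_defs)
          show "wp (Sq rooting (Sq tables (Sq best (Sq trace answer)))) ?Q \<tau>4"
          proof (rule wp_step[OF rooting[OF st4 mg]])
            show "no_out rooting" by (simp add: program_defs)
            fix \<tau>5 assume sm5: "same (wv rooting) (wa rooting) \<tau>4 \<tau>5" and o5: "out \<tau>5 = out \<tau>4"
              and "\<exists>Nd. nodes \<tau>5 Nd \<and> (if U = {} then var \<tau>5 vh = 2 * n \<and> var \<tau>5 vnd = n else var \<tau>5 vh \<in> alive \<tau>5 \<and> Nd (var \<tau>5 vh) = U)"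
            then obtain Nd where Nd: "nodes \<tau>5 Nd" "if U = {} then var \<tau>5 vh = 2 * n \<and> var \<tau>5 vnd = n else var \<tau>5 vh \<in> alive \<tau>5 \<and> Nd (var \<tau>5 vh) = U" by blast
            have st5: "stat (ord \<tau>3) \<tau>5" by (rule stat_same[OF sm5 st4]) (auto simp: program_defs)
            have a5: "arr \<tau>5 aREP = arr \<tau>3 aREP" "arr \<tau>5 aTB = arr \<tau>2 aTB" "arr \<tau>5 aTG = arr \<tau>2 aTG"
              using same_arr[OF sm5] a4 by (simp_all add: program_defs a3)
            show "wp (Sq tables (Sq best (Sq trace answer))) ?Q \<tau>5"
            proof (rule final_phase[OF st5 Nd])
              show "leafs \<tau>5" using lf3 by (simp add: leafs_def a5 a3)
              show "arr \<tau>5 aTB i t = 0" if "n \<le> i" for i t using rk that by (simp add: a5)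
              show "arr \<tau>5 aTG i 0 = 0" for i using z2 by (simp add: a5)
              show "out \<tau>5 i = 0" for i using o1 o2 o3 o4 o5 z0 by simp
            qed
          qed
        qed
      qed
    qed
  qed
  moreover have "n \<le> X" "c \<le> X" "Suc c \<le> X" using n_le_X c_le_X by auto
  ultimately show ?thesis unfolding program_def read_header_def
    by (subst wp_simps(5)) (use inp_len in \<open>simp add: inp_n inp_c\<close>)
qed

end

text \<open>The address computation expects the number of columns in register 0 and the length of
  the output in register 1. The first scratch register is 28: two reserved registers and 26
  variables come before it.\<close>

definition ram_program :: com where
  "ram_program = Seq (ReadInput 1 (Imm 0)) (Seq (ReadInput 0 (Imm 1)) (Seq (Assign 0 Add (Reg 0) (Imm 1)) (ccm 28 program)))"

lemma wf_program: "wf_cm 26 program"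
  by (simp add: program_def read_header_def program_defs tables_def cell_def best_def trace_def answer_def
     size_ex_def offset_ex_def target_ex_def)

context ssg
begin

text \<open>2556 is the sum of the five coefficients; every monomial is at most
  \<open>n * c * c\<close> because \<open>n\<close> and \<open>c\<close> are positive.\<close>

lemma time_bound: "tm \<beta> program \<le> 2556 * (n * c\<^sup>2)"
proof -
  have tm: "tm \<beta> program = 89 + 31 * c + 1055 * n + 1006 * (n * c) + 375 * (n * c * c)"
    by (simp add: program_def read_header_def program_defs tables_def cell_def best_def trace_def answer_def
      \<beta>_def size_ex_def offset_ex_def target_ex_def algebra_simps)
  have "1 \<le> n * c * c" "n \<le> n * c * c" "c \<le> n * c * c" "n * c \<le> n * c * c"
    using n_pos c_pos by (auto simp: Suc_le_eq)
  hence "tm \<beta> program \<le> 2556 * (n * c * c)" unfolding tm by linarith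
  thus ?thesis by (simp add: power2_eq_square mult.assoc)
qed

text \<open>2559 is the 2556 of the time bound plus the three instructions in front of the compiled
  code, and it also covers the factor 97 for space. In \<open>k\<close>, the part
  \<open>2 * weight_cm program\<close> pays for intermediate values, estimated in base
  \<open>M ^ 2\<close>, and \<open>C + 2\<close> for the number of cells.\<close>

lemma ram_run:
  assumes C: "2559 \<le> C" and k: "2 * weight_cm program + C + 2 \<le> k"
  shows "\<exists>t \<sigma>. exec inp (C * (n * c)) (max_word k inp) ram_program initial_state t \<sigma> \<and>
    t \<le> C * (n * c\<^sup>2 + card (parcs G)) \<and> ssg_solution s c G (output_set n \<sigma>)"
proof -
  define M where "M = length inp + Max (set inp)"
  let ?S = "C * (n * c)" and ?W = "max_word k inp" and ?Y = "M ^ 2"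
  have M: "3 \<le> M" "n \<le> M" "c \<le> M" and X_M: "X = 2 * M"
    using inp_len inp_le_Max[of "Suc 0"] inp_c by (auto simp: M_def X_def)
  have W: "?W = M ^ k" by (simp add: max_word_def M_def)
  have pw: "M ^ a \<le> ?W" if "a \<le> k" for a unfolding W using M that by (intro power_increasing) auto
  have SW: "?S \<le> ?W"
  proof -
    have "C \<le> 2 ^ C" by (rule less_imp_le[OF less_exp])
    also have "\<dots> \<le> M ^ C" using M by (intro power_mono) auto
    finally have "?S \<le> M ^ C * (M * M)" using M by (intro mult_le_mono) auto
    also have "\<dots> = M ^ (C + 2)" by (simp add: power_add power2_eq_square)
    also have "\<dots> \<le> ?W" using k by (intro pw) simp
    finally show ?thesis .
  qed
  \<comment> \<open>Stored values may reach \<open>2 * M\<close>, so \<open>M\<close> itself is too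
    small as a base; its square suffices because \<open>M \<ge> 3\<close>.\<close>
  have Y: "2 \<le> ?Y" "X \<le> ?Y"
    using mult_le_mono[OF M(1) M(1)] mult_le_mono1[of 2 M M] M X_M by (auto simp: power2_eq_square)
  have XW: "X \<le> ?W" using Y(2) pw[of 2] k by simp
  have nc: "n \<le> n * c" "1 \<le> n * c" "c \<le> n * c" using n_pos c_pos by (auto simp: Suc_le_eq)
  have "NI * NJ \<le> (3 * n) * (2 * c)" using n_pos c_pos by (intro mult_le_mono) (auto simp: NI_def NJ_def)
  hence "NI * NJ \<le> 6 * (n * c)" by simp
  \<comment> \<open>Sixteen arrays of at most \<open>6 * (n * c)\<close> cells and the output of
    length \<open>n\<close>: 16 times 6 plus 1 is 97.\<close>
  hence "n + 16 * (NI * NJ) \<le> 97 * (n * c)" using nc by linarith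
  also have "\<dots> \<le> ?S" using C by (intro mult_le_mono1) simp
  finally have space: "n + 16 * (NI * NJ) \<le> ?S" .
  have cmp: "compiled inp n NI NJ X ?S ?W ?Y"
    by unfold_locales (use space SW XW Y inp_le_X in auto)
  let ?\<rho> = "\<lparr> regs = (\<lambda>_. 0)(1 := n, 0 := NJ), mem = \<lambda>_. 0 \<rparr>"
  have rel: "compiled.rel n NI NJ 26 ?\<rho> start"
    by (simp add: compiled.rel_def[OF cmp] start_def)
  have bd: "compiled.bounded X start" by (simp add: compiled.bounded_def[OF cmp] start_def)
  have pr: "safe program start" "ssg_solution s c G {v. v < n \<and> out (run inp program start) v = 1}"
    using program by (auto simp: wp_def)
  have "?Y ^ weight_cm program = M ^ (2 * weight_cm program)" by (simp add: power_mult)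
  also have "\<dots> \<le> ?W" using k by (intro pw) simp
  finally have wt: "?Y ^ weight_cm program \<le> ?W" .
  have "compiled.cexec inp ?S ?W (ccm (26 + 2) program) ?\<rho> (tm \<beta> program)
     (\<lambda>\<rho>'. compiled.rel n NI NJ 26 \<rho>' (run inp program start) \<and> compiled.bounded X (run inp program start))"
    by (rule compiled.exec_ccm[OF cmp pr(1) bd wf_program rel wt])
  then obtain t \<rho>' where ex: "exec inp ?S ?W (ccm 28 program) ?\<rho> t \<rho>'" "t \<le> tm \<beta> program"
    and rel': "compiled.rel n NI NJ 26 \<rho>' (run inp program start)"
    by (auto simp: compiled.cexec_def[OF cmp])
  have len: "0 < length inp" "Suc 0 < length inp" using inp_len by auto
  have nW: "n \<le> ?W" "c \<le> ?W" "c + 1 \<le> ?W" using n_le_X c_le_X XW by auto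
  let ?\<rho>1 = "set_reg 1 n initial_state" let ?\<rho>2 = "set_reg 0 c ?\<rho>1"
  have e1: "exec inp ?S ?W (ReadInput 1 (Imm 0)) initial_state 1 ?\<rho>1"
    using exec.ReadInput[of 0 initial_state "Imm 0" inp ?W ?S 1] len nW inp_n by simp
  have e2: "exec inp ?S ?W (ReadInput 0 (Imm 1)) ?\<rho>1 1 ?\<rho>2"
    using exec.ReadInput[of 1 ?\<rho>1 "Imm 1" inp ?W ?S 0] len nW inp_c by simp
  have e3: "exec inp ?S ?W (Assign 0 Add (Reg 0) (Imm 1)) ?\<rho>2 1 (set_reg 0 (c + 1) ?\<rho>2)"
    by (rule exec.Assign) (use nW in \<open>auto simp: set_reg_def\<close>)
  have "set_reg 0 (c + 1) ?\<rho>2 = ?\<rho>" by (auto simp: set_reg_def initial_state_def NJ_def fun_eq_iff)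
  hence "exec inp ?S ?W ram_program initial_state (1 + (1 + (1 + t))) \<rho>'"
    unfolding ram_program_def using e1 e2 e3 ex(1) by (metis exec.Seq)
  moreover have "1 + (1 + (1 + t)) \<le> C * (n * c\<^sup>2 + card (parcs G))"
  proof -
    have "1 \<le> n * c\<^sup>2" using n_pos c_pos by (simp add: Suc_le_eq)
    hence "1 + (1 + (1 + t)) \<le> 2559 * (n * c\<^sup>2)" using ex(2) time_bound by linarith
    also have "\<dots> \<le> C * (n * c\<^sup>2 + card (parcs G))" using C by (intro mult_le_mono) auto
    finally show ?thesis .
  qed
  moreover have "output_set n \<rho>' = {v. v < n \<and> out (run inp program start) v = 1}"
    using rel' by (auto simp: compiled.rel_def[OF cmp] output_set_def)
  ultimately show ?thesis using pr(2) by metis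
qed

end

theorem theorem2:
  shows "\<exists>(p :: com) (C :: nat) (k :: nat).
    \<forall>(n :: nat) (s :: nat \<Rightarrow> nat) (c :: nat) (G :: nat pair_pre_digraph) (adj :: nat \<Rightarrow> nat list).
      ssg_instance n s c G \<and> directed_cograph G \<and> adjacency_lists n G adj \<longrightarrow>
      (let inp = encode_instance n s c adj; m = card (parcs G) in
        \<exists>t \<sigma>. exec inp (C * (n * c)) (max_word k inp) p initial_state t \<sigma>
          \<and> t \<le> C * (n * c\<^sup>2 + m)
          \<and> ssg_solution s c G (output_set n \<sigma>))"
proof (intro exI allI impI)
  fix n s c and G :: "nat pair_pre_digraph" and adj
  assume "ssg_instance n s c G \<and> directed_cograph G \<and> adjacency_lists n G adj"
  then interpret ssg n s c G adj by unfold_locales auto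
  show "let inp = encode_instance n s c adj; m = card (parcs G) in
        \<exists>t \<sigma>. exec inp (2559 * (n * c)) (max_word (2 * weight_cm program + 2559 + 2) inp) ram_program initial_state t \<sigma>
          \<and> t \<le> 2559 * (n * c\<^sup>2 + m)
          \<and> ssg_solution s c G (output_set n \<sigma>)"
    using ram_run[OF order_refl order_refl] by (simp only: Let_def inp_def)
qed

end
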